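(* Let $d\ge1$ and $n\ge d+1$, let $\tau_1,\ldots,\tau_n>0$, and let $g_1,\ldots,g_n$ be independent $\mathbb R^d$-valued standard Gaussian random vectors. Then $$\mathbb E\operatorname{Vol}_d\bigl([g_1/\tau_1,\ldots,g_n/\tau_n]\bigr)=\frac{2^{d/2}\,\Gamma\bigl(\frac{d+1}2\bigr)}{\sqrt\pi\,d!}\sum_{1\le i_1<\cdots<i_{d+1}\le n}\frac{\sqrt{\tau_{i_1}^2+\cdots+\tau_{i_{d+1}}^2}}{\tau_{i_1}\cdots\tau_{i_{d+1}}}\ \mathbf g_{n-d-1}\bigl(\tau_{i_1}^2+\cdots+\tau_{i_{d+1}}^2;\ \tau_{j_1}^2,\ldots,\tau_{j_{n-d-1}}^2;\ 1,\ldots,1\bigr),$$ where $j_1,\ldots,j_{n-d-1}$ are defined via $\{i_1,\ldots,i_{d+1}\}\cup\{j_1,\ldots,j_{n-d-1}\}=\{1,\ldots,n\}$.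
   Context: $[\ldots]$ denotes the convex hull, $\operatorname{Vol}_d$ the $d$-dimensional volume. Function $\mathbf g_m$: for $m\in\mathbb N$ and $\lambda_0,\lambda_1,\ldots,\lambda_m>0$, $\mathbf g_m(\lambda_0;\lambda_1,\ldots,\lambda_m;1,\ldots,1):=\mathbb P[\eta_1<0,\ldots,\eta_m<0]$, where $(\eta_1,\ldots,\eta_m)$ is a centered Gaussian vector with covariance matrix $\bigl(\frac1{\lambda_0}+\frac{\delta_{ij}}{\lambda_i}\bigr)_{i,j=1}^m$. Also $\mathbf g_0(\lambda_0):=1$ for all $\lambda_0\in\mathbb R$. *)

theory Defs
  imports
    "HOL-Probability.Probability"
    "Jordan_Normal_Form.Gauss_Jordan_Elimination"
    "Jordan_Normal_Form.Determinant"
begin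

text \<open>The coordinates in the orthonormal basis are independent and \<open>N(0,1)\<close>-distributed.\<close>

definition std_gaussian_vector ::
    "'w measure \<Rightarrow> ('w \<Rightarrow> 'a::euclidean_space) \<Rightarrow> bool" where
  "std_gaussian_vector M X \<longleftrightarrow>
     prob_space.indep_vars M (\<lambda>_. borel) (\<lambda>b \<omega>. inner (X \<omega>) b) Basis \<and>
     (\<forall>b\<in>Basis. distributed M lborel (\<lambda>\<omega>. inner (X \<omega>) b) std_normal_density)"

text \<open>
  The law \<open>N(0,S)\<close> on \<open>\<real>\<^sup>m\<close> of a centered Gaussian vector \<open>(\<eta>\<^sub>0,\<dots>,\<eta>\<^sub>m\<^sub>-\<^sub>1)\<close> whose covariance
  matrix \<open>S\<close> is positive definite, given by the density
  \<open>exp (- x\<^sup>T S\<^sup>-\<^sup>1 x / 2) / ((2\<pi>)\<^sup>m det S)\<^sup>1\<^sup>/\<^sup>2\<close>. As \<open>m\<close> varies, \<open>\<real>\<^sup>m\<close> is the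
  product over the index set \<open>{..<m}\<close>. The definition is meaningful only for positive definite \<open>S\<close>.
\<close>

definition centered_gaussian :: "nat \<Rightarrow> real mat \<Rightarrow> (nat \<Rightarrow> real) measure" where
  "centered_gaussian m S =
     density (\<Pi>\<^sub>M i\<in>{..<m}. lborel)
       (\<lambda>x. ennreal
          (exp (- (\<Sum>i<m. \<Sum>j<m. the (mat_inverse S) $$ (i, j) * x i * x j) / 2)
           / sqrt ((2 * pi) ^ m * Determinant.det S)))"

definition g_cov :: "real \<Rightarrow> real list \<Rightarrow> real mat" where
  "g_cov l0 ls =
     Matrix.mat (length ls) (length ls)
       (\<lambda>(i, j). 1 / l0 + (if i = j then 1 / ls ! i else 0))"

text \<open>
  \<open>gfun \<lambda>\<^sub>0 [\<lambda>\<^sub>1,\<dots>,\<lambda>\<^sub>m]\<close> is \<open>g\<^sub>m(\<lambda>\<^sub>0; \<lambda>\<^sub>1,\<dots>,\<lambda>\<^sub>m; 1,\<dots>,1)\<close>. For \<open>m \<ge> 1\<close> it is meaningful only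
  when all arguments are positive; the covariance matrix is then positive definite.
\<close>

definition gfun :: "real \<Rightarrow> real list \<Rightarrow> real" where
  "gfun l0 ls =
     (if ls = [] then 1
      else let N = centered_gaussian (length ls) (g_cov l0 ls)
           in measure N {\<eta> \<in> space N. \<forall>i<length ls. \<eta> i < 0})"

end

theory Submission
  imports Defs
begin

text \<open>
  Lift the points \<open>g\<^sub>i / \<tau>\<^sub>i\<close> to dimension \<open>d + 1\<close> by heights \<open>u\<^sub>i / \<tau>\<^sub>i\<close> with \<open>u\<^sub>i\<close> independent
  standard normal. Almost surely the simplices \<open>I\<close> whose lifted hyperplane lies above all other
  lifted points triangulate the convex hull, so its volume is the sum over all \<open>I\<close> of the volume
  of the simplex times the indicator of this event. Given \<open>I\<close>, write the hyperplane as
  \<open>u\<^sub>i = v \<bullet> g\<^sub>i + s \<tau>\<^sub>i\<close>. The remaining points lie below it independently, each with probability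
  \<open>\<Phi>(\<tau>\<^sub>j z)\<close> where \<open>z = s / sqrt (1 + |v|\<^sup>2)\<close>. The substitution \<open>u \<mapsto> (v, s)\<close> has Jacobian
  \<open>|det (g, \<tau>)|\<close>, which is proportional to the volume of the simplex, and completing the square in
  the \<open>g\<^sub>i\<close> leaves \<open>det (g, \<tau>)\<close> unchanged up to a factor depending on \<open>v\<close> only. Hence, weighted by
  the volume, \<open>z\<close> is \<open>N(0, 1 / \<Sum>\<tau>\<^sub>i\<^sup>2)\<close>, and averaging \<open>\<Prod>\<Phi>(\<tau>\<^sub>j z)\<close> over this law gives
  \<open>g\<^sub>m\<close>.
\<close>

no_notation Matrix.vec_index (infixl "$" 100)
no_notation Matrix.scalar_prod (infix "\<bullet>" 70)
hide_const (open) Determinant.det Matrix.mat Matrix.row Matrix.col Matrix.vec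
hide_fact (open) Determinant.det_def Matrix.vec_eq_iff Matrix.mat_def Matrix.row_def Determinant.det_rows_mul
  Determinant.det_permute_rows

section \<open>Determinants of augmented matrices\<close>

text \<open>The lifting makes the determinant tractable. The volume alone contributes the absolute
  value |det (g, tau)|, awkward to average over the random event that a simplex belongs to the
  triangulation. The Jacobian contributes a second such factor, and the square is a polynomial whose
  Gaussian mean is a finite sum of moments: d! times the sum of the tau_i^2. Dividing the heights by
  the same tau_i as the points keeps the hyperplane equations linear in g_i and u_i.

  Origin of the constant, with r = sqrt (1 + |v|^2): the d + 1 densities of the observations give
  r^-(d+1), the squared determinant gives r^-2, and ds = r dz gives r. The integral of r^-(d+2) over
  v is pi^(d/2) / Gamma (d/2 + 1). Together with d! from the second moment and (2 pi)^(-d/2) from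
  the densities, Legendre duplication turns this into 2^(d/2) Gamma ((d+1)/2) / sqrt pi.\<close>

lemma prod_option_UNIV:
  fixes f :: "'d::finite option \<Rightarrow> 'a::comm_monoid_mult"
  shows "(\<Prod>i\<in>UNIV. f i) = f None * (\<Prod>b\<in>UNIV. f (Some b))"
  unfolding UNIV_option_conv by (subst prod.insert) (auto simp: prod.reindex)

lemma sum_option_UNIV:
  fixes f :: "'d::finite option \<Rightarrow> 'a::comm_monoid_add"
  shows "(\<Sum>i\<in>UNIV. f i) = f None + (\<Sum>b\<in>UNIV. f (Some b))"
  unfolding UNIV_option_conv by (subst sum.insert) (auto simp: sum.reindex)

text \<open>Expansion along the column \<open>None\<close>: a permutation that moves
  \<open>None\<close> sends some row \<open>Some k\<close> to that column and contributes zero. Only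
  the permutations of \<open>range Some\<close> remain, and they are transported to
  \<open>'d\<close>.\<close>

lemma det_option_block:
  fixes A :: "real ^ ('d::finite option) ^ ('d option)"
  assumes zero: "\<And>i. A $ Some i $ None = 0"
  shows "det A = det (\<chi> i j. A $ Some i $ Some j) * A $ None $ None"
proof -
  let ?h = "\<lambda>p. of_int (sign p) * (\<Prod>i\<in>UNIV. A $ i $ p i)"
  let ?R = "range (Some :: 'd \<Rightarrow> _)"
  have UNIV_eq: "UNIV = insert None ?R"
    by (rule UNIV_option_conv)
  have "det A = sum ?h {p. p permutes UNIV}"
    by (simp add: det_def)
  also have "\<dots> = sum ?h {p. p permutes ?R}"
  proof (rule sum.mono_neutral_right)
    show "finite {p::'d option \<Rightarrow> 'd option. p permutes UNIV}" by simp
    show "{p. p permutes ?R} \<subseteq> {p. p permutes UNIV}"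
      using permutes_subset by blast
    show "\<forall>p\<in>{p. p permutes UNIV} - {p. p permutes ?R}. ?h p = 0"
    proof
      fix p :: "'d option \<Rightarrow> 'd option"
      assume "p \<in> {p. p permutes UNIV} - {p. p permutes ?R}"
      then have p: "p permutes UNIV" and np: "\<not> p permutes ?R" by auto
      have "p None \<noteq> None"
      proof
        assume "p None = None"
        then have "p permutes ?R"
          using p permutes_superset[of p UNIV ?R] by (auto simp: UNIV_eq)
        with np show False by simp
      qed
      obtain i where i: "p i = None" using p by (metis permutes_univ)
      with \<open>p None \<noteq> None\<close> obtain k where "i = Some k" by (cases i) auto
      with i zero have "A $ i $ p i = 0" by simp
      then show "?h p = 0" by (metis UNIV_I finite_class.finite_UNIV mult_zero_right prod_zero)
    qed
  qed
  also have "\<dots> = (\<Sum>q | q permutes (UNIV::'d set).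
      of_int (sign q) * (\<Prod>i\<in>UNIV. A $ Some i $ Some (q i)) * A $ None $ None)"
  proof (rule sym, rule sum.reindex_bij_witness[where i = "map_permutation ?R the" and j = "map_permutation UNIV Some"])
    fix q :: "'d \<Rightarrow> 'd" assume "q \<in> {q. q permutes UNIV}"
    then have q: "q permutes UNIV" by simp
    have b: "bij_betw (Some :: 'd \<Rightarrow> _) UNIV ?R" by (simp add: bij_betw_def)
    show "map_permutation ?R the (map_permutation UNIV Some q) = q"
      by (rule map_permutation_compose_inv[OF b q]) simp
    show mp: "map_permutation UNIV Some q \<in> {p. p permutes ?R}"
      using map_permutation_permutes[OF b q] by simp
    have s: "sign (map_permutation UNIV Some q) = sign q"
      using sign_map_permutation[of Some UNIV q] q by simp
    have "map_permutation UNIV Some q None = None"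
      using mp by (auto simp: permutes_def)
    moreover have "map_permutation UNIV Some q (Some i) = Some (q i)" for i
      by (rule map_permutation_apply) auto
    ultimately show "of_int (sign (map_permutation UNIV Some q)) * (\<Prod>i\<in>UNIV. A $ i $ map_permutation UNIV Some q i)
       = of_int (sign q) * (\<Prod>i\<in>UNIV. A $ Some i $ Some (q i)) * A $ None $ None"
      by (simp add: s prod_option_UNIV)
  next
    fix p :: "'d option \<Rightarrow> 'd option" assume "p \<in> {p. p permutes ?R}"
    then have p: "p permutes ?R" by simp
    have b: "bij_betw the ?R (UNIV :: 'd set)"
      by (rule bij_betw_byWitness[where f' = Some]) auto
    show "map_permutation UNIV Some (map_permutation ?R the p) = p"
      by (rule map_permutation_compose_inv[OF b p]) auto
    show "map_permutation ?R the p \<in> {q. q permutes UNIV}"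
      using map_permutation_permutes[OF b p] by simp
  qed
  also have "\<dots> = det (\<chi> i j. A $ Some i $ Some j) * A $ None $ None"
    by (simp add: det_def sum_distrib_right)
  finally show ?thesis .
qed

text \<open>The type \<open>'d option\<close> has one element more than \<open>'d\<close>: as row
  index it numbers the d + 1 vertices, as column index its \<open>None\<close> carries the
  homogenising coordinate. If \<open>t i\<close> is nonzero, row \<open>i\<close> is
  \<open>t i\<close> times the affine row of the point \<open>G i /\<^sub>R t i\<close>.\<close>

definition aug :: "('d::finite option \<Rightarrow> real ^ 'd) \<Rightarrow> ('d option \<Rightarrow> real) \<Rightarrow> real ^ ('d option) ^ ('d option)" where
  "aug G t = (\<chi> i j. case j of None \<Rightarrow> t i | Some b \<Rightarrow> G i $ b)"

definition split_opt :: "real ^ ('d::finite option) \<Rightarrow> (real ^ 'd) \<times> real" where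
  "split_opt x = (\<chi> b. x $ Some b, x $ None)"

definition join_opt :: "(real ^ 'd::finite) \<times> real \<Rightarrow> real ^ ('d option)" where
  "join_opt p = (\<chi> i. case i of None \<Rightarrow> snd p | Some b \<Rightarrow> fst p $ b)"

lemma join_opt_nth [simp]: "join_opt p $ None = snd p" "join_opt p $ Some b = fst p $ b"
  by (simp_all add: join_opt_def)

lemma split_join_opt [simp]: "split_opt (join_opt p) = p"
  by (simp add: split_opt_def prod_eq_iff vec_eq_iff)

lemma join_split_opt [simp]: "join_opt (split_opt x) = x"
  by (auto simp: split_opt_def join_opt_def vec_eq_iff split: option.split)

lemma aug_mult_join: "(aug G t *v join_opt (v, s)) $ i = v \<bullet> G i + s * t i"
  by (simp add: aug_def matrix_vector_mult_def sum_option_UNIV inner_vec_def mult.commute)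

text \<open>Shifting row \<open>i\<close> by \<open>t i\<close> times a fixed vector adds multiples
  of the column \<open>None\<close> to the other columns, so it is absorbed together with
  \<open>T\<close> into right multiplication by a block triangular matrix. Hence the substitution
  that completes the square costs only \<open>det T\<close>.\<close>

lemma det_aug_mult:
  fixes G :: "'d::finite option \<Rightarrow> real ^ 'd" and T :: "real ^ 'd ^ 'd"
  shows "det (aug (\<lambda>i. G i v* T + t i *\<^sub>R c) t) = det (aug G t) * det T"
proof -
  let ?B = "\<chi> a b. (case a of None \<Rightarrow> (case b of None \<Rightarrow> 1 | Some b' \<Rightarrow> c $ b')
     | Some a' \<Rightarrow> (case b of None \<Rightarrow> 0 | Some b' \<Rightarrow> T $ a' $ b')) :: real ^ ('d option) ^ ('d option)"
  have "aug (\<lambda>i. G i v* T + t i *\<^sub>R c) t = aug G t ** ?B"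
    by (auto simp: vec_eq_iff aug_def matrix_matrix_mult_def sum_option_UNIV vector_matrix_mult_def
        mult.commute split: option.split)
  moreover have "det ?B = det T"
    by (subst det_option_block) simp_all
  ultimately show ?thesis by (simp add: det_mul)
qed

text \<open>Subtracting the row \<open>None\<close> from the others turns the column of ones into a
  unit vector and leaves the edge vectors of the simplex.\<close>

lemma det_aug_one:
  fixes y :: "'d::finite option \<Rightarrow> real ^ 'd"
  shows "det (aug y (\<lambda>_. 1)) = det (\<chi> i j. y (Some i) $ j - y None $ j)"
proof -
  let ?L = "(\<chi> i j. if i = j then 1 else if j = None then -1 else 0) :: real ^ ('d option) ^ ('d option)"
  have one: "(\<chi> i j. if j = i then 1 else 0) = (mat 1 :: real ^ 'd ^ 'd)"
    by (auto simp: vec_eq_iff mat_def)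
  \<comment> \<open>\<open>det_option_block\<close> wants zeros in the column \<open>None\<close>.
    The entries -1 of \<open>?L\<close> stand exactly there; in the transpose they stand in the row
    \<open>None\<close>.\<close>
  have "det (transpose ?L) = 1"
    by (subst det_option_block, simp_all add: transpose_def one cong: if_cong)
  then have L: "det ?L = 1" by simp
  have "(?L ** aug y (\<lambda>_. 1)) $ None $ None = 1"
    by (simp add: matrix_matrix_mult_def aug_def sum_option_UNIV)
  moreover have "(?L ** aug y (\<lambda>_. 1)) $ Some i $ None = 0" for i
    by (simp add: matrix_matrix_mult_def aug_def sum_option_UNIV if_distrib[of "\<lambda>x. x * _"] cong: if_cong)
  moreover have "(?L ** aug y (\<lambda>_. 1)) $ Some i $ Some j = y (Some i) $ j - y None $ j" for i j
    by (simp add: matrix_matrix_mult_def aug_def sum_option_UNIV if_distrib[of "\<lambda>x. x * _"] cong: if_cong)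
  ultimately have "det (?L ** aug y (\<lambda>_. 1)) = det (\<chi> i j. y (Some i) $ j - y None $ j)"
    by (simp add: det_option_block)
  then show ?thesis by (simp add: det_mul L)
qed

lemma det_aug_scale:
  assumes "\<And>i. t i \<noteq> 0"
  shows "det (aug (\<lambda>i. G i /\<^sub>R t i) (\<lambda>_. 1)) = det (aug G t) / (\<Prod>i\<in>UNIV. t i)"
proof -
  have "aug G t = (\<chi> i. t i *s (aug (\<lambda>i. G i /\<^sub>R t i) (\<lambda>_. 1) $ i))"
    using assms by (auto simp: vec_eq_iff aug_def split: option.split)
  then have "det (aug G t) = (\<Prod>i\<in>UNIV. t i) * det (aug (\<lambda>i. G i /\<^sub>R t i) (\<lambda>_. 1))"
    using Determinants.det_rows_mul[of t "\<lambda>i. aug (\<lambda>i. G i /\<^sub>R t i) (\<lambda>_. 1) $ i"] by simp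
  moreover have "(\<Prod>i\<in>UNIV. t i) \<noteq> 0" using assms by simp
  ultimately show ?thesis by simp
qed

text \<open>Coefficients \<open>(v, s)\<close> of the affine function taking the values \<open>u\<close>, by Cramer's rule so
  that measurability is apparent; junk when the determinant vanishes.\<close>

definition hyp :: "('d::finite option \<Rightarrow> real ^ 'd) \<Rightarrow> ('d option \<Rightarrow> real) \<Rightarrow> ('d option \<Rightarrow> real) \<Rightarrow> (real ^ 'd) \<times> real" where
  "hyp G t u = split_opt (\<chi> k. det (\<chi> i j. if j = k then u i else aug G t $ i $ j) / det (aug G t))"

lemma hyp_iff:
  assumes "det (aug G t) \<noteq> 0"
  shows "hyp G t u = (v, s) \<longleftrightarrow> (\<forall>i. u i = v \<bullet> G i + s * t i)"
proof -
  have "hyp G t u = (v, s) \<longleftrightarrow> join_opt (v, s) = join_opt (hyp G t u)"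
    by (metis split_join_opt)
  also have "\<dots> \<longleftrightarrow> aug G t *v join_opt (v, s) = (\<chi> i. u i)"
    unfolding cramer[OF assms] by (simp add: hyp_def cong: if_cong)
  also have "\<dots> \<longleftrightarrow> (\<forall>i. u i = v \<bullet> G i + s * t i)"
    by (subst vec_eq_iff) (auto simp: aug_mult_join)
  finally show ?thesis .
qed

section \<open>Lebesgue measure on \<open>\<real>\<^sup>n\<close>\<close>

lemma Basis_vec_real: "(Basis :: (real ^ 'n) set) = range (\<lambda>i. axis i 1)"
  by (auto simp: Basis_vec_def)

lemma inj_axis_1: "inj (\<lambda>i::'n::finite. axis i (1::real))"
  by (auto simp: inj_def axis_eq_axis)

lemma prod_Basis_vec:
  "(\<Prod>b\<in>(Basis :: (real ^ 'n) set). F b) = (\<Prod>i\<in>UNIV. F (axis i 1))"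
  unfolding Basis_vec_real by (subst prod.reindex[OF inj_axis_1]) (simp add: o_def)

lemma sum_Basis_vec:
  "(\<Sum>b\<in>(Basis :: (real ^ 'n) set). F b) = (\<Sum>i\<in>UNIV. F (axis i 1))"
  unfolding Basis_vec_real by (subst sum.reindex[OF inj_axis_1]) (simp add: o_def)

lemma borel_measurable_vecI:
  fixes f :: "'a \<Rightarrow> real ^ 'n"
  assumes "\<And>i. (\<lambda>x. f x $ i) \<in> borel_measurable M"
  shows "f \<in> borel_measurable M"
  using assms by (subst borel_measurable_euclidean_space) (auto simp: Basis_vec_def inner_axis)

lemma borel_measurable_vec_nth' [measurable (raw)]:
  fixes f :: "'a \<Rightarrow> real ^ 'n"
  assumes "f \<in> borel_measurable M"
  shows "(\<lambda>x. f x $ i) \<in> borel_measurable M"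
proof -
  have "(\<lambda>x::real ^ 'n. x $ i) \<in> borel_measurable borel"
    by (intro borel_measurable_continuous_onI continuous_on_component continuous_on_id)
  from measurable_compose[OF assms this] show ?thesis .
qed

lemma measurable_vec_lambda:
  assumes "sets M = sets borel"
  shows "(\<lambda>f. \<chi> i. f i) \<in> borel_measurable (PiM (UNIV :: 'n::finite set) (\<lambda>_. M :: real measure))"
proof (rule borel_measurable_vecI)
  fix i
  have "(\<lambda>f. f i) \<in> measurable (PiM (UNIV :: 'n set) (\<lambda>_. M)) M" by simp
  then show "(\<lambda>f. (\<chi> i. f i) $ i) \<in> borel_measurable (PiM (UNIV :: 'n set) (\<lambda>_. M))"
    by (simp add: measurable_cong_sets[OF refl assms])
qed

lemma borel_measurable_matrix_vector_mult:
  "(\<lambda>x. A *v x) \<in> borel_measurable (borel :: (real ^ 'n::finite) measure)" for A :: "real ^ 'n ^ 'n"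
  by (intro borel_measurable_continuous_onI linear_continuous_on matrix_vector_mul_bounded_linear)

text \<open>Both measures agree on boxes. This makes Fubini over single coordinates available for
  \<open>real ^ 'n\<close>.\<close>

lemma lborel_vec:
  "distr (PiM (UNIV :: 'n::finite set) (\<lambda>_. lborel)) borel (\<lambda>f. \<chi> i. f i) = (lborel :: (real ^ 'n) measure)"
proof (rule lborel_eqI[symmetric])
  interpret product_sigma_finite "\<lambda>_::'n. lborel :: real measure" ..
  note m = measurable_vec_lambda[where 'n = 'n, OF sets_lborel]
  fix l u :: "real ^ 'n"
  assume le: "\<And>b. b \<in> Basis \<Longrightarrow> l \<bullet> b \<le> u \<bullet> b"
  have le': "l $ i \<le> u $ i" for i
    using le[of "axis i 1"] by (simp add: inner_axis)
  have "emeasure (distr (PiM UNIV (\<lambda>_::'n. lborel)) borel (\<lambda>f. \<chi> i. f i)) (box l u)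
     = emeasure (PiM UNIV (\<lambda>_::'n. lborel)) (PiE UNIV (\<lambda>i. {l $ i <..< u $ i}))"
    using m by (subst emeasure_distr)
       (auto intro!: arg_cong2[where f = emeasure] simp: space_PiM PiE_iff extensional_def mem_box_cart)
  also have "\<dots> = (\<Prod>i\<in>UNIV. ennreal (u $ i - l $ i))"
    by (subst emeasure_PiM) (auto simp: le')
  also have "\<dots> = ennreal (\<Prod>b\<in>Basis. (u - l) \<bullet> b)"
    by (simp add: prod_Basis_vec inner_axis prod_ennreal le')
  finally show "emeasure (distr (PiM UNIV (\<lambda>_::'n. lborel)) borel (\<lambda>f. \<chi> i. f i)) (box l u) =
      ennreal (\<Prod>b\<in>Basis. (u - l) \<bullet> b)" by simp
qed simp

lemma nn_integral_lborel_vec: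
  fixes F :: "real ^ 'n::finite \<Rightarrow> ennreal"
  assumes [measurable]: "F \<in> borel_measurable borel"
  shows "(\<integral>\<^sup>+x. F x \<partial>lborel) = (\<integral>\<^sup>+f. F (\<chi> i. f i) \<partial>PiM (UNIV :: 'n set) (\<lambda>_. lborel))"
proof -
  note m = measurable_vec_lambda[where 'n = 'n, OF sets_lborel]
  show ?thesis
    using m by (subst lborel_vec[symmetric], subst nn_integral_distr) auto
qed

text \<open>With the other coordinates fixed, the shear translates coordinate \<open>m\<close> by
  \<open>c * x $ n\<close>, so translation invariance in one variable suffices once that coordinate
  is integrated innermost.\<close>

lemma nn_integral_matrix_shear:
  fixes F :: "real ^ 'n::finite \<Rightarrow> ennreal" and c :: real
  assumes [measurable]: "F \<in> borel_measurable borel" and mn: "m \<noteq> n"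
  shows "(\<integral>\<^sup>+x. F (\<chi> i. if i = m then x $ m + c * x $ n else x $ i) \<partial>lborel) = (\<integral>\<^sup>+x. F x \<partial>lborel)"
proof -
  interpret product_sigma_finite "\<lambda>_::'n. lborel :: real measure" ..
  have U: "(UNIV :: 'n set) = insert m (UNIV - {m})" by auto
  note m1 = measurable_vec_lambda[where 'n = 'n, OF sets_lborel]
  have m2: "(\<lambda>x::real^'n. \<chi> i. if i = m then x $ m + c * x $ n else x $ i) \<in> borel_measurable borel"
    by (rule borel_measurable_vecI) simp
  let ?P = "PiM (UNIV - {m}) (\<lambda>_::'n. lborel)"
  have *: "(\<integral>\<^sup>+x. H x \<partial>lborel) = (\<integral>\<^sup>+x. \<integral>\<^sup>+y. H (\<chi> i. (x(m := y)) i) \<partial>lborel \<partial>?P)"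
    if H: "H \<in> borel_measurable borel" for H :: "real ^ 'n \<Rightarrow> ennreal"
  proof -
    have "(\<integral>\<^sup>+x. H x \<partial>lborel) = (\<integral>\<^sup>+f. H (\<chi> i. f i) \<partial>PiM (insert m (UNIV - {m})) (\<lambda>_. lborel))"
      using nn_integral_lborel_vec[OF H] U by simp
    also have "\<dots> = (\<integral>\<^sup>+x. \<integral>\<^sup>+y. H (\<chi> i. (x(m := y)) i) \<partial>lborel \<partial>?P)"
      using H m1 U by (intro product_nn_integral_insert) auto
    finally show ?thesis .
  qed
  have "(\<integral>\<^sup>+y. F (\<chi> i. if i = m then (\<chi> i. (x(m := y)) i) $ m + c * (\<chi> i. (x(m := y)) i) $ n else (\<chi> i. (x(m := y)) i) $ i) \<partial>lborel)
    = (\<integral>\<^sup>+y. F (\<chi> i. (x(m := y)) i) \<partial>lborel)" for x :: "'n \<Rightarrow> real"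
  proof -
    have "(\<lambda>y. \<chi> i. (x(m := y)) i) \<in> borel_measurable (borel :: real measure)"
      by (rule borel_measurable_vecI) simp
    from measurable_compose[OF this assms(1)] have "(\<integral>\<^sup>+y. F (\<chi> i. (x(m := y)) i) \<partial>lborel) = (\<integral>\<^sup>+y. F (\<chi> i. (x(m := c * x n + 1 * y)) i) \<partial>lborel)"
      by (subst nn_integral_real_affine[where c = 1 and t = "c * x n"]) (auto simp: fun_upd_def)
    also have "(\<lambda>y. \<chi> i. (x(m := c * x n + 1 * y)) i) =
      (\<lambda>y. \<chi> i. if i = m then (\<chi> i. (x(m := y)) i) $ m + c * (\<chi> i. (x(m := y)) i) $ n else (\<chi> i. (x(m := y)) i) $ i)"
      using mn by (auto simp: fun_eq_iff vec_eq_iff)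
    finally show ?thesis by (simp add: fun_eq_iff)
  qed
  then show ?thesis
    using m2 by (simp add: *)
qed

text \<open>The formula is multiplicative in \<open>A\<close>, so it is checked on generators:
  diagonal matrices, coordinate swaps and shears. It serves for simplex volumes, for completing the
  square and for the passage from heights to hyperplanes.\<close>

proposition nn_integral_matrix:
  fixes F :: "real ^ 'n::finite \<Rightarrow> ennreal" and A :: "real ^ 'n ^ 'n"
  assumes "F \<in> borel_measurable borel" and "det A \<noteq> 0"
  shows "(\<integral>\<^sup>+x. F x \<partial>lborel) = ennreal \<bar>det A\<bar> * (\<integral>\<^sup>+x. F (A *v x) \<partial>lborel)"
proof -
  have mA: "(\<lambda>x. A *v x) \<in> borel_measurable borel" for A :: "real ^ 'n ^ 'n"
    by (rule borel_measurable_matrix_vector_mult)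
  \<comment> \<open>Keeping \<open>det A \<noteq> 0\<close> inside the induction predicate makes the
    zero-row case vacuous, and it passes from a product to both factors.\<close>
  define P where "P = (\<lambda>A :: real ^ 'n ^ 'n. det A \<noteq> 0 \<longrightarrow> (\<forall>F \<in> borel_measurable borel.
    (\<integral>\<^sup>+x. F x \<partial>lborel) = ennreal \<bar>det A\<bar> * (\<integral>\<^sup>+x. F (A *v x) \<partial>lborel)))"
  have "P A"
  proof (rule induct_matrix_elementary)
    fix A B :: "real ^ 'n ^ 'n" assume AB: "P A" "P B"
    show "P (A ** B)"
      unfolding P_def
    proof (intro impI ballI)
      fix F :: "real ^ 'n \<Rightarrow> ennreal" assume d: "det (A ** B) \<noteq> 0" and F: "F \<in> borel_measurable borel"
      have FA: "(\<lambda>x. F (A *v x)) \<in> borel_measurable borel"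
        using F mA by simp
      have "(\<integral>\<^sup>+x. F x \<partial>lborel) = ennreal \<bar>det A\<bar> * (\<integral>\<^sup>+x. F (A *v x) \<partial>lborel)"
        using AB d F by (auto simp: P_def det_mul)
      also have "(\<integral>\<^sup>+x. F (A *v x) \<partial>lborel) = ennreal \<bar>det B\<bar> * (\<integral>\<^sup>+x. F (A *v (B *v x)) \<partial>lborel)"
        using AB d FA by (auto simp: P_def det_mul)
      finally show "(\<integral>\<^sup>+x. F x \<partial>lborel) = ennreal \<bar>det (A ** B)\<bar> * (\<integral>\<^sup>+x. F (A ** B *v x) \<partial>lborel)"
        by (simp add: det_mul abs_mult ennreal_mult mult.assoc matrix_vector_mul_assoc)
    qed
  next
    fix A :: "real ^ 'n ^ 'n" and i assume "row i A = 0"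
    then show "P A" by (simp add: P_def det_zero_row)
  next
    fix A :: "real ^ 'n ^ 'n" assume dg: "\<And>i j. i \<noteq> j \<Longrightarrow> A $ i $ j = 0"
    show "P A"
      unfolding P_def
    proof (intro impI ballI)
      fix F :: "real ^ 'n \<Rightarrow> ennreal" assume d: "det A \<noteq> 0" and F: "F \<in> borel_measurable borel"
      have dA: "det A = (\<Prod>i\<in>UNIV. A $ i $ i)" by (rule det_diagonal) (rule dg)
      define c where "c b = (\<Sum>i\<in>UNIV. b $ i * A $ i $ i)" for b :: "real ^ 'n"
      have c: "c (axis i 1) = A $ i $ i" for i
        by (simp add: c_def axis_def if_distrib[of "\<lambda>x. x * _"] cong: if_cong)
      define T where "T = (\<lambda>x. 0 + (\<Sum>j\<in>Basis. (c j * (x \<bullet> j)) *\<^sub>R j) :: real ^ 'n)"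
      have Av: "T x = A *v x" for x
      proof -
        have "T x = (\<Sum>i\<in>UNIV. (A $ i $ i * x $ i) *\<^sub>R axis i 1)"
          unfolding T_def sum_Basis_vec
          by (simp add: c inner_axis)
        also have "\<dots> = A *v x"
        proof -
          have "(A *v x) $ i = A $ i $ i * x $ i" for i
          proof -
            have "(A *v x) $ i = (\<Sum>j\<in>UNIV. A $ i $ j * x $ j)"
              by (simp add: matrix_vector_mult_def)
            also have "\<dots> = (\<Sum>j\<in>UNIV. if j = i then A $ i $ i * x $ i else 0)"
              by (rule sum.cong) (use dg in auto)
            finally show ?thesis by simp
          qed
          then show ?thesis
            by (simp add: vec_eq_iff axis_def if_distrib[of "\<lambda>x. _ * x"] cong: if_cong)
        qed
        finally show ?thesis .
      qed
      have nz: "c b \<noteq> 0" if "b \<in> Basis" for b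
        using that d unfolding dA by (auto simp: Basis_vec_def c)
      have l: "lborel = density (distr lborel borel T) (\<lambda>_. (\<Prod>j\<in>Basis. \<bar>c j\<bar>))"
        using lborel_affine_euclidean[of c 0] nz unfolding T_def by simp
      have "T = (*v) A" using Av by auto
      with mA[of A] have Tm: "T \<in> borel_measurable borel" by simp
      have "(\<integral>\<^sup>+x. F x \<partial>lborel) = (\<integral>\<^sup>+x. F x \<partial>density (distr lborel borel T) (\<lambda>_. (\<Prod>j\<in>Basis. \<bar>c j\<bar>)))"
        by (rule arg_cong[OF l])
      also have "\<dots> = ennreal (\<Prod>j\<in>Basis. \<bar>c j\<bar>) * (\<integral>\<^sup>+x. F (T x) \<partial>lborel)"
        using F Tm by (subst nn_integral_density) (auto simp: nn_integral_distr nn_integral_cmult)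
      finally show "(\<integral>\<^sup>+x. F x \<partial>lborel) = ennreal \<bar>det A\<bar> * (\<integral>\<^sup>+x. F (A *v x) \<partial>lborel)"
        by (simp add: Av prod_Basis_vec c dA abs_prod)
    qed
  next
    fix m n :: 'n assume mn: "m \<noteq> n"
    let ?A = "(\<chi> i j. mat 1 $ i $ Transposition.transpose m n j) :: real ^ 'n ^ 'n"
    let ?t = "Transposition.transpose m n"
    have Ax: "?A *v x = (\<chi> i. x $ ?t i)" for x
    proof -
      have "(\<Sum>j\<in>UNIV. (if i = ?t j then 1 else 0) * x $ j) = x $ ?t i" for i
      proof -
        have "(\<Sum>j\<in>UNIV. (if i = ?t j then 1 else 0) * x $ j) = (\<Sum>j\<in>UNIV. if j = ?t i then x $ j else 0)"
          by (intro sum.cong) auto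
        then show ?thesis by simp
      qed
      then show ?thesis by (simp add: vec_eq_iff matrix_vector_mult_def mat_def)
    qed
    have "?A = (\<chi> i. mat 1 $ ?t i)"
      by (auto simp: vec_eq_iff mat_def)
    then have "det ?A = of_int (sign ?t) * det (mat 1 :: real ^ 'n ^ 'n)"
      using det_permute_rows[of ?t "mat 1 :: real ^ 'n ^ 'n"] by (simp add: permutes_swap_id)
    then have dt: "\<bar>det ?A\<bar> = 1" by (simp add: sign_def)
    have "lborel = distr lborel borel (\<lambda>x::real^'n. ?A *v x)"
    proof (rule lborel_eqI)
      fix l u :: "real ^ 'n"
      assume le: "\<And>b. b \<in> Basis \<Longrightarrow> l \<bullet> b \<le> u \<bullet> b"
      have le': "l $ i \<le> u $ i" for i
        using le[of "axis i 1"] by (simp add: inner_axis)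
      have "(\<lambda>x. ?A *v x) -` box l u = box (\<chi> i. l $ ?t i) (\<chi> i. u $ ?t i)"
        unfolding Ax by (auto simp: mem_box_cart) (metis transpose_involutory)+
      then have "emeasure (distr lborel borel (\<lambda>x::real^'n. ?A *v x)) (box l u) = (\<Prod>i\<in>UNIV. u $ ?t i - l $ ?t i)"
        using mA[of ?A]
        by (simp add: emeasure_distr) (subst emeasure_lborel_box, force simp: Basis_vec_real inner_axis le',
          simp add: prod_Basis_vec inner_axis)
      also have "(\<Prod>i\<in>UNIV. u $ ?t i - l $ ?t i) = (\<Prod>i\<in>UNIV. u $ i - l $ i)"
        by (rule prod.reindex_bij_betw) (simp add: permutes_imp_bij permutes_swap_id)
      finally show "emeasure (distr lborel borel (\<lambda>x::real^'n. ?A *v x)) (box l u) = (\<Prod>b\<in>Basis. (u - l) \<bullet> b)"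
        by (simp add: prod_Basis_vec inner_axis)
    qed simp
    note D = this
    have "(\<integral>\<^sup>+x. F x \<partial>lborel) = (\<integral>\<^sup>+x. F (?A *v x) \<partial>lborel)" if F: "F \<in> borel_measurable borel" for F :: "_ \<Rightarrow> ennreal"
    proof -
      have "(\<integral>\<^sup>+x. F x \<partial>lborel) = (\<integral>\<^sup>+x. F x \<partial>distr lborel borel (\<lambda>x. ?A *v x))"
        by (rule arg_cong[OF D])
      also have "\<dots> = (\<integral>\<^sup>+x. F (?A *v x) \<partial>lborel)"
        using F mA[of ?A] by (intro nn_integral_distr) simp_all
      finally show ?thesis .
    qed
    then show "P ?A" by (simp add: P_def dt)
  next
    fix m n :: 'n and c :: real assume mn: "m \<noteq> n"
    let ?A = "(\<chi> i j. if i = m \<and> j = n then c else of_bool (i = j)) :: real ^ 'n ^ 'n"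
    have Ax: "?A *v x = (\<chi> i. if i = m then x $ m + c * x $ n else x $ i)" for x
    proof -
      have "(\<Sum>j\<in>UNIV. (if i = m \<and> j = n then c else of_bool (i = j)) * x $ j)
         = (if i = m then x $ m + c * x $ n else x $ i)" for i
      proof -
        have "(\<Sum>j\<in>UNIV. (if i = m \<and> j = n then c else of_bool (i = j)) * x $ j)
          = (\<Sum>j\<in>UNIV. (if j = i then x $ j else 0) + (if j = n then (if i = m then c * x $ n else 0) else 0))"
          using mn by (intro sum.cong) auto
        then show ?thesis by (simp add: sum.distrib)
      qed
      then show ?thesis by (simp add: vec_eq_iff matrix_vector_mult_def)
    qed
    have "?A = (\<chi> k. if k = m then row m (mat 1) + c *s row n (mat 1) else row k (mat 1))"
      using mn by (auto simp: vec_eq_iff row_def mat_def)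
    then have "det ?A = 1"
      using det_row_operation[OF mn, of "mat 1 :: real ^ 'n ^ 'n" c] by simp
    then show "P ?A"
      using mn by (simp add: P_def Ax nn_integral_matrix_shear)
  qed
  then show ?thesis using assms by (simp add: P_def)
qed

lemma nn_integral_lborel_option:
  fixes F :: "real ^ ('d::finite option) \<Rightarrow> ennreal"
  assumes [measurable]: "F \<in> borel_measurable borel"
  shows "(\<integral>\<^sup>+x. F x \<partial>lborel) = (\<integral>\<^sup>+v. \<integral>\<^sup>+s. F (\<chi> i. case i of None \<Rightarrow> s | Some b \<Rightarrow> v $ b) \<partial>lborel \<partial>lborel)"
proof -
  let ?j = "(\<lambda>(v, s). \<chi> i. case i of None \<Rightarrow> s | Some b \<Rightarrow> v $ b) :: (real ^ 'd) \<times> real \<Rightarrow> real ^ ('d option)"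
  have m: "?j \<in> borel_measurable borel"
  proof (rule borel_measurable_vecI)
    fix i :: "'d option"
    show "(\<lambda>x. ?j x $ i) \<in> borel_measurable borel"
      by (cases i) (auto simp: case_prod_beta intro!: borel_measurable_continuous_onI continuous_intros)
  qed
  have "lborel = distr lborel borel ?j"
  proof (rule lborel_eqI)
    fix l u :: "real ^ ('d option)"
    assume le: "\<And>b. b \<in> Basis \<Longrightarrow> l \<bullet> b \<le> u \<bullet> b"
    have le': "l $ i \<le> u $ i" for i
      using le[of "axis i 1"] by (simp add: inner_axis)
    let ?l = "\<chi> b. l $ Some b" and ?u = "\<chi> b. u $ Some b"
    have "?j -` box l u = box ?l ?u \<times> box (l $ None) (u $ None)"
      by (auto simp: mem_box_cart split: option.splits)
    then have "emeasure (distr lborel borel ?j) (box l u) = emeasure (lborel \<Otimes>\<^sub>M lborel) (box ?l ?u \<times> box (l $ None) (u $ None))"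
      using m by (simp add: emeasure_distr lborel_prod)
    also have "\<dots> = emeasure lborel (box ?l ?u) * emeasure lborel (box (l $ None) (u $ None))"
      by (rule lborel.emeasure_pair_measure_Times) auto
    also have "emeasure lborel (box ?l ?u) = ennreal (\<Prod>b\<in>UNIV. u $ Some b - l $ Some b)"
      by (subst emeasure_lborel_box, force simp: Basis_vec_real inner_axis le', simp add: prod_Basis_vec inner_axis)
    also have "ennreal (\<Prod>b\<in>UNIV. u $ Some b - l $ Some b) * emeasure lborel (box (l $ None) (u $ None))
        = ennreal (\<Prod>b\<in>Basis. (u - l) \<bullet> b)"
      unfolding prod_Basis_vec UNIV_option_conv
      by (subst prod.insert) (auto simp: prod.reindex inner_axis le' ennreal_mult[symmetric] prod_nonneg mult.commute)
    finally show "emeasure (distr lborel borel ?j) (box l u) = ennreal (\<Prod>b\<in>Basis. (u - l) \<bullet> b)" .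
  qed simp
  then have "(\<integral>\<^sup>+x. F x \<partial>lborel) = (\<integral>\<^sup>+x. F x \<partial>distr lborel borel ?j)" by (rule arg_cong)
  also have "\<dots> = (\<integral>\<^sup>+p. F (?j p) \<partial>(lborel \<Otimes>\<^sub>M lborel))"
    using m by (simp add: nn_integral_distr lborel_prod)
  also have "\<dots> = (\<integral>\<^sup>+v. \<integral>\<^sup>+s. F (?j (v, s)) \<partial>lborel \<partial>lborel)"
    using m by (subst lborel.nn_integral_fst[symmetric]) (auto simp: lborel_prod)
  finally show ?thesis by simp
qed

section \<open>Regular triangulations\<close>

lemma negligible_convex_hull_card:
  fixes S :: "'a::euclidean_space set"
  assumes "finite S" "card S \<le> DIM('a)"
  shows "negligible (convex hull S)"
  using empty_interior_convex_hull[OF assms] negligible_convex_interior[of "convex hull S"] by simp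

lemma measure_lborel_convex_hull_finite:
  fixes S :: "'a::euclidean_space set"
  assumes "finite S"
  shows "measure lborel (convex hull S) = measure lebesgue (convex hull S)"
proof -
  have "compact (convex hull S)" using assms by (rule finite_imp_compact_convex_hull)
  then have "convex hull S \<in> sets lborel" by (simp add: borel_compact)
  then show ?thesis by simp
qed

text \<open>The points \<open>y i\<close> may coincide, so weights attached to points are pulled
  back along a subset of indices on which \<open>y\<close> is injective; all other indices get
  weight 0.\<close>

lemma convex_hull_imageE:
  fixes y :: "'i \<Rightarrow> 'a::real_vector"
  assumes "finite I" and "x \<in> convex hull (y ` I)"
  obtains c where "\<And>i. i \<in> I \<Longrightarrow> 0 \<le> c i" "sum c I = 1" "(\<Sum>i\<in>I. c i *\<^sub>R y i) = x"
proof -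
  obtain U where U: "U \<subseteq> I" "inj_on y U" "y ` I = y ` U"
    using subset_image_inj[of "y ` I" y I] by auto
  have fU: "finite U" using U assms(1) finite_subset by blast
  obtain u where u: "\<forall>p\<in>y ` U. 0 \<le> u p" "sum u (y ` U) = 1" "(\<Sum>p\<in>y ` U. u p *\<^sub>R p) = x"
    using assms(2) fU unfolding U(3) by (auto simp: convex_hull_finite)
  let ?c = "\<lambda>i. if i \<in> U then u (y i) else 0"
  have "sum ?c I = sum u (y ` U)"
    using U(1,2) assms(1) by (simp add: sum.reindex sum.inter_restrict[symmetric] inf.absorb2)
  moreover have "(\<Sum>i\<in>I. ?c i *\<^sub>R y i) = (\<Sum>p\<in>y ` U. u p *\<^sub>R p)"
    using U(1,2) assms(1)
    by (simp add: sum.reindex if_distrib[of "\<lambda>x. x *\<^sub>R _"] sum.inter_restrict[symmetric] inf.absorb2 cong: if_cong)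
  ultimately show ?thesis
    using that[of ?c] u by auto
qed

lemma convex_hull_imageI:
  fixes y :: "'i \<Rightarrow> 'a::real_vector"
  assumes "finite I" "\<And>i. i \<in> I \<Longrightarrow> 0 \<le> c i" "sum c I = 1"
  shows "(\<Sum>i\<in>I. c i *\<^sub>R y i) \<in> convex hull (y ` I)"
  using assms by (intro convex_sum) (auto intro: hull_inc)

lemma caratheodory_image:
  fixes y :: "'i \<Rightarrow> 'a::euclidean_space"
  assumes "x \<in> convex hull (y ` K)"
  obtains S where "S \<subseteq> K" "finite S" "card S \<le> DIM('a) + 1" "x \<in> convex hull (y ` S)"
proof -
  obtain T where T: "finite T" "T \<subseteq> y ` K" "card T \<le> DIM('a) + 1" "x \<in> convex hull T"
    using assms by (subst (asm) caratheodory) auto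
  from T(2) obtain S where S: "S \<subseteq> K" "inj_on y S" "T = y ` S"
    by (auto simp: subset_image_inj)
  show ?thesis
    using T S that[of S] by (simp add: card_image finite_image_iff)
qed

text \<open>The pivot step of the simplex method. Putting weight \<open>e\<close> on
  \<open>j\<close> and taking \<open>e * \<alpha> i\<close> from each \<open>i\<close> keeps the
  represented point, and raises the interpolated height by \<open>e\<close> times the excess of
  \<open>h j\<close> over its affine prediction. The step is as long as nonnegativity
  permits.\<close>

lemma convex_combination_pivot:
  fixes y :: "'i \<Rightarrow> 'a::real_vector" and h :: "'i \<Rightarrow> real"
  assumes I: "finite I" "j \<notin> I"
    and c: "\<And>i. i \<in> I \<Longrightarrow> 0 < c i" "sum c I = 1"
    and \<alpha>: "sum \<alpha> I = 1" "(\<Sum>i\<in>I. \<alpha> i *\<^sub>R y i) = y j"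
    and h: "(\<Sum>i\<in>I. \<alpha> i * h i) < h j"
  obtains k c' where "k \<in> I"
    "\<And>i. i \<in> insert j (I - {k}) \<Longrightarrow> 0 \<le> c' i" "sum c' (insert j (I - {k})) = 1"
    "(\<Sum>i\<in>insert j (I - {k}). c' i *\<^sub>R y i) = (\<Sum>i\<in>I. c i *\<^sub>R y i)"
    "(\<Sum>i\<in>I. c i * h i) < (\<Sum>i\<in>insert j (I - {k}). c' i * h i)"
proof -
  let ?S = "{i \<in> I. 0 < \<alpha> i}"
  have "?S \<noteq> {}"
  proof
    assume "?S = {}"
    then have "sum \<alpha> I \<le> 0" by (intro sum_nonpos) force
    with \<alpha>(1) show False by simp
  qed
  \<comment> \<open>Ratio test: among the indices that lose weight, \<open>k\<close> is the first to
    reach zero, which bounds the admissible step.\<close>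
  then obtain k where k: "k \<in> ?S" "\<And>i. i \<in> ?S \<Longrightarrow> c k / \<alpha> k \<le> c i / \<alpha> i"
    using ex_is_arg_min_if_finite[of ?S "\<lambda>i. c i / \<alpha> i"] I(1) by (auto simp: is_arg_min_linorder)
  define e where "e = c k / \<alpha> k"
  have e: "0 < e" using k(1) c(1) by (simp add: e_def)
  define c' where "c' = (\<lambda>i. if i = j then e else c i - e * \<alpha> i)"
  have c'k: "c k - e * \<alpha> k = 0" using k(1) by (simp add: e_def)
  \<comment> \<open>One identity for three uses: a constant \<open>f\<close> gives the total weight,
    \<open>y\<close> the represented point and \<open>h\<close> the height.\<close>
  have sum': "(\<Sum>i\<in>insert j (I - {k}). c' i *\<^sub>R f i) = e *\<^sub>R f j + ((\<Sum>i\<in>I. c i *\<^sub>R f i) - e *\<^sub>R (\<Sum>i\<in>I. \<alpha> i *\<^sub>R f i))"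
    for f :: "'i \<Rightarrow> 'b::real_vector"
  proof -
    have "(\<Sum>i\<in>insert j (I - {k}). c' i *\<^sub>R f i) = e *\<^sub>R f j + (\<Sum>i\<in>I - {k}. c' i *\<^sub>R f i)"
      using I by (subst sum.insert) (auto simp: c'_def)
    also have "(\<Sum>i\<in>I - {k}. c' i *\<^sub>R f i) = (\<Sum>i\<in>I - {k}. (c i - e * \<alpha> i) *\<^sub>R f i)"
      by (rule sum.cong) (use I(2) in \<open>auto simp: c'_def\<close>)
    also have "(\<Sum>i\<in>I - {k}. (c i - e * \<alpha> i) *\<^sub>R f i) = (\<Sum>i\<in>I. (c i - e * \<alpha> i) *\<^sub>R f i)"
      using I k c'k by (intro sum.mono_neutral_left) auto
    finally show ?thesis
      by (simp add: scaleR_left_diff_distrib sum_subtractf scaleR_sum_right)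
  qed
  show ?thesis
  proof (rule that[of k c'])
    show "k \<in> I" using k by simp
    show "0 \<le> c' i" if "i \<in> insert j (I - {k})" for i
    proof (cases "i = j")
      case False
      then have i: "i \<in> I" using that by auto
      show ?thesis
      proof (cases "0 < \<alpha> i")
        case True
        then have "e \<le> c i / \<alpha> i" using k(2)[of i] i by (simp add: e_def)
        then show ?thesis using True False by (simp add: c'_def field_simps)
      next
        case F: False
        then have "e * \<alpha> i \<le> 0" using e by (simp add: mult_nonneg_nonpos)
        then show ?thesis using c(1)[OF i] False by (simp add: c'_def)
      qed
    qed (use e in \<open>simp add: c'_def\<close>)
    show "sum c' (insert j (I - {k})) = 1"
      using sum'[of "\<lambda>_. 1::real"] c \<alpha> by simp
    show "(\<Sum>i\<in>insert j (I - {k}). c' i *\<^sub>R y i) = (\<Sum>i\<in>I. c i *\<^sub>R y i)"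
      unfolding sum' by (simp add: \<alpha>(2))
    have "(\<Sum>i\<in>insert j (I - {k}). c' i * h i) = (\<Sum>i\<in>I. c i * h i) + e * (h j - (\<Sum>i\<in>I. \<alpha> i * h i))"
      using sum'[of h] by (simp add: algebra_simps)
    moreover have "0 < e * (h j - (\<Sum>i\<in>I. \<alpha> i * h i))"
      using e h by simp
    ultimately show "(\<Sum>i\<in>I. c i * h i) < (\<Sum>i\<in>insert j (I - {k}). c' i * h i)" by simp
  qed
qed

text \<open>\<open>\<D>\<close> collects the nondegenerate simplices; those below whose lifted hyperplane all other
  lifted points lie form the regular triangulation induced by the heights \<open>h\<close>.\<close>

proposition measure_regular_triangulation:
  fixes y :: "'i \<Rightarrow> 'a::euclidean_space" and h :: "'i \<Rightarrow> real"
    and v :: "'i set \<Rightarrow> 'a" and s :: "'i set \<Rightarrow> real"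
  assumes K: "finite K"
    and \<D>: "\<D> \<subseteq> {I. I \<subseteq> K \<and> card I = DIM('a) + 1}"
    and degenerate: "\<And>I. I \<subseteq> K \<Longrightarrow> card I = DIM('a) + 1 \<Longrightarrow> I \<notin> \<D> \<Longrightarrow> negligible (convex hull (y ` I))"
    and span: "\<And>I p. I \<in> \<D> \<Longrightarrow> \<exists>\<alpha>. sum \<alpha> I = 1 \<and> (\<Sum>i\<in>I. \<alpha> i *\<^sub>R y i) = p"
    and on: "\<And>I i. I \<in> \<D> \<Longrightarrow> i \<in> I \<Longrightarrow> h i = v I \<bullet> y i + s I"
    and off: "\<And>I j. I \<in> \<D> \<Longrightarrow> j \<in> K - I \<Longrightarrow> h j \<noteq> v I \<bullet> y j + s I"
  shows "measure lborel (convex hull (y ` K)) =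
    (\<Sum>I\<in>{I\<in>\<D>. \<forall>j\<in>K - I. h j < v I \<bullet> y j + s I}. measure lborel (convex hull (y ` I)))"
proof -
  let ?U = "{I\<in>\<D>. \<forall>j\<in>K - I. h j < v I \<bullet> y j + s I}"
  \<comment> \<open>The exceptional set \<open>N\<close> consists of the hulls of at most
    \<open>DIM('a)\<close> points and of the degenerate simplices, a finite union of null sets.
    Outside it a point can only be represented by simplices of \<open>\<D>\<close>, and with
    positive weights, so lower-dimensional faces never interfere.\<close>
  define B where "B = {S. S \<subseteq> K \<and> (card S \<le> DIM('a) \<or> (card S = DIM('a) + 1 \<and> S \<notin> \<D>))}"
  define N where "N = (\<Union>S\<in>B. convex hull (y ` S))"
  have fin: "finite S" if "S \<subseteq> K" for S using that K finite_subset by blast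
  have finD: "finite \<D>" using \<D> K finite_subset[of \<D> "Pow K"] by auto
  have finI: "finite I" and cardI: "card I = DIM('a) + 1" and subI: "I \<subseteq> K" if "I \<in> \<D>" for I
    using that \<D> fin by auto
  have negN: "negligible N"
    unfolding N_def
  proof (rule negligible_Union)
    have "B \<subseteq> Pow K" by (auto simp: B_def)
    then show "finite ((\<lambda>S. convex hull (y ` S)) ` B)" using K by (simp add: finite_subset)
    fix T assume "T \<in> (\<lambda>S. convex hull (y ` S)) ` B"
    then obtain S where S: "S \<in> B" "T = convex hull (y ` S)" by auto
    show "negligible T"
    proof (cases "card S \<le> DIM('a)")
      case True
      have "card (y ` S) \<le> card S" using S fin card_image_le by (auto simp: B_def)
      then show ?thesis
        using True S fin by (auto simp: B_def intro!: negligible_convex_hull_card)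
    next
      case False
      then show ?thesis using S degenerate by (auto simp: B_def)
    qed
  qed
  have pos: "0 < c i" if "I \<in> \<D>" "x \<notin> N" "\<And>i. i \<in> I \<Longrightarrow> 0 \<le> c i" "sum c I = 1" "(\<Sum>i\<in>I. c i *\<^sub>R y i) = x" "i \<in> I"
    for c x I i
  proof (rule ccontr)
    assume "\<not> 0 < c i"
    with that have ci: "c i = 0" by force
    have "sum c (I - {i}) = 1" "(\<Sum>k\<in>I - {i}. c k *\<^sub>R y k) = x"
      using that finI[OF that(1)] ci by (simp_all add: sum_diff1)
    then have "x \<in> convex hull (y ` (I - {i}))"
      using convex_hull_imageI[of "I - {i}" c y] that finI[OF that(1)] by auto
    moreover have "I - {i} \<in> B"
      using that(1,6) cardI subI finI by (auto simp: B_def)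
    ultimately show False using \<open>x \<notin> N\<close> by (auto simp: N_def)
  qed
  have val: "v I \<bullet> x + s I = (\<Sum>i\<in>J. c i * (v I \<bullet> y i + s I))"
    if "sum c J = 1" "(\<Sum>i\<in>J. c i *\<^sub>R y i) = x" for c x I J
    using that by (auto simp: inner_sum_right sum.distrib distrib_left sum_distrib_right[symmetric])
  have val_h: "v I \<bullet> x + s I = (\<Sum>i\<in>I. c i * h i)"
    if "I \<in> \<D>" "sum c I = 1" "(\<Sum>i\<in>I. c i *\<^sub>R y i) = x" for c x I
    unfolding val[OF that(2,3)] by (intro sum.cong) (simp_all add: on[OF that(1)])
  \<comment> \<open>Existence: among the simplices containing \<open>x\<close>, take one whose
    interpolated height at \<open>x\<close> is largest, as an \<open>is_arg_min\<close> of the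
    negative. A lifted point above its hyperplane would permit a pivot to a simplex through
    \<open>x\<close> with a larger height.\<close>
  have cover: "x \<in> N \<or> (\<exists>I\<in>?U. x \<in> convex hull (y ` I))" if x: "x \<in> convex hull (y ` K)" for x
  proof (rule disjCI)
    assume "\<not> (\<exists>I\<in>?U. x \<in> convex hull (y ` I))"
    show "x \<in> N"
    proof (rule ccontr)
      assume xN: "x \<notin> N"
      have inD: "S \<in> \<D>" if "S \<subseteq> K" "card S \<le> DIM('a) + 1" "x \<in> convex hull (y ` S)" for S
      proof (rule ccontr)
        assume "S \<notin> \<D>"
        with that have "S \<in> B" by (auto simp: B_def)
        with that(3) xN show False by (auto simp: N_def)
      qed
      let ?C = "{I\<in>\<D>. x \<in> convex hull (y ` I)}"
      obtain S where "S \<subseteq> K" "card S \<le> DIM('a) + 1" "x \<in> convex hull (y ` S)"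
        using caratheodory_image[OF x] by metis
      with inD have "S \<in> ?C" by auto
      then obtain I where am: "is_arg_min (\<lambda>J. - (v J \<bullet> x + s J)) (\<lambda>J. J \<in> ?C) I"
        using finD ex_is_arg_min_if_finite[of ?C "\<lambda>J. - (v J \<bullet> x + s J)"] by fastforce
      have I: "I \<in> ?C" using am by (simp add: is_arg_min_linorder)
      have Imax: "v J \<bullet> x + s J \<le> v I \<bullet> x + s I" if "J \<in> ?C" for J
        using am that unfolding is_arg_min_linorder neg_le_iff_le by blast
      have ID: "I \<in> \<D>" using I by simp
      obtain c where c: "\<And>i. i \<in> I \<Longrightarrow> 0 \<le> c i" "sum c I = 1" "(\<Sum>i\<in>I. c i *\<^sub>R y i) = x"
        using I finI by (auto elim: convex_hull_imageE)
      have "\<exists>j\<in>K - I. \<not> h j < v I \<bullet> y j + s I"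
        using \<open>\<not> (\<exists>I\<in>?U. _)\<close> I by auto
      then obtain j where j: "j \<in> K - I" "v I \<bullet> y j + s I < h j"
        using off[OF ID] by force
      obtain \<alpha> where \<alpha>: "sum \<alpha> I = 1" "(\<Sum>i\<in>I. \<alpha> i *\<^sub>R y i) = y j"
        using span[OF ID] by blast
      have "(\<Sum>i\<in>I. \<alpha> i * h i) < h j"
        using j(2) val_h[OF ID \<alpha>] by simp
      moreover have "\<And>i. i \<in> I \<Longrightarrow> 0 < c i" using pos[OF ID xN _ c(2,3)] c(1) by blast
      ultimately obtain k c' where k: "k \<in> I" and
        c': "\<And>i. i \<in> insert j (I - {k}) \<Longrightarrow> 0 \<le> c' i" "sum c' (insert j (I - {k})) = 1"
        "(\<Sum>i\<in>insert j (I - {k}). c' i *\<^sub>R y i) = (\<Sum>i\<in>I. c i *\<^sub>R y i)"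
        and less: "(\<Sum>i\<in>I. c i * h i) < (\<Sum>i\<in>insert j (I - {k}). c' i * h i)"
        using convex_combination_pivot[of I j c \<alpha> y h] finI[OF ID] j(1) c(2) \<alpha> by auto
      let ?J = "insert j (I - {k})"
      have fJ: "finite ?J" using finI[OF ID] by simp
      have xJ: "x \<in> convex hull (y ` ?J)"
        using convex_hull_imageI[OF fJ c'(1,2), of y] c'(3) c(3) by simp
      moreover have "card ?J = card I"
        using card_Suc_Diff1[OF finI[OF ID] k] finI[OF ID] j(1) by simp
      ultimately have J: "?J \<in> \<D>" using inD[of ?J] j(1) subI[OF ID] cardI[OF ID] by auto
      have "v ?J \<bullet> x + s ?J = (\<Sum>i\<in>?J. c' i * h i)"
        by (rule val_h[OF J c'(2)]) (use c' c in simp)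
      also have "\<dots> > v I \<bullet> x + s I" using less val_h[OF ID c(2,3)] by simp
      finally show False using Imax[of ?J] J xJ by simp
    qed
  qed
  \<comment> \<open>Uniqueness: at \<open>x\<close> the hyperplane of \<open>J\<close> takes the
    weighted mean of the heights over \<open>J\<close>. The hyperplane of \<open>I\<close> is
    nowhere below these heights and strictly above at a vertex of \<open>J\<close> outside
    \<open>I\<close>, whose weight is positive. For \<open>x\<close> in both hulls, exchanging the
    roles gives a contradiction, which is \<open>disj\<close>.\<close>
  have less: "v J \<bullet> x + s J < v I \<bullet> x + s I"
    if "I \<in> ?U" "J \<in> ?U" "I \<noteq> J" "x \<in> convex hull (y ` J)" "x \<notin> N" for I J x
  proof -
    have JD: "J \<in> \<D>" and ID: "I \<in> \<D>" and xJ: "x \<in> convex hull (y ` J)" using that by auto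
    obtain c where c: "\<And>i. i \<in> J \<Longrightarrow> 0 \<le> c i" "sum c J = 1" "(\<Sum>i\<in>J. c i *\<^sub>R y i) = x"
      using xJ finI[OF JD] by (auto elim: convex_hull_imageE)
    have p: "0 < c i" if "i \<in> J" for i
      using pos[OF JD \<open>x \<notin> N\<close> _ c(2,3) that] c(1) by blast
    have "\<not> J \<subseteq> I"
      using card_subset_eq[OF finI[OF ID], of J] cardI ID JD that(3) by auto
    then obtain j where j: "j \<in> J" "j \<notin> I" by auto
    have hl: "h i < v I \<bullet> y i + s I" if "i \<in> J" "i \<notin> I" for i
      using that \<open>I \<in> ?U\<close> subI[OF JD] by auto
    have "(\<Sum>i\<in>J. c i * h i) < (\<Sum>i\<in>J. c i * (v I \<bullet> y i + s I))"
    proof (rule sum_strict_mono_ex1[OF finI[OF JD]])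
      show "\<forall>i\<in>J. c i * h i \<le> c i * (v I \<bullet> y i + s I)"
      proof
        fix i assume "i \<in> J"
        then show "c i * h i \<le> c i * (v I \<bullet> y i + s I)"
          using hl[of i] on[OF ID, of i] c(1)[of i] by (cases "i \<in> I") (auto intro!: mult_left_mono)
      qed
      show "\<exists>i\<in>J. c i * h i < c i * (v I \<bullet> y i + s I)"
        using hl[OF j] p[OF j(1)] j by (intro bexI[of _ j] mult_strict_left_mono)
    qed
    then show ?thesis using val_h[OF JD c(2,3)] val[OF c(2,3), of I] by simp
  qed
  have disj: "negligible (convex hull (y ` I) \<inter> convex hull (y ` J))" if "I \<in> ?U" "J \<in> ?U" "I \<noteq> J" for I J
  proof (rule negligible_subset[OF negN])
    show "convex hull (y ` I) \<inter> convex hull (y ` J) \<subseteq> N"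
      using less[OF that] less[OF that(2,1) that(3)[symmetric]] by fastforce
  qed
  have sub: "convex hull (y ` I) \<subseteq> convex hull (y ` K)" if "I \<in> ?U" for I
    using that subI by (intro hull_mono image_mono) auto
  have lm: "convex hull (y ` I) \<in> lmeasurable" if "I \<subseteq> K" for I
    using fin[OF that] by (intro lmeasurable_compact finite_imp_compact_convex_hull) simp
  have "measure lebesgue (convex hull (y ` K)) = measure lebesgue (\<Union>I\<in>?U. convex hull (y ` I))"
  proof (rule measure_negligible_symdiff)
    show "(\<Union>I\<in>?U. convex hull (y ` I)) \<in> lmeasurable"
      using finD subI by (intro fmeasurable.finite_UN lm) auto
    show "negligible ((\<Union>I\<in>?U. convex hull (y ` I)) - convex hull (y ` K) \<union> (convex hull (y ` K) - (\<Union>I\<in>?U. convex hull (y ` I))))"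
      using cover sub by (intro negligible_subset[OF negN]) blast
  qed
  also have "\<dots> = (\<Sum>I\<in>?U. measure lebesgue (convex hull (y ` I)))"
    using finD subI disj by (intro measure_negligible_finite_Union_image lm) (auto simp: pairwise_def)
  finally show ?thesis
    using K subI fin by (simp add: measure_lborel_convex_hull_finite)
qed

section \<open>The functions \<open>g\<^sub>m\<close>\<close>

text \<open>Matrix determinant lemma, from two eliminations of one bordered matrix
  \<open>?M\<close>: row operations by \<open>?L\<close> leave \<open>?D\<close> and the scalar
  \<open>?t\<close> on the diagonal, column operations by \<open>?R\<close> leave \<open>?S\<close>
  and 1. Both factors have determinant 1.\<close>

lemma det_diag_plus_rank_one:
  fixes l :: "real list" and u :: "nat \<Rightarrow> real" and c :: real
  assumes pos: "\<And>i. i < m \<Longrightarrow> a i \<noteq> 0"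
  shows "Determinant.det (Matrix.mat m m (\<lambda>(i, j). c * u i * w j + (if i = j then a i else 0))) =
     (1 + c * (\<Sum>i<m. u i * w i / a i)) * (\<Prod>i<m. a i)"
proof -
  let ?D = "Matrix.mat m m (\<lambda>(i, j). if i = j then a i else 0 :: real)"
  let ?w = "Matrix.mat 1 m (\<lambda>(i, j). w j)"
  let ?u = "Matrix.mat m 1 (\<lambda>(i, j). - c * u i)"
  let ?v = "Matrix.mat 1 m (\<lambda>(i, j). - (w j / a j))"
  let ?M = "four_block_mat ?D ?u ?w (1\<^sub>m 1)"
  let ?S = "Matrix.mat m m (\<lambda>(i, j). c * u i * w j + (if i = j then a i else 0))"
  have D: "?D \<in> carrier_mat m m" "?u \<in> carrier_mat m 1" "?w \<in> carrier_mat 1 m" "?v \<in> carrier_mat 1 m"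
    "1\<^sub>m 1 \<in> carrier_mat 1 1" "?S \<in> carrier_mat m m" by auto
  let ?L = "four_block_mat (1\<^sub>m m) (0\<^sub>m m 1) ?v (1\<^sub>m 1)"
  let ?R = "four_block_mat (1\<^sub>m m) (0\<^sub>m m 1) (- ?w) (1\<^sub>m 1)"
  let ?t = "1 + c * (\<Sum>i<m. u i * w i / a i)"
  have detD: "Determinant.det ?D = (\<Prod>i<m. a i)"
    by (subst det_upper_triangular[OF _ D(1)]) (auto simp: diag_mat_def prod.list_conv_set_nth atLeast0LessThan)
  have vD: "?v * ?D = - ?w"
    using pos by (intro eq_matI) (auto simp: scalar_prod_def if_distrib[of "\<lambda>x. _ * x"] cong: if_cong)
  have vu: "?v * ?u + 1\<^sub>m 1 = Matrix.mat 1 1 (\<lambda>_. ?t)"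
    by (intro eq_matI) (auto simp: scalar_prod_def sum_distrib_left atLeast0LessThan intro!: sum.cong)
  have uw: "?D + ?u * (- ?w) = ?S"
    by (intro eq_matI) (auto simp: scalar_prod_def)
  have LM: "?L * ?M = four_block_mat ?D ?u (0\<^sub>m 1 m) (Matrix.mat 1 1 (\<lambda>_. ?t))"
  proof -
    have "?L * ?M = four_block_mat (1\<^sub>m m * ?D + 0\<^sub>m m 1 * ?w) (1\<^sub>m m * ?u + 0\<^sub>m m 1 * 1\<^sub>m 1)
      (?v * ?D + 1\<^sub>m 1 * ?w) (?v * ?u + 1\<^sub>m 1 * 1\<^sub>m 1)"
      by (rule mult_four_block_mat) auto
    moreover have "?v * ?D + 1\<^sub>m 1 * ?w = 0\<^sub>m 1 m"
      unfolding vD by (intro eq_matI) (auto simp: scalar_prod_def)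
    ultimately show ?thesis using D vu by simp
  qed
  have MR: "?M * ?R = four_block_mat ?S ?u (0\<^sub>m 1 m) (1\<^sub>m 1)"
  proof -
    have "?M * ?R = four_block_mat (?D * 1\<^sub>m m + ?u * (- ?w)) (?D * 0\<^sub>m m 1 + ?u * 1\<^sub>m 1)
      (?w * 1\<^sub>m m + 1\<^sub>m 1 * (- ?w)) (?w * 0\<^sub>m m 1 + 1\<^sub>m 1 * 1\<^sub>m 1)"
      by (rule mult_four_block_mat) auto
    moreover have "?w * 1\<^sub>m m + 1\<^sub>m 1 * (- ?w) = 0\<^sub>m 1 m"
      using D by (intro eq_matI) auto
    ultimately show ?thesis using D uw by simp
  qed
  have MC: "?M \<in> carrier_mat (m + 1) (m + 1)" "?L \<in> carrier_mat (m + 1) (m + 1)" "?R \<in> carrier_mat (m + 1) (m + 1)"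
    by auto
  have dLR: "Determinant.det ?L = 1" "Determinant.det ?R = 1"
    by (subst det_four_block_mat_upper_right_zero[where n = m and m = 1]; simp)+
  have "Determinant.det (?L * ?M) = Determinant.det ?L * Determinant.det ?M"
    by (rule det_mult[OF MC(2,1)])
  also have "\<dots> = Determinant.det ?M * Determinant.det ?R"
    by (simp only: dLR mult_1_left mult_1_right)
  also have "\<dots> = Determinant.det (?M * ?R)"
    by (rule det_mult[OF MC(1,3), symmetric])
  also have "Determinant.det (?M * ?R) = Determinant.det ?S"
    unfolding MR by (subst det_four_block_mat_lower_left_zero[where n = m and m = 1]) (simp_all)
  also have "Determinant.det (?L * ?M) = Determinant.det ?D * ?t"
    unfolding LM by (subst det_four_block_mat_lower_left_zero[where n = m and m = 1]) (simp_all add: det_single)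
  finally have "Determinant.det ?D * ?t = Determinant.det ?S" .
  from this[symmetric] show ?thesis unfolding detD by (simp only: mult.commute)
qed

text \<open>\<open>mat_inverse\<close> is accessed through its specification: the result
  \<open>None\<close> is excluded because \<open>B\<close> makes \<open>A\<close> a unit, and any
  other result is a two-sided inverse, hence equal to \<open>B\<close>.\<close>

lemma mat_inverse_eqI:
  fixes A :: "real mat"
  assumes "A \<in> carrier_mat n n" "B \<in> carrier_mat n n" "A * B = 1\<^sub>m n" "B * A = 1\<^sub>m n"
  shows "mat_inverse A = Some B"
proof (cases "mat_inverse A")
  case None
  then have "A \<notin> Units (ring_mat TYPE(real) n ())"
    by (rule mat_inverse(1)[OF assms(1)])
  moreover have "A \<in> Units (ring_mat TYPE(real) n ())"
    using assms unfolding Units_def by (auto simp: ring_mat_def)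
  ultimately show ?thesis by simp
next
  case (Some C)
  from mat_inverse(2)[OF assms(1) this] have C: "A * C = 1\<^sub>m n" "C * A = 1\<^sub>m n" "C \<in> carrier_mat n n" by auto
  have "C = (B * A) * C" using assms C by simp
  also have "\<dots> = B * (A * C)" using assms C by (intro assoc_mult_mat) auto
  also have "\<dots> = B" using assms C by simp
  finally show ?thesis using Some by simp
qed

lemma det_g_cov:
  assumes "0 < l0" "\<forall>i<length ls. 0 < ls ! i"
  shows "Determinant.det (g_cov l0 ls) = (l0 + (\<Sum>i<length ls. ls ! i)) / (l0 * (\<Prod>i<length ls. ls ! i))"
proof -
  have "g_cov l0 ls = Matrix.mat (length ls) (length ls)
     (\<lambda>(i, j). (1 / l0) * 1 * 1 + (if i = j then 1 / ls ! i else 0))"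
    by (simp add: g_cov_def)
  then have "Determinant.det (g_cov l0 ls) =
     (1 + (1 / l0) * (\<Sum>i<length ls. 1 * 1 / (1 / ls ! i))) * (\<Prod>i<length ls. 1 / ls ! i)"
    using det_diag_plus_rank_one[of "length ls" "\<lambda>i. 1 / ls ! i" "1 / l0" "\<lambda>_. 1" "\<lambda>_. 1"] assms(2)
    by (metis (no_types, lifting) divide_eq_0_iff less_numeral_extra(3) zero_neq_one)
  then show ?thesis
    using assms by (simp add: field_simps prod_dividef)
qed

text \<open>The Sherman-Morrison formula for a diagonal matrix with entries
  \<open>1 / ls ! i\<close> plus the constant matrix \<open>1 / l0\<close>.\<close>

lemma mat_inverse_g_cov:
  assumes "0 < l0" "\<forall>i<length ls. 0 < ls ! i"
  defines "L \<equiv> l0 + (\<Sum>i<length ls. ls ! i)"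
  shows "mat_inverse (g_cov l0 ls) = Some (Matrix.mat (length ls) (length ls)
     (\<lambda>(i, j). (if i = j then ls ! i else 0) - ls ! i * ls ! j / L))"
proof (rule mat_inverse_eqI)
  let ?m = "length ls"
  let ?B = "Matrix.mat ?m ?m (\<lambda>(i, j). (if i = j then ls ! i else 0) - ls ! i * ls ! j / L)"
  have L: "0 < L" "0 < l0"
    unfolding L_def using assms by (auto intro!: add_pos_nonneg sum_nonneg simp: less_imp_le)
  have nz: "ls ! i \<noteq> 0" if "i < ?m" for i using assms(2) that by auto
  have s: "(\<Sum>i<?m. ls ! i) = L - l0" by (simp add: L_def)
  have s': "(\<Sum>k<?m. ls ! k * z) = (L - l0) * z" for z
    by (simp only: sum_distrib_right[symmetric] s)
  show c: "g_cov l0 ls \<in> carrier_mat ?m ?m" "?B \<in> carrier_mat ?m ?m" by (auto simp: g_cov_def)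
  have e: "(\<Sum>k<?m. (1 / l0 + (if i = k then 1 / ls ! i else 0)) * ((if k = j then ls ! k else 0) - ls ! k * ls ! j / L))
     = (if i = j then 1 else 0)" if "i < ?m" "j < ?m" for i j
  proof -
    have "(\<Sum>k<?m. (1 / l0 + (if i = k then 1 / ls ! i else 0)) * ((if k = j then ls ! k else 0) - ls ! k * ls ! j / L))
      = (\<Sum>k<?m. (if k = j then ls ! j / l0 else 0) - ls ! k * (ls ! j / (L * l0)) +
          (if k = i then ((if i = j then 1 else 0) - ls ! j / L) else 0))"
      using nz[OF that(1)] L by (intro sum.cong) (auto simp: field_simps)
    also have "\<dots> = ls ! j / l0 - (L - l0) * (ls ! j / (L * l0)) + ((if i = j then 1 else 0) - ls ! j / L)"
      using that by (simp only: sum.distrib sum_subtractf s' sum.delta finite_lessThan lessThan_iff if_True)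
    also have "\<dots> = (if i = j then 1 else 0)" using L by (simp add: field_simps)
    finally show ?thesis .
  qed
  show AB: "g_cov l0 ls * ?B = 1\<^sub>m ?m"
    by (intro eq_matI) (auto simp: g_cov_def scalar_prod_def atLeast0LessThan e)
  show "?B * g_cov l0 ls = 1\<^sub>m ?m"
    using mat_mult_left_right_inverse[OF c AB] .
qed

text \<open>Completing the square exhibits the integrand as a multiple of the normal density with
  mean \<open>b / L\<close> and variance \<open>1 / L\<close>.\<close>

lemma gaussian_integral_quadratic:
  assumes "0 < L"
  shows "(\<integral>\<^sup>+z. ennreal (exp (- (L * z\<^sup>2 - 2 * b * z) / 2)) \<partial>lborel) = ennreal (sqrt (2 * pi / L) * exp (b\<^sup>2 / (2 * L)))"
proof -
  let ?s = "1 / sqrt L"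
  have s: "0 < ?s" "?s\<^sup>2 = 1 / L" using assms by (simp_all add: power_divide)
  have "exp (- (L * z\<^sup>2 - 2 * b * z) / 2) = sqrt (2 * pi / L) * exp (b\<^sup>2 / (2 * L)) * normal_density (b / L) ?s z" for z
  proof -
    have "- (L * z\<^sup>2 - 2 * b * z) / 2 = b\<^sup>2 / (2 * L) + - (z - b / L)\<^sup>2 / (2 * (1 / L))"
      using assms by (simp add: field_simps power2_eq_square)
    then show ?thesis
      using assms by (simp add: normal_density_def s(2) exp_add[symmetric] real_sqrt_divide)
  qed
  then have "(\<integral>\<^sup>+z. ennreal (exp (- (L * z\<^sup>2 - 2 * b * z) / 2)) \<partial>lborel) =
    (\<integral>\<^sup>+z. ennreal (sqrt (2 * pi / L) * exp (b\<^sup>2 / (2 * L))) * ennreal (normal_density (b / L) ?s z) \<partial>lborel)"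
    using assms by (simp add: ennreal_mult)
  also have "\<dots> = ennreal (sqrt (2 * pi / L) * exp (b\<^sup>2 / (2 * L))) * (\<integral>\<^sup>+z. ennreal (normal_density (b / L) ?s z) \<partial>lborel)"
    by (rule nn_integral_cmult) simp
  also have "(\<integral>\<^sup>+z. ennreal (normal_density (b / L) ?s z) \<partial>lborel) = 1"
    using s(1) by (subst nn_integral_eq_integral) auto
  finally show ?thesis by simp
qed

text \<open>A covariance matrix \<open>1/\<lambda>\<^sub>0 + diag (1/\<lambda>\<^sub>i)\<close> means that all components share an independent
  \<open>N(0, 1/\<lambda>\<^sub>0)\<close> summand \<open>z\<close>; integrating over \<open>z\<close> recovers the joint density.\<close>

lemma real_sqrt_prod:
  "sqrt (\<Prod>i\<in>A. f i) = (\<Prod>i\<in>A. sqrt (f i))"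
  by (induction A rule: infinite_finite_induct) (simp_all add: real_sqrt_mult)

lemma centered_gaussian_g_cov_density:
  assumes "0 < l0" "\<forall>i<length ls. 0 < ls ! i"
  shows "ennreal (exp (- (\<Sum>i<length ls. \<Sum>j<length ls. the (mat_inverse (g_cov l0 ls)) $$ (i, j) * x i * x j) / 2)
           / sqrt ((2 * pi) ^ length ls * Determinant.det (g_cov l0 ls))) =
    (\<integral>\<^sup>+z. ennreal (normal_density 0 (1 / sqrt l0) z) *
       (\<Prod>i<length ls. ennreal (normal_density z (1 / sqrt (ls ! i)) (x i))) \<partial>lborel)"
proof -
  let ?m = "length ls"
  \<comment> \<open>Coefficients of the mixture: as a function of \<open>z\<close> its exponent is
    -1/2 times q - 2 b z + L z^2. Integrating out \<open>z\<close> turns this into q - b^2 / L, and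
    the term b^2 / L is precisely the rank one correction in the inverse covariance.\<close>
  define L where "L = l0 + (\<Sum>i<?m. ls ! i)"
  define P where "P = (\<Prod>i<?m. ls ! i)"
  define b where "b = (\<Sum>i<?m. ls ! i * x i)"
  define q where "q = (\<Sum>i<?m. ls ! i * (x i)\<^sup>2)"
  have L: "0 < L" unfolding L_def using assms by (intro add_pos_nonneg sum_nonneg) (auto simp: less_imp_le)
  have P: "0 < P" unfolding P_def using assms by (intro prod_pos) auto
  have quad: "(\<Sum>i<?m. \<Sum>j<?m. the (mat_inverse (g_cov l0 ls)) $$ (i, j) * x i * x j) = q - b\<^sup>2 / L"
  proof -
    have "(\<Sum>i<?m. \<Sum>j<?m. the (mat_inverse (g_cov l0 ls)) $$ (i, j) * x i * x j)
      = (\<Sum>i<?m. \<Sum>j<?m. (if j = i then ls ! i * (x i)\<^sup>2 else 0) - (ls ! i * x i) * (ls ! j * x j) / L)"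
      by (intro sum.cong refl) (simp only: mat_inverse_g_cov[OF assms] L_def[symmetric], auto simp: field_simps power2_eq_square)
    also have "\<dots> = q - (\<Sum>i<?m. \<Sum>j<?m. (ls ! i * x i) * (ls ! j * x j)) / L"
      by (simp add: sum_subtractf q_def sum_divide_distrib)
    also have "(\<Sum>i<?m. \<Sum>j<?m. (ls ! i * x i) * (ls ! j * x j)) = b\<^sup>2"
      by (simp add: b_def power2_eq_square sum_product)
    finally show ?thesis .
  qed
  have nd: "normal_density z (1 / sqrt l) y = sqrt l / sqrt (2 * pi) * exp (- (l * (y - z)\<^sup>2) / 2)" if "0 < l" for l y z :: real
    using that by (simp add: normal_density_def power_divide real_sqrt_divide field_simps)
  have mix: "normal_density 0 (1 / sqrt l0) z * (\<Prod>i<?m. normal_density z (1 / sqrt (ls ! i)) (x i))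
    = sqrt (l0 * P) / sqrt ((2 * pi) ^ (?m + 1)) * exp (- q / 2) * exp (- (L * z\<^sup>2 - 2 * b * z) / 2)" for z
  proof -
    have "(\<Prod>i<?m. normal_density z (1 / sqrt (ls ! i)) (x i)) =
      (\<Prod>i<?m. sqrt (ls ! i) / sqrt (2 * pi) * exp (- (ls ! i * (x i - z)\<^sup>2) / 2))"
      using assms by (intro prod.cong) (auto simp: nd)
    also have "\<dots> = sqrt P / sqrt (2 * pi) ^ ?m * exp (\<Sum>i<?m. - (ls ! i * (x i - z)\<^sup>2) / 2)"
      by (simp add: prod.distrib prod_dividef P_def exp_sum real_sqrt_prod)
    also have "(\<Sum>i<?m. - (ls ! i * (x i - z)\<^sup>2) / 2) = - q / 2 + b * z - (L - l0) * z\<^sup>2 / 2"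
      unfolding q_def b_def L_def
      by (simp add: power2_eq_square algebra_simps sum.distrib sum_subtractf sum_divide_distrib sum_distrib_left sum_negf
         add_divide_distrib diff_divide_distrib)
    finally have *: "(\<Prod>i<?m. normal_density z (1 / sqrt (ls ! i)) (x i)) =
      sqrt P / sqrt (2 * pi) ^ ?m * exp (- q / 2 + b * z - (L - l0) * z\<^sup>2 / 2)" .
    have "exp (- (l0 * (0 - z)\<^sup>2) / 2) * exp (- q / 2 + b * z - (L - l0) * z\<^sup>2 / 2) = exp (- q / 2) * exp (- (L * z\<^sup>2 - 2 * b * z) / 2)"
      unfolding exp_add[symmetric] by (simp add: field_simps power2_eq_square)
    then show ?thesis
      unfolding * normal_density_def[of 0] using assms(1)
      by (simp add: power_divide real_sqrt_divide real_sqrt_mult real_sqrt_power field_simps)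
  qed
  have "(\<integral>\<^sup>+z. ennreal (normal_density 0 (1 / sqrt l0) z) * (\<Prod>i<?m. ennreal (normal_density z (1 / sqrt (ls ! i)) (x i))) \<partial>lborel)
    = (\<integral>\<^sup>+z. ennreal (sqrt (l0 * P) / sqrt ((2 * pi) ^ (?m + 1)) * exp (- q / 2)) * ennreal (exp (- (L * z\<^sup>2 - 2 * b * z) / 2)) \<partial>lborel)"
    using assms(1) P
    by (intro nn_integral_cong) (simp add: prod_ennreal normal_density_nonneg ennreal_mult[symmetric] prod_nonneg mix)
  also have "\<dots> = ennreal (sqrt (l0 * P) / sqrt ((2 * pi) ^ (?m + 1)) * exp (- q / 2)) * ennreal (sqrt (2 * pi / L) * exp (b\<^sup>2 / (2 * L)))"
    by (subst nn_integral_cmult, measurable) (simp only: gaussian_integral_quadratic[OF L])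
  also have "\<dots> = ennreal (exp (- (q - b\<^sup>2 / L) / 2) / sqrt ((2 * pi) ^ ?m * (L / (l0 * P))))"
  proof -
    have "exp (- (q - b\<^sup>2 / L) / 2) = exp (- q / 2) * exp (b\<^sup>2 / (2 * L))"
      unfolding exp_add[symmetric] by (simp add: field_simps)
    then show ?thesis
      using assms(1) P L by (simp add: ennreal_mult[symmetric] real_sqrt_divide real_sqrt_mult field_simps)
  qed
  finally show ?thesis
    using quad det_g_cov[OF assms] by (simp add: L_def P_def)
qed

text \<open>The standard normal distribution function, valued in \<open>ennreal\<close> so that it
  can stand inside nonnegative integrals without conversion.\<close>

definition Phi :: "real \<Rightarrow> ennreal" where
  "Phi a = (\<integral>\<^sup>+t\<in>{..<a}. ennreal (std_normal_density t) \<partial>lborel)"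

lemma normal_tail:
  assumes "0 < \<sigma>"
  shows "(\<integral>\<^sup>+t\<in>{..<a}. ennreal (normal_density \<mu> \<sigma> t) \<partial>lborel) = Phi ((a - \<mu>) / \<sigma>)"
proof -
  have "(\<integral>\<^sup>+t\<in>{..<a}. ennreal (normal_density \<mu> \<sigma> t) \<partial>lborel) =
    \<bar>\<sigma>\<bar> * (\<integral>\<^sup>+t. ennreal (normal_density \<mu> \<sigma> (\<mu> + \<sigma> * t)) * indicator {..<a} (\<mu> + \<sigma> * t) \<partial>lborel)"
    using assms by (subst nn_integral_real_affine[where c = \<sigma> and t = \<mu>]) auto
  also have "\<dots> = (\<integral>\<^sup>+t. ennreal \<sigma> * (ennreal (normal_density \<mu> \<sigma> (\<mu> + \<sigma> * t)) * indicator {..<a} (\<mu> + \<sigma> * t)) \<partial>lborel)"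
    using assms by (subst nn_integral_cmult) auto
  also have "\<dots> = (\<integral>\<^sup>+t. ennreal (std_normal_density t) * indicator {..<(a - \<mu>) / \<sigma>} t \<partial>lborel)"
  proof (rule nn_integral_cong)
    fix t
    have "\<sigma> * normal_density \<mu> \<sigma> (\<mu> + \<sigma> * t) = std_normal_density t"
      using assms by (simp add: normal_density_def real_sqrt_mult power_mult_distrib field_simps)
    moreover have "indicator {..<a} (\<mu> + \<sigma> * t) = (indicator {..<(a - \<mu>) / \<sigma>} t :: ennreal)"
      using assms by (auto simp: indicator_def field_simps)
    ultimately show "ennreal \<sigma> * (ennreal (normal_density \<mu> \<sigma> (\<mu> + \<sigma> * t)) * indicator {..<a} (\<mu> + \<sigma> * t)) =
      ennreal (std_normal_density t) * indicator {..<(a - \<mu>) / \<sigma>} t"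
      using assms by (simp add: mult.assoc[symmetric] ennreal_mult[symmetric])
  qed
  finally show ?thesis by (simp add: Phi_def)
qed

lemma Phi_measurable [measurable]: "Phi \<in> borel_measurable borel"
proof -
  have "(\<lambda>a. \<integral>\<^sup>+t. ennreal (std_normal_density t) * indicator {p. snd p < fst p} (a, t) \<partial>lborel) \<in> borel_measurable borel"
    by measurable
  then show ?thesis
    unfolding Phi_def[abs_def] by (simp add: indicator_def)
qed

lemma Phi_le_1: "Phi a \<le> 1"
proof -
  have "Phi a \<le> (\<integral>\<^sup>+t. ennreal (std_normal_density t) \<partial>lborel)"
    unfolding Phi_def by (intro nn_integral_mono) (auto simp: indicator_def)
  also have "\<dots> = 1" by (subst nn_integral_eq_integral) auto
  finally show ?thesis .
qed

text \<open>Given the common summand \<open>z\<close>, the components are independent normal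
  variables with mean \<open>z\<close> and variance \<open>1 / ls ! i\<close>, so the orthant
  probability factorises. The empty list agrees with the default value 1 of \<open>gfun\<close>
  because the normal density has mass 1.\<close>

lemma gfun_eq:
  assumes "0 < l0" "\<forall>i<length ls. 0 < ls ! i"
  shows "ennreal (gfun l0 ls) =
    (\<integral>\<^sup>+z. ennreal (normal_density 0 (1 / sqrt l0) z) * (\<Prod>i<length ls. Phi (sqrt (ls ! i) * z)) \<partial>lborel)"
proof (cases "ls = []")
  case True
  have "(\<integral>\<^sup>+z. ennreal (normal_density 0 (1 / sqrt l0) z) \<partial>lborel) = 1"
    using assms(1) by (subst nn_integral_eq_integral) auto
  with True show ?thesis by (simp add: gfun_def)
next
  case False
  interpret product_sigma_finite "\<lambda>_::nat. lborel :: real measure" ..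
  interpret P: sigma_finite_measure "PiM {..<length ls} (\<lambda>_::nat. lborel :: real measure)"
    by (rule sigma_finite) simp
  let ?m = "length ls"
  let ?P = "PiM {..<?m} (\<lambda>_::nat. lborel :: real measure)"
  let ?k = "\<lambda>z x. \<Prod>i<?m. ennreal (normal_density z (1 / sqrt (ls ! i)) (x i)) * indicator {..<0} (x i)"
  let ?f = "\<lambda>x. ennreal (exp (- (\<Sum>i<length ls. \<Sum>j<length ls. the (mat_inverse (g_cov l0 ls)) $$ (i, j) * x i * x j) / 2)
           / sqrt ((2 * pi) ^ length ls * Determinant.det (g_cov l0 ls)))"
  let ?N = "density ?P ?f"
  let ?A = "{\<eta> \<in> space ?P. \<forall>i<?m. \<eta> i < 0}"
  have [measurable]: "?f \<in> borel_measurable ?P" by measurable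
  have A: "?A \<in> sets ?P" by measurable
  have "emeasure ?N ?A = (\<integral>\<^sup>+x. ?f x * indicator ?A x \<partial>?P)"
    by (rule emeasure_density) (use A in auto)
  also have "\<dots> = (\<integral>\<^sup>+x. (\<integral>\<^sup>+z. ennreal (normal_density 0 (1 / sqrt l0) z) *
       ?k z x \<partial>lborel) \<partial>?P)"
  proof (rule nn_integral_cong)
    fix x assume x: "x \<in> space ?P"
    have "indicator ?A x = (\<Prod>i<?m. indicator {..<0} (x i) :: ennreal)"
      using x by (auto simp: indicator_def intro!: prod.neutral[symmetric] prod_zero[symmetric])
    then show "?f x * indicator ?A x = (\<integral>\<^sup>+z. ennreal (normal_density 0 (1 / sqrt l0) z) *
       ?k z x \<partial>lborel)"
      unfolding centered_gaussian_g_cov_density[OF assms] prod.distrib mult.assoc[symmetric]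
      by (simp only:) (rule nn_integral_multc[symmetric], unfold normal_density_def, measurable)
  qed
  also have "\<dots> = (\<integral>\<^sup>+z. (\<integral>\<^sup>+x. ennreal (normal_density 0 (1 / sqrt l0) z) *
       ?k z x \<partial>?P) \<partial>lborel)"
  proof -
    interpret pair_sigma_finite "PiM {..<length ls} (\<lambda>_::nat. lborel :: real measure)" "lborel :: real measure" ..
    show ?thesis
      by (rule Fubini'[symmetric]) (simp add: normal_density_def case_prod_beta)
  qed
  also have "\<dots> = (\<integral>\<^sup>+z. ennreal (normal_density 0 (1 / sqrt l0) z) * (\<Prod>i<?m. Phi (- (sqrt (ls ! i) * z))) \<partial>lborel)"
  proof (rule nn_integral_cong)
    fix z :: real
    have "(\<integral>\<^sup>+x. ?k z x \<partial>?P)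
      = (\<Prod>i<?m. (\<integral>\<^sup>+t\<in>{..<0}. ennreal (normal_density z (1 / sqrt (ls ! i)) t) \<partial>lborel))"
      by (rule product_nn_integral_prod) auto
    also have "\<dots> = (\<Prod>i<?m. Phi (- (sqrt (ls ! i) * z)))"
      using assms(2) by (intro prod.cong refl, subst normal_tail) (auto simp: field_simps)
    finally show "(\<integral>\<^sup>+x. ennreal (normal_density 0 (1 / sqrt l0) z) *
       ?k z x \<partial>?P) =
       ennreal (normal_density 0 (1 / sqrt l0) z) * (\<Prod>i<?m. Phi (- (sqrt (ls ! i) * z)))"
      by (subst nn_integral_cmult) auto
  qed
  \<comment> \<open>The density of \<open>z\<close> is even, so the reflection of \<open>z\<close>
    removes the sign inside \<open>Phi\<close>.\<close>
  also have "\<dots> = (\<integral>\<^sup>+z. ennreal (normal_density 0 (1 / sqrt l0) z) * (\<Prod>i<?m. Phi (sqrt (ls ! i) * z)) \<partial>lborel)"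
    by (subst nn_integral_real_affine[where c = "-1" and t = 0]) (auto simp: normal_density_def)
  finally have *: "emeasure ?N ?A = \<dots>" .
  \<comment> \<open>\<open>measure\<close> returns 0 on a set of infinite measure, so finiteness is
    established before passing from \<open>emeasure\<close> to \<open>measure\<close>; the bound
    comes from \<open>Phi_le_1\<close>.\<close>
  have "\<dots> \<le> (\<integral>\<^sup>+z. ennreal (normal_density 0 (1 / sqrt l0) z) * 1 \<partial>lborel)"
    by (intro nn_integral_mono mult_left_mono prod_le_1) (auto simp: Phi_le_1)
  also have "\<dots> = 1"
    using assms(1) by (simp, subst nn_integral_eq_integral) auto
  finally have "emeasure ?N ?A \<noteq> \<infinity>"
    unfolding * by (auto simp: top_unique)
  then have "ennreal (measure ?N ?A) = emeasure ?N ?A"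
    by (simp add: emeasure_eq_ennreal_measure)
  moreover have "gfun l0 ls = measure ?N ?A"
    using False by (simp add: gfun_def Let_def centered_gaussian_def space_density)
  ultimately show ?thesis using * by simp
qed

section \<open>Simplices\<close>

text \<open>The simplex is a translate of the image of the standard simplex, of volume 1 / d!, under
  the matrix whose columns are its edges at the vertex \<open>None\<close>. The change of variables
  covers invertible edge matrices; a singular one flattens the simplex to a null set.\<close>

lemma content_simplex_aug:
  fixes y :: "'d::finite option \<Rightarrow> real ^ 'd"
  shows "measure lborel (convex hull (range y)) = \<bar>det (aug y (\<lambda>_. 1))\<bar> / fact CARD('d)"
proof -
  let ?A = "\<chi> i j. y (Some j) $ i - y None $ i"
  let ?f = "\<lambda>x. ?A *v x"
  let ?S = "convex hull (insert 0 Basis) :: (real ^ 'd) set"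
  have "det ?A = det (transpose (\<chi> i j. y (Some i) $ j - y None $ j))"
    by (simp add: transpose_def)
  then have det: "det ?A = det (aug y (\<lambda>_. 1))" by (simp add: det_aug_one)
  have lin: "linear ?f" by simp
  have f_axis: "?f (axis j 1) = y (Some j) - y None" for j
    by (simp add: matrix_vector_mult_basis column_def vec_eq_iff)
  have "range y = (\<lambda>x. y None + x) ` ?f ` (insert 0 Basis)"
    by (auto simp: Basis_vec_real image_image f_axis UNIV_option_conv)
  then have hull: "convex hull (range y) = (\<lambda>x. y None + x) ` ?f ` ?S"
    by (simp only: convex_hull_translation convex_hull_linear_image[OF lin])
  have bS: "?S \<in> sets borel"
    by (intro borel_compact finite_imp_compact_convex_hull) simp
  have bH: "convex hull (range y) \<in> sets borel"
    by (intro borel_compact finite_imp_compact_convex_hull) simp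
  show ?thesis
  proof (cases "det ?A = 0")
    case True
    then have "\<not> inj ?f"
      using det_nz_iff_inj[OF lin] by simp
    then have "negligible (convex hull (range y))"
      unfolding hull by (intro negligible_translation negligible_linear_singular_image[OF lin])
    then have "measure lebesgue (convex hull (range y)) = 0"
      by (rule negligible_imp_measure0)
    then show ?thesis
      using True bH det by simp
  next
    case False
    then have inj: "inj ?f"
      using det_nz_iff_inj[OF lin] by simp
    have mf: "?f \<in> borel_measurable borel"
      by (rule borel_measurable_matrix_vector_mult)
    have tr: "(\<lambda>x. y None + x) \<in> borel_measurable borel" by simp
    have "emeasure lborel (convex hull (range y)) = (\<integral>\<^sup>+x. indicator (convex hull (range y)) x \<partial>distr lborel borel (\<lambda>x. y None + x))"
      using bH by (simp add: lborel_distr_plus)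
    also have "\<dots> = (\<integral>\<^sup>+x. indicator (convex hull (range y)) (y None + x) \<partial>lborel)"
      using bH by (subst nn_integral_distr) auto
    also have "\<dots> = ennreal \<bar>det ?A\<bar> * (\<integral>\<^sup>+x. indicator (convex hull (range y)) (y None + ?f x) \<partial>lborel)"
      using bH False measurable_compose[OF tr borel_measurable_indicator[OF bH]] by (subst nn_integral_matrix[of _ ?A]) auto
    also have "(\<integral>\<^sup>+x. indicator (convex hull (range y)) (y None + ?f x) \<partial>lborel) = (\<integral>\<^sup>+x. indicator ?S x \<partial>lborel)"
      unfolding hull using inj by (intro nn_integral_cong) (auto simp: indicator_def inj_image_mem_iff)
    also have "\<dots> = emeasure lborel ?S" using bS by simp
    also have "\<dots> = ennreal (1 / fact CARD('d))"
      using content_std_simplex[where 'a = "real ^ 'd"]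
      by (metis DIM_cart DIM_real emeasure_eq_ennreal_measure emeasure_compact_finite finite.insertI finite_Basis
        finite_imp_compact_convex_hull less_top mult.right_neutral infinity_ennreal_def)
    finally have "emeasure lborel (convex hull (range y)) = ennreal (\<bar>det ?A\<bar> * (1 / fact CARD('d)))"
      by (simp only: ennreal_mult[symmetric] abs_ge_zero zero_le_divide_1_iff fact_ge_zero)
    then show ?thesis
      by (simp add: measure_def det)
  qed
qed

text \<open>An arbitrary numbering of the d + 1 elements of \<open>I\<close>. Renumbering permutes
  the rows of \<open>aug\<close>: this changes the determinant at most in sign, and it leaves the
  interpolating hyperplane unchanged when the determinant is nonzero.\<close>

definition enum :: "'i set \<Rightarrow> 'd::finite option \<Rightarrow> 'i" where
  "enum I = (SOME e. bij_betw e UNIV I)"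

lemma bij_betw_enum:
  assumes "card I = CARD('d) + 1"
  shows "bij_betw (enum I :: 'd::finite option \<Rightarrow> 'i) UNIV I"
proof -
  have "finite I" using assms by (metis Suc_eq_plus1 card.infinite nat.distinct(1))
  then have "\<exists>e. bij_betw e (UNIV :: 'd option set) I"
    using assms by (intro finite_same_card_bij) simp_all
  then show ?thesis unfolding enum_def by (rule someI_ex)
qed

text \<open>Barycentric coordinates solve the transposed system with right-hand side (p, 1).\<close>

lemma aug_one_span:
  fixes y :: "'d::finite option \<Rightarrow> real ^ 'd"
  assumes "det (aug y (\<lambda>_. 1)) \<noteq> 0"
  obtains \<alpha> where "(\<Sum>i\<in>UNIV. \<alpha> i) = 1" "(\<Sum>i\<in>UNIV. \<alpha> i *\<^sub>R y i) = p"
proof -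
  let ?W = "transpose (aug y (\<lambda>_. 1))"
  have "det ?W \<noteq> 0" using assms by simp
  then obtain x where x: "?W *v x = join_opt (p, 1)"
    using cramer[of ?W] by blast
  show ?thesis
  proof (rule that[of "\<lambda>i. x $ i"])
    have "(?W *v x) $ None = 1" by (simp only: x join_opt_nth snd_conv)
    then show "(\<Sum>i\<in>UNIV. x $ i) = 1"
      by (simp add: vector_matrix_mult_def aug_def)
    have "(?W *v x) $ Some b = p $ b" for b by (simp only: x join_opt_nth fst_conv)
    then show "(\<Sum>i\<in>UNIV. x $ i *\<^sub>R y i) = p"
      by (simp add: vector_matrix_mult_def aug_def vec_eq_iff mult.commute)
  qed
qed

section \<open>Gaussian measures\<close>

definition gauss1 :: "real measure" where
  "gauss1 = density lborel (\<lambda>x. ennreal (std_normal_density x))"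

definition gauss :: "(real ^ 'd::finite) measure" where
  "gauss = density lborel (\<lambda>x. \<Prod>i\<in>UNIV. ennreal (std_normal_density (x $ i)))"

lemma sets_gauss1 [simp, measurable_cong]: "sets gauss1 = sets borel"
  by (simp add: gauss1_def)

lemma space_gauss1 [simp]: "space gauss1 = UNIV"
  by (simp add: gauss1_def)

lemma sets_gauss [simp, measurable_cong]: "sets gauss = sets borel"
  by (simp add: gauss_def)

lemma space_gauss [simp]: "space gauss = UNIV"
  by (simp add: gauss_def)

lemma prob_space_gauss1: "prob_space gauss1"
  unfolding gauss1_def by (rule prob_space_normal_density) simp

lemma PiM_gauss1:
  assumes "finite I"
  shows "PiM I (\<lambda>_. gauss1) = density (PiM I (\<lambda>_. lborel)) (\<lambda>x. \<Prod>i\<in>I. ennreal (std_normal_density (x i)))"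
proof -
  interpret G: prob_space gauss1 by (rule prob_space_gauss1)
  interpret P: product_sigma_finite "\<lambda>_. gauss1" ..
  interpret L: product_sigma_finite "\<lambda>_. lborel :: real measure" ..
  let ?D = "density (PiM I (\<lambda>_. lborel)) (\<lambda>x. \<Prod>i\<in>I. ennreal (std_normal_density (x i)))"
  show ?thesis
  proof (rule P.PiM_eqI[symmetric, OF assms])
    show "sets ?D = sets (PiM I (\<lambda>_. gauss1))"
      by (simp cong: sets_PiM_cong)
    fix A assume A: "\<And>i. i \<in> I \<Longrightarrow> A i \<in> sets gauss1"
    have "emeasure ?D (PiE I A)
       = (\<integral>\<^sup>+x. (\<Prod>i\<in>I. ennreal (std_normal_density (x i))) * indicator (PiE I A) x \<partial>PiM I (\<lambda>_. lborel))"
      using A assms by (intro emeasure_density) (auto intro!: sets_PiM_I_finite)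
    also have "\<dots> = (\<integral>\<^sup>+x. (\<Prod>i\<in>I. ennreal (std_normal_density (x i)) * indicator (A i) (x i)) \<partial>PiM I (\<lambda>_. lborel))"
    proof (rule nn_integral_cong)
      fix x :: "'a \<Rightarrow> real" assume x: "x \<in> space (PiM I (\<lambda>_. lborel))"
      have "indicator (PiE I A) x = (\<Prod>i\<in>I. indicator (A i) (x i) :: ennreal)"
        using x assms by (auto simp: indicator_def space_PiM PiE_iff intro!: prod.neutral[symmetric] prod_zero[symmetric])
      then show "(\<Prod>i\<in>I. ennreal (std_normal_density (x i))) * indicator (PiE I A) x =
        (\<Prod>i\<in>I. ennreal (std_normal_density (x i)) * indicator (A i) (x i))"
        by (simp add: prod.distrib)
    qed
    also have "\<dots> = (\<Prod>i\<in>I. \<integral>\<^sup>+t. ennreal (std_normal_density t) * indicator (A i) t \<partial>lborel)"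
      using A assms by (intro L.product_nn_integral_prod) auto
    also have "\<dots> = (\<Prod>i\<in>I. emeasure gauss1 (A i))"
      using A by (intro prod.cong refl) (simp add: gauss1_def emeasure_density)
    finally show "emeasure ?D (PiE I A) =
      (\<Prod>i\<in>I. emeasure gauss1 (A i))" .
  qed
qed

lemma distr_PiM_gauss1:
  "distr (PiM (UNIV :: 'd::finite set) (\<lambda>_. gauss1)) borel (\<lambda>f. \<chi> i. f i) = gauss"
proof (rule measure_eqI)
  note m = measurable_vec_lambda[where 'n = 'd, OF sets_gauss1]
  note m' = measurable_vec_lambda[where 'n = 'd, OF sets_lborel]
  fix A assume "A \<in> sets (distr (PiM (UNIV :: 'd set) (\<lambda>_. gauss1)) borel (\<lambda>f. \<chi> i. f i))"
  then have A: "A \<in> sets borel" by simp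
  have "emeasure gauss A = (\<integral>\<^sup>+x. (\<Prod>i\<in>UNIV. ennreal (std_normal_density (x $ i))) * indicator A x \<partial>lborel)"
    unfolding gauss_def using A by (intro emeasure_density) auto
  also have "\<dots> = (\<integral>\<^sup>+f. (\<Prod>i\<in>UNIV. ennreal (std_normal_density (f i))) * indicator A (\<chi> i. f i) \<partial>PiM UNIV (\<lambda>_. lborel))"
    using A by (subst nn_integral_lborel_vec) auto
  also have "\<dots> = (\<integral>\<^sup>+f. indicator A (\<chi> i. f i) \<partial>PiM UNIV (\<lambda>_. gauss1))"
    unfolding PiM_gauss1[OF finite] using A m' by (subst nn_integral_density) auto
  also have "\<dots> = (\<integral>\<^sup>+x. indicator A x \<partial>distr (PiM (UNIV :: 'd set) (\<lambda>_. gauss1)) borel (\<lambda>f. \<chi> i. f i))"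
    using A m by (subst nn_integral_distr) auto
  finally show "emeasure (distr (PiM (UNIV :: 'd set) (\<lambda>_. gauss1)) borel (\<lambda>f. \<chi> i. f i)) A = emeasure gauss A"
    using A by simp
qed simp

lemma prob_space_gauss: "prob_space (gauss :: (real ^ 'd::finite) measure)"
proof -
  note m = measurable_vec_lambda[where 'n = 'd, OF sets_gauss1]
  have "prob_space (PiM (UNIV :: 'd set) (\<lambda>_. gauss1))"
    by (intro prob_space_PiM prob_space_gauss1)
  then show ?thesis
    unfolding distr_PiM_gauss1[symmetric] using m by (rule prob_space.prob_space_distr)
qed

lemma prod_std_normal_density:
  fixes x :: "real ^ 'd::finite"
  shows "(\<Prod>i\<in>UNIV. ennreal (std_normal_density (x $ i))) = ennreal (exp (- (x \<bullet> x) / 2) / sqrt (2 * pi) ^ CARD('d))"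
proof -
  have "(\<Prod>i\<in>UNIV. std_normal_density (x $ i)) = (\<Prod>i\<in>UNIV. exp (- (x $ i * x $ i) / 2)) / sqrt (2 * pi) ^ CARD('d)"
    by (simp add: std_normal_density_def prod_dividef power2_eq_square)
  also have "(\<Prod>i\<in>UNIV. exp (- (x $ i * x $ i) / 2)) = exp (- (x \<bullet> x) / 2)"
    by (simp add: exp_sum[symmetric] inner_vec_def sum_negf sum_divide_distrib)
  finally show ?thesis by (simp add: prod_ennreal)
qed

lemma nn_integral_gauss:
  fixes F :: "real ^ 'd::finite \<Rightarrow> ennreal"
  assumes "F \<in> borel_measurable borel"
  shows "(\<integral>\<^sup>+x. F x \<partial>gauss) = (\<integral>\<^sup>+x. ennreal (exp (- (x \<bullet> x) / 2) / sqrt (2 * pi) ^ CARD('d)) * F x \<partial>lborel)"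
  unfolding gauss_def prod_std_normal_density using assms by (subst nn_integral_density) auto

lemma std_normal_density_mult_gauss:
  "std_normal_density t * (exp (- q / 2) / c) = exp (- (q + t\<^sup>2) / 2) / (sqrt (2 * pi) * c)"
proof -
  have "- (q + t\<^sup>2) / 2 = - t\<^sup>2 / 2 + - q / 2" by (simp add: add_divide_distrib)
  then show ?thesis
    by (simp only: std_normal_density_def exp_add) simp
qed

text \<open>Conditioning a standard Gaussian vector on a noisy linear observation: \<open>T = (I + v v\<^sup>T)\<^sup>-\<^sup>1\<^sup>/\<^sup>2\<close> is a
  rank one perturbation of the identity.\<close>

lemma gauss_observation:
  fixes v :: "real ^ 'd::finite"
  obtains T :: "real ^ 'd ^ 'd" where "\<bar>det T\<bar> = 1 / sqrt (1 + v \<bullet> v)"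
    "\<And>t F. F \<in> borel_measurable borel \<Longrightarrow>
       (\<integral>\<^sup>+x. F x * ennreal (std_normal_density (v \<bullet> x + t)) \<partial>gauss) =
       ennreal (normal_density 0 (sqrt (1 + v \<bullet> v)) t) * (\<integral>\<^sup>+x. F (x v* T - (t / (1 + v \<bullet> v)) *\<^sub>R v) \<partial>gauss)"
proof -
  define q where "q = v \<bullet> v"
  define r where "r = 1 / sqrt (1 + q)"
  \<comment> \<open>Chosen so that \<open>T\<close>, the identity plus \<open>\<kappa>\<close> times
    v v^T, scales \<open>v\<close> by \<open>r\<close> and fixes its orthogonal complement; this is
    \<open>1 + \<kappa> * q = r\<close>. The case \<open>q = 0\<close> means \<open>v = 0\<close>,
    where \<open>T\<close> is the identity.\<close>
  define \<kappa> where "\<kappa> = (if q = 0 then 0 else (r - 1) / q)"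
  define T :: "real ^ 'd ^ 'd" where "T = (\<chi> i j. (if i = j then 1 else 0) + \<kappa> * v $ i * v $ j)"
  have q0: "0 \<le> q" by (simp add: q_def)
  then have r: "0 < r" "r\<^sup>2 * (1 + q) = 1" by (simp_all add: r_def power_divide)
  have \<kappa>: "1 + \<kappa> * q = r" using q0 by (auto simp: \<kappa>_def r_def)
  have Tx: "T *v x = x + (\<kappa> * (v \<bullet> x)) *\<^sub>R v" for x
  proof -
    have "(T *v x) $ i = x $ i + \<kappa> * (v \<bullet> x) * v $ i" for i
    proof -
      have "(T *v x) $ i = (\<Sum>j\<in>UNIV. (if j = i then x $ j else 0) + \<kappa> * v $ i * (v $ j * x $ j))"
        unfolding matrix_vector_mult_def T_def by (auto intro!: sum.cong simp: algebra_simps)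
      then show ?thesis by (simp add: sum.distrib sum_distrib_left[symmetric] inner_vec_def mult.commute)
    qed
    then show ?thesis by (simp add: vec_eq_iff)
  qed
  have "transpose T = T" by (auto simp: T_def transpose_def vec_eq_iff)
  then have xT: "x v* T = T *v x" for x by (metis transpose_matrix_vector)
  have vT: "v \<bullet> (T *v x) = r * (v \<bullet> x)" for x
    unfolding Tx inner_add_right inner_scaleR_right q_def[symmetric] \<kappa>[symmetric] by (simp add: algebra_simps)
  have "x = 0" if "T *v x = 0" for x
  proof -
    have "v \<bullet> x = 0" using vT[of x] that r(1) by simp
    then show ?thesis using that by (simp add: Tx)
  qed
  then have "\<exists>B. B ** T = mat 1" using matrix_left_invertible_ker[of T] by blast
  then have dT: "det T \<noteq> 0" by (simp add: invertible_det_nz[symmetric] invertible_left_inverse)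
  have mT: "(\<lambda>x. T *v x) \<in> borel_measurable borel"
    by (rule borel_measurable_matrix_vector_mult)
  let ?E = "\<lambda>t. exp (- (t\<^sup>2 / (1 + q)) / 2) / sqrt (2 * pi)" and ?s = "\<lambda>t. (t / (1 + q)) *\<^sub>R v"
  \<comment> \<open>Completing the square: |x|^2 + (v x + t)^2 is minimal at -(t / (1 + q)) v with
    value t^2 / (1 + q). The substitution centres there and \<open>T\<close> normalises the
    remaining quadratic form.\<close>
  have norm: "(T *v x - ?s t) \<bullet> (T *v x - ?s t) + (v \<bullet> (T *v x - ?s t) + t)\<^sup>2
     = x \<bullet> x + t\<^sup>2 / (1 + q)" for x t
  proof -
    let ?a = "v \<bullet> x" and ?c = "t / (1 + q)"
    have TT: "(T *v x) \<bullet> (T *v x) = x \<bullet> x + (2 * \<kappa> + \<kappa>\<^sup>2 * q) * ?a\<^sup>2"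
      unfolding Tx by (simp add: inner_add_left inner_add_right q_def inner_commute power2_eq_square algebra_simps)
    have k: "(2 * \<kappa> + \<kappa>\<^sup>2 * q + r\<^sup>2) * ?a\<^sup>2 = 0"
    proof (cases "q = 0")
      case True
      then show ?thesis by (simp add: q_def)
    next
      case False
      have "q * (2 * \<kappa> + \<kappa>\<^sup>2 * q + r\<^sup>2) = (1 + \<kappa> * q)\<^sup>2 + r\<^sup>2 * q - 1"
        by (simp add: power2_eq_square algebra_simps)
      also have "\<dots> = 0" using r(2) unfolding \<kappa> by (simp add: algebra_simps)
      finally show ?thesis using False by simp
    qed
    have "?c * (1 + q) = t" using q0 by simp
    then have ct: "?c * q + ?c = t" by (simp only: distrib_left mult_1_right add.commute)
    have sq: "(X - c *\<^sub>R v) \<bullet> (X - c *\<^sub>R v) = X \<bullet> X - 2 * c * (v \<bullet> X) + c\<^sup>2 * q" for X c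
      by (simp add: inner_diff_left inner_diff_right inner_commute q_def power2_eq_square algebra_simps)
    have vs: "v \<bullet> (X - c *\<^sub>R v) = v \<bullet> X - c * q" for X c
      by (simp add: inner_diff_right q_def)
    have "(T *v x - ?c *\<^sub>R v) \<bullet> (T *v x - ?c *\<^sub>R v) + (v \<bullet> (T *v x - ?c *\<^sub>R v) + t)\<^sup>2 =
       (T *v x) \<bullet> (T *v x) - 2 * ?c * (r * ?a) + ?c\<^sup>2 * q + (r * ?a - ?c * q + t)\<^sup>2"
      by (simp only: sq vs vT)
    also have "r * ?a - ?c * q + t = r * ?a + ?c" using ct by simp
    also have "(T *v x) \<bullet> (T *v x) - 2 * ?c * (r * ?a) + ?c\<^sup>2 * q + (r * ?a + ?c)\<^sup>2 =
       x \<bullet> x + (2 * \<kappa> + \<kappa>\<^sup>2 * q + r\<^sup>2) * ?a\<^sup>2 + ?c * (?c * q + ?c)"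
      unfolding TT by (simp add: power2_eq_square algebra_simps)
    also have "\<dots> = x \<bullet> x + t\<^sup>2 / (1 + q)"
      unfolding k ct by (simp add: power2_eq_square)
    finally show ?thesis .
  qed
  have main: "(\<integral>\<^sup>+x. F x * ennreal (std_normal_density (v \<bullet> x + t)) \<partial>gauss) =
    ennreal (\<bar>det T\<bar> * (?E t)) * (\<integral>\<^sup>+x. F (T *v x - ?s t) \<partial>gauss)"
    if F[measurable]: "F \<in> borel_measurable borel" for F :: "_ \<Rightarrow> ennreal" and t
  proof -
    let ?n = "sqrt (2 * pi) ^ CARD('d)"
    let ?c = "- ?s t"
    define H where "H x = ennreal (exp (- (x \<bullet> x + (v \<bullet> x + t)\<^sup>2) / 2) / (sqrt (2 * pi) * ?n)) * F x" for x
    have [measurable]: "H \<in> borel_measurable borel" unfolding H_def by measurable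
    have [measurable]: "(\<lambda>x. T *v x) \<in> borel_measurable borel" by (rule mT)
    have "(\<integral>\<^sup>+x. F x * ennreal (std_normal_density (v \<bullet> x + t)) \<partial>gauss) = (\<integral>\<^sup>+x. H x \<partial>lborel)"
    proof (subst nn_integral_gauss, measurable, rule nn_integral_cong)
      fix x
      have "ennreal (std_normal_density (v \<bullet> x + t) * (exp (- (x \<bullet> x) / 2) / ?n)) =
        ennreal (std_normal_density (v \<bullet> x + t)) * ennreal (exp (- (x \<bullet> x) / 2) / ?n)"
        by (rule ennreal_mult) simp_all
      then show "ennreal (exp (- (x \<bullet> x) / 2) / ?n) * (F x * ennreal (std_normal_density (v \<bullet> x + t))) = H x"
        unfolding H_def std_normal_density_mult_gauss[symmetric] by (simp only: mult_ac)
    qed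
    also have "\<dots> = (\<integral>\<^sup>+x. H x \<partial>distr lborel borel (\<lambda>x. ?c + x))"
      by (simp only: lborel_distr_plus)
    also have "\<dots> = (\<integral>\<^sup>+x. H (?c + x) \<partial>lborel)"
      by (subst nn_integral_distr) auto
    also have "\<dots> = ennreal \<bar>det T\<bar> * (\<integral>\<^sup>+x. H (?c + T *v x) \<partial>lborel)"
      by (rule nn_integral_matrix) (use dT in auto)
    also have "(\<integral>\<^sup>+x. H (?c + T *v x) \<partial>lborel) = (\<integral>\<^sup>+x. ennreal (?E t) *
        (ennreal (exp (- (x \<bullet> x) / 2) / ?n) * F (T *v x - ?s t)) \<partial>lborel)"
    proof (rule nn_integral_cong)
      fix x
      have c: "?c + T *v x = T *v x - ?s t" by simp
      have e: "exp (- (a + b) / 2) = exp (- b / 2) * exp (- a / 2)" for a b :: real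
        by (simp add: exp_add[symmetric] add_divide_distrib)
      have E: "ennreal (exp (- (x \<bullet> x + t\<^sup>2 / (1 + q)) / 2) / (sqrt (2 * pi) * ?n)) =
        ennreal (?E t) * ennreal (exp (- (x \<bullet> x) / 2) / ?n)"
        unfolding e times_divide_times_eq[symmetric] by (rule ennreal_mult) simp_all
      have "H (?c + T *v x) = ennreal (exp (- (x \<bullet> x + t\<^sup>2 / (1 + q)) / 2) / (sqrt (2 * pi) * ?n)) *
        F (T *v x - ?s t)"
        by (simp only: c H_def norm)
      then show "H (?c + T *v x) = ennreal (?E t) *
        (ennreal (exp (- (x \<bullet> x) / 2) / ?n) * F (T *v x - ?s t))"
        by (simp only: E mult.assoc)
    qed
    also have "\<dots> = ennreal (?E t) * (\<integral>\<^sup>+x. F (T *v x - ?s t) \<partial>gauss)"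
      by (subst nn_integral_gauss, measurable) (rule nn_integral_cmult, measurable)
    finally have "(\<integral>\<^sup>+x. F x * ennreal (std_normal_density (v \<bullet> x + t)) \<partial>gauss) = ennreal \<bar>det T\<bar> *
      (ennreal (?E t) * (\<integral>\<^sup>+x. F (T *v x - ?s t) \<partial>gauss))" .
    moreover have "ennreal (\<bar>det T\<bar> * (?E t)) =
      ennreal \<bar>det T\<bar> * ennreal (?E t)"
      by (rule ennreal_mult) simp_all
    ultimately show ?thesis by (simp only: mult.assoc)
  qed
  interpret G: prob_space "gauss :: (real ^ 'd) measure" by (rule prob_space_gauss)
  have nd: "normal_density 0 (sqrt (1 + q)) t = r * (?E t)" for t
  proof -
    have "- t\<^sup>2 / (2 * (1 + q)) = - (t\<^sup>2 / (1 + q)) / 2" using q0 by (simp add: field_simps)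
    moreover have "normal_density 0 (sqrt (1 + q)) t = 1 / sqrt (2 * pi * (1 + q)) * exp (- t\<^sup>2 / (2 * (1 + q)))"
      using q0 by (simp add: normal_density_def)
    ultimately show ?thesis
      by (simp only: real_sqrt_mult[of "2 * pi" "1 + q"] r_def) simp
  qed
  \<comment> \<open>The determinant is obtained from total masses instead of an expansion:
    \<open>main\<close> with \<open>F\<close> constant 1, integrated over \<open>t\<close>, gives
    \<open>\<bar>det T\<bar> / r\<close>, while Fubini in the other order gives 1.\<close>
  have dT': "\<bar>det T\<bar> = r"
  proof -
    interpret pair_sigma_finite "gauss :: (real ^ 'd) measure" "lborel :: real measure"
      by (intro pair_sigma_finite.intro G.sigma_finite_measure_axioms sigma_finite_lborel)
    have "(\<integral>\<^sup>+t. \<integral>\<^sup>+x. ennreal (std_normal_density (v \<bullet> x + t)) \<partial>gauss \<partial>lborel) =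
      (\<integral>\<^sup>+x. \<integral>\<^sup>+t. ennreal (std_normal_density (v \<bullet> x + t)) \<partial>lborel \<partial>gauss)"
      by (rule Fubini') measurable
    also have "\<dots> = (\<integral>\<^sup>+x. 1 \<partial>(gauss :: (real ^ 'd) measure))"
    proof (rule nn_integral_cong)
      fix x :: "real ^ 'd"
      have "(\<integral>\<^sup>+t. ennreal (std_normal_density (v \<bullet> x + t)) \<partial>lborel) = (\<integral>\<^sup>+t. ennreal (std_normal_density t) \<partial>lborel)"
        by (subst nn_integral_real_affine[where c = 1 and t = "v \<bullet> x"]) auto
      also have "\<dots> = 1" by (subst nn_integral_eq_integral) auto
      finally show "(\<integral>\<^sup>+t. ennreal (std_normal_density (v \<bullet> x + t)) \<partial>lborel) = 1" .
    qed
    also have "\<dots> = 1" by (simp add: G.emeasure_space_1[simplified])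
    finally have 1: "(\<integral>\<^sup>+t. \<integral>\<^sup>+x. ennreal (std_normal_density (v \<bullet> x + t)) \<partial>gauss \<partial>lborel) = 1" .
    have "(\<integral>\<^sup>+x. ennreal (std_normal_density (v \<bullet> x + t)) \<partial>gauss) = ennreal (\<bar>det T\<bar> / r) * ennreal (normal_density 0 (sqrt (1 + q)) t)" for t
      using main[of "\<lambda>_. 1" t] r(1) by (simp add: nd G.emeasure_space_1[simplified] ennreal_mult[symmetric])
    then have "(\<integral>\<^sup>+t. \<integral>\<^sup>+x. ennreal (std_normal_density (v \<bullet> x + t)) \<partial>gauss \<partial>lborel) =
      ennreal (\<bar>det T\<bar> / r) * (\<integral>\<^sup>+t. ennreal (normal_density 0 (sqrt (1 + q)) t) \<partial>lborel)"
      by (simp add: nn_integral_cmult)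
    also have "(\<integral>\<^sup>+t. ennreal (normal_density 0 (sqrt (1 + q)) t) \<partial>lborel) = 1"
      using q0 by (subst nn_integral_eq_integral) auto
    finally have "ennreal (\<bar>det T\<bar> / r) = 1" using 1 by (simp only: mult_1_right)
    then have "\<bar>det T\<bar> / r = 1" by (simp only: ennreal_eq_1)
    then show ?thesis by (simp only: divide_eq_1_iff)
  qed
  show ?thesis
  proof (rule that[of T])
    show "\<bar>det T\<bar> = 1 / sqrt (1 + v \<bullet> v)" using dT' by (simp add: r_def q_def)
    fix t and F :: "real ^ 'd \<Rightarrow> ennreal" assume "F \<in> borel_measurable borel"
    from main[OF this, of t] show "(\<integral>\<^sup>+x. F x * ennreal (std_normal_density (v \<bullet> x + t)) \<partial>gauss) =
       ennreal (normal_density 0 (sqrt (1 + v \<bullet> v)) t) * (\<integral>\<^sup>+x. F (x v* T - (t / (1 + v \<bullet> v)) *\<^sub>R v) \<partial>gauss)"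
      by (simp only: dT' nd[symmetric] xT q_def[symmetric])
  qed
qed

text \<open>Tensorises a one-variable rule: if weighting \<open>M\<close> by \<open>w i\<close>
  amounts to the factor \<open>c i\<close> and the substitution \<open>S i\<close>, the product
  weight amounts to the product factor and the coordinatewise substitution. It carries
  \<open>gauss_observation\<close> to all vertices at once.\<close>

lemma nn_integral_PiM_weighted:
  fixes M :: "'a measure" and F :: "('i \<Rightarrow> 'a) \<Rightarrow> ennreal"
  assumes M: "sigma_finite_measure M" and "finite I"
    and "\<And>i. i \<in> I \<Longrightarrow> w i \<in> borel_measurable M"
    and "\<And>i. i \<in> I \<Longrightarrow> S i \<in> measurable M M"
    and "\<And>i F. i \<in> I \<Longrightarrow> F \<in> borel_measurable M \<Longrightarrow>
      (\<integral>\<^sup>+x. F x * w i x \<partial>M) = c i * (\<integral>\<^sup>+x. F (S i x) \<partial>M)"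
    and "F \<in> borel_measurable (PiM I (\<lambda>_. M))"
  shows "(\<integral>\<^sup>+x. F x * (\<Prod>i\<in>I. w i (x i)) \<partial>PiM I (\<lambda>_. M)) =
    (\<Prod>i\<in>I. c i) * (\<integral>\<^sup>+x. F (\<lambda>i\<in>I. S i (x i)) \<partial>PiM I (\<lambda>_. M))"
  using assms(2-)
proof (induction I arbitrary: F rule: finite_induct)
  case empty
  have "(\<integral>\<^sup>+x. F (\<lambda>i\<in>{}. S i (x i)) \<partial>PiM {} (\<lambda>_. M)) = (\<integral>\<^sup>+x. F x \<partial>PiM {} (\<lambda>_. M))"
    by (rule nn_integral_cong) (auto simp: space_PiM restrict_def)
  then show ?case by (simp only: prod.empty mult_1_right mult_1_left)
next
  case (insert i I F)
  let ?P = "PiM I (\<lambda>_. M)" and ?Q = "PiM (insert i I) (\<lambda>_. M)"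
  interpret sigma_finite_measure M by fact
  interpret product_sigma_finite "\<lambda>_::'i. M" ..
  note [measurable] = insert.prems(1,2,4)
  have w_i [measurable]: "w i \<in> borel_measurable M" and S_i [measurable]: "S i \<in> measurable M M" by simp_all
  have upd [measurable]: "(\<lambda>(x, y). x(i := y)) \<in> measurable (?P \<Otimes>\<^sub>M M) ?Q"
    by (rule measurable_add_dim)
  have Fu: "(\<lambda>p. F ((fst p)(i := snd p))) \<in> borel_measurable (?P \<Otimes>\<^sub>M M)"
    using measurable_compose[OF upd insert.prems(4)] by (simp add: case_prod_beta)
  have Fy [measurable]: "(\<lambda>y. F (x(i := y))) \<in> borel_measurable M" if "x \<in> space ?P" for x
    using measurable_compose[OF measurable_Pair1'[OF that] Fu] by simp
  have FS: "(\<lambda>p. F ((fst p)(i := S i (snd p)))) \<in> borel_measurable (?P \<Otimes>\<^sub>M M)"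
  proof -
    have "(\<lambda>p. (fst p, S i (snd p))) \<in> measurable (?P \<Otimes>\<^sub>M M) (?P \<Otimes>\<^sub>M M)"
      by measurable
    from measurable_compose[OF this Fu] show ?thesis by simp
  qed
  \<comment> \<open>Coordinate \<open>i\<close> is already substituted and integrated out here; the
    induction hypothesis is applied to this function, hence the generalisation over
    \<open>F\<close>.\<close>
  define H where "H x = (\<integral>\<^sup>+y. F (x(i := S i y)) \<partial>M)" for x
  have H [measurable]: "H \<in> borel_measurable ?P"
    unfolding H_def using borel_measurable_nn_integral_fst[OF FS] by simp
  have w_I [measurable]: "(\<lambda>x. \<Prod>j\<in>I. w j (x j)) \<in> borel_measurable ?P"
  proof (rule borel_measurable_prod_ennreal)
    fix j assume j: "j \<in> I"
    from measurable_compose[OF measurable_component_singleton[OF j, of "\<lambda>_. M"]] insert.prems(1)[of j] j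
    show "(\<lambda>x. w j (x j)) \<in> borel_measurable ?P" by simp
  qed
  have w_I' [measurable]: "(\<lambda>x. \<Prod>j\<in>insert i I. w j (x j)) \<in> borel_measurable ?Q"
  proof (rule borel_measurable_prod_ennreal)
    fix j assume j: "j \<in> insert i I"
    from measurable_compose[OF measurable_component_singleton[OF j, of "\<lambda>_. M"]] insert.prems(1)[of j] j
    show "(\<lambda>x. w j (x j)) \<in> borel_measurable ?Q" by simp
  qed
  have w_I'': "(\<lambda>x. F x * (\<Prod>j\<in>insert i I. w j (x j))) \<in> borel_measurable ?Q"
    by measurable
  have "(\<integral>\<^sup>+x. F x * (\<Prod>j\<in>insert i I. w j (x j)) \<partial>?Q) =
    (\<integral>\<^sup>+x. \<integral>\<^sup>+y. F (x(i := y)) * (\<Prod>j\<in>insert i I. w j ((x(i := y)) j)) \<partial>M \<partial>?P)"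
    using insert.hyps w_I'' by (intro product_nn_integral_insert) auto
  also have "\<dots> = (\<integral>\<^sup>+x. c i * (H x * (\<Prod>j\<in>I. w j (x j))) \<partial>?P)"
  proof (rule nn_integral_cong)
    fix x assume x: "x \<in> space ?P"
    have "(\<Prod>j\<in>I. w j (if j = i then y else x j)) = (\<Prod>j\<in>I. w j (x j))" for y
      using insert.hyps by (intro prod.cong) auto
    then have "(\<integral>\<^sup>+y. F (x(i := y)) * (\<Prod>j\<in>insert i I. w j ((x(i := y)) j)) \<partial>M) =
      (\<integral>\<^sup>+y. (\<Prod>j\<in>I. w j (x j)) * (F (x(i := y)) * w i y) \<partial>M)"
      using insert.hyps by (intro nn_integral_cong) (simp add: mult_ac)
    also have "\<dots> = (\<Prod>j\<in>I. w j (x j)) * (\<integral>\<^sup>+y. F (x(i := y)) * w i y \<partial>M)"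
      by (intro nn_integral_cmult borel_measurable_times_ennreal Fy[OF x] w_i)
    also have "(\<integral>\<^sup>+y. F (x(i := y)) * w i y \<partial>M) = c i * H x"
      unfolding H_def using Fy[OF x] by (intro insert.prems(3)) auto
    finally show "(\<integral>\<^sup>+y. F (x(i := y)) * (\<Prod>j\<in>insert i I. w j ((x(i := y)) j)) \<partial>M) = c i * (H x * (\<Prod>j\<in>I. w j (x j)))"
      by (simp only: mult_ac)
  qed
  also have "\<dots> = c i * (\<integral>\<^sup>+x. H x * (\<Prod>j\<in>I. w j (x j)) \<partial>?P)"
    by (rule nn_integral_cmult) measurable
  also have "(\<integral>\<^sup>+x. H x * (\<Prod>j\<in>I. w j (x j)) \<partial>?P) =
     (\<Prod>j\<in>I. c j) * (\<integral>\<^sup>+x. H (\<lambda>j\<in>I. S j (x j)) \<partial>?P)"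
    using insert.prems H by (intro insert.IH) auto
  also have "(\<integral>\<^sup>+x. H (\<lambda>j\<in>I. S j (x j)) \<partial>?P) =
    (\<integral>\<^sup>+x. F (\<lambda>j\<in>insert i I. S j (x j)) \<partial>?Q)"
  proof -
    have "(\<lambda>x. \<lambda>j\<in>insert i I. S j (x j)) \<in> measurable ?Q ?Q"
    proof (rule measurable_restrict)
      fix j assume j: "j \<in> insert i I"
      from measurable_compose[OF measurable_component_singleton[OF j, of "\<lambda>_. M"]] insert.prems(2)[of j] j
      show "(\<lambda>x. S j (x j)) \<in> measurable ?Q M" by simp
    qed
    from measurable_compose[OF this insert.prems(4)]
    have "(\<integral>\<^sup>+x. F (\<lambda>j\<in>insert i I. S j (x j)) \<partial>?Q) =
      (\<integral>\<^sup>+x. \<integral>\<^sup>+y. F (\<lambda>j\<in>insert i I. S j ((x(i := y)) j)) \<partial>M \<partial>?P)"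
      using insert.hyps by (intro product_nn_integral_insert) auto
    moreover have "(\<lambda>j\<in>insert i I. S j ((x(i := y)) j)) = (\<lambda>j\<in>I. S j (x j))(i := S i y)" for x y
      using insert.hyps by (auto simp: fun_eq_iff restrict_def)
    ultimately show ?thesis by (simp only: H_def)
  qed
  finally show ?case
    by (simp only: prod.insert[OF insert.hyps(1,2)] mult.assoc)
qed

section \<open>Gaussian moments and the second moment of the augmented determinant\<close>

lemma integrable_gauss1_power: "integrable gauss1 (\<lambda>x. x ^ k)"
  unfolding gauss1_def using integrable_std_normal_moment[of k]
  by (subst integrable_density) (auto simp: mult.commute)

lemma integral_gauss1_power: "integral\<^sup>L gauss1 (\<lambda>x. x ^ k) = (LBINT x. std_normal_density x * x ^ k)"
  unfolding gauss1_def set_lebesgue_integral_def by (subst integral_density) auto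

lemma gauss1_moments:
  "integral\<^sup>L gauss1 (\<lambda>x. x ^ 0) = 1" "integral\<^sup>L gauss1 (\<lambda>x. x ^ 1) = 0" "integral\<^sup>L gauss1 (\<lambda>x. x ^ 2) = 1"
  unfolding integral_gauss1_power set_lebesgue_integral_def
  using integral_std_normal_moment_even[of 0] integral_std_normal_moment_odd[of 0] integral_std_normal_moment_even[of 1]
  by simp_all

lemma gauss_moment:
  fixes k :: "'d::finite \<Rightarrow> nat"
  shows "has_bochner_integral gauss (\<lambda>x. \<Prod>i\<in>UNIV. (x $ i) ^ k i) (\<Prod>i\<in>UNIV. integral\<^sup>L gauss1 (\<lambda>x. x ^ k i))"
proof -
  interpret G: prob_space gauss1 by (rule prob_space_gauss1)
  interpret P: product_sigma_finite "\<lambda>_::'d. gauss1" ..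
  note m = measurable_vec_lambda[where 'n = 'd, OF sets_gauss1]
  have m2: "(\<lambda>x::real^'d. \<Prod>i\<in>UNIV. (x $ i) ^ k i) \<in> borel_measurable borel" by measurable
  have "integrable (PiM (UNIV :: 'd set) (\<lambda>_. gauss1)) (\<lambda>f. \<Prod>i\<in>UNIV. f i ^ k i)"
    by (rule P.product_integrable_prod) (auto intro: integrable_gauss1_power)
  moreover have "integral\<^sup>L (PiM (UNIV :: 'd set) (\<lambda>_. gauss1)) (\<lambda>f. \<Prod>i\<in>UNIV. f i ^ k i) = (\<Prod>i\<in>UNIV. integral\<^sup>L gauss1 (\<lambda>x. x ^ k i))"
    by (rule P.product_integral_prod) (auto intro: integrable_gauss1_power)
  ultimately show ?thesis
    unfolding has_bochner_integral_iff distr_PiM_gauss1[symmetric]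
    using m m2 by (simp add: integrable_distr_eq integral_distr)
qed

lemma gauss_moment1: "has_bochner_integral gauss (\<lambda>x::real^'d::finite. x $ b) 0"
proof -
  have "(\<Prod>i\<in>UNIV. (x $ i) ^ (if i = b then 1 else 0)) = x $ b" for x :: "real ^ 'd"
    by (simp add: if_distrib[of "\<lambda>k. _ ^ k"] cong: if_cong)
  moreover have "(\<Prod>i\<in>UNIV. integral\<^sup>L gauss1 (\<lambda>x. x ^ (if i = b then 1 else 0))) = 0"
    using gauss1_moments(2) by (intro prod_zero) auto
  ultimately show ?thesis using gauss_moment[of "\<lambda>i. if i = b then 1 else 0"] by (simp only:)
qed

lemma gauss_moment2: "has_bochner_integral gauss (\<lambda>x::real^'d::finite. x $ b * x $ c) (if b = c then 1 else 0)"
proof -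
  let ?k = "\<lambda>i. (if i = b then 1 else 0) + (if i = c then 1 else 0) :: nat"
  have "(\<Prod>i\<in>UNIV. (x $ i) ^ ?k i) = x $ b * x $ c" for x :: "real ^ 'd"
    by (simp add: power_add prod.distrib if_distrib[of "\<lambda>k. _ ^ k"] cong: if_cong)
  moreover have "(\<Prod>i\<in>UNIV. integral\<^sup>L gauss1 (\<lambda>x. x ^ ?k i)) = (if b = c then 1 else 0)"
  proof (cases "b = c")
    case True
    then have "integral\<^sup>L gauss1 (\<lambda>x. x ^ ?k i) = 1" for i
      using gauss1_moments by (auto simp: numeral_2_eq_2)
    then show ?thesis using True by simp
  next
    case False
    then have "integral\<^sup>L gauss1 (\<lambda>x. x ^ ?k b) = 0"
      using gauss1_moments(2) by simp
    then show ?thesis using False by (auto intro!: prod_zero)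
  qed
  ultimately show ?thesis using gauss_moment[of ?k] by (simp only:)
qed

text \<open>Each possible value of \<open>p a\<close> is attained by equally many permutations,
  namely \<open>fact (card S)\<close>.\<close>

lemma sum_permutations_at:
  fixes f :: "'a \<Rightarrow> real"
  assumes "finite S" "a \<notin> S"
  shows "(\<Sum>p | p permutes (insert a S). f (p a)) = fact (card S) * sum f (insert a S)"
proof -
  have "(\<Sum>p | p permutes (insert a S). f (p a)) = (\<Sum>b\<in>insert a S. \<Sum>q | q permutes S. f b)"
    unfolding sum_over_permutations_insert[OF assms]
    using assms(2) by (intro sum.cong refl) (auto simp: permutes_not_in)
  then show ?thesis
    using assms(1) by (simp add: card_permutations sum_distrib_left)
qed

text \<open>The square is expanded over pairs of permutations. Rows are independent and distinct
  entries of one row are uncorrelated, so only equal pairs survive, and such a pair \<open>p\<close>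
  contributes \<open>(t i)\<^sup>2\<close> for the row \<open>i\<close> that \<open>p\<close> sends
  to the column \<open>None\<close>.\<close>

lemma det_aug_sq_integral:
  fixes t :: "'d::finite option \<Rightarrow> real"
  shows "(\<integral>\<^sup>+G. ennreal ((det (aug G t))\<^sup>2) \<partial>PiM UNIV (\<lambda>_. gauss)) = ennreal (fact CARD('d) * (\<Sum>i\<in>UNIV. (t i)\<^sup>2))"
proof -
  interpret G: prob_space "gauss :: (real ^ 'd) measure" by (rule prob_space_gauss)
  interpret P: product_sigma_finite "\<lambda>_::'d option. gauss :: (real ^ 'd) measure" ..
  let ?P = "PiM (UNIV :: 'd option set) (\<lambda>_. gauss :: (real ^ 'd) measure)"
  let ?S = "{p. p permutes (UNIV :: 'd option set)}"
  define a where "a i j x = (case j of None \<Rightarrow> t i | Some b \<Rightarrow> x $ b)" for i j and x :: "real ^ 'd"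
  have sq: "(det (aug G t))\<^sup>2 = (\<Sum>p\<in>?S. \<Sum>q\<in>?S. of_int (sign p) * of_int (sign q) * (\<Prod>i\<in>UNIV. a i (p i) (G i) * a i (q i) (G i)))" for G
    unfolding det_def power2_eq_square sum_product
    by (intro sum.cong refl) (simp add: prod.distrib aug_def a_def mult_ac)
  \<comment> \<open>The mixed second moments within row \<open>i\<close>. The column
    \<open>None\<close> is the constant \<open>t i\<close>; it is uncorrelated with the other
    columns because those are centred.\<close>
  define m where "m i j k = (if j = k then (case j of None \<Rightarrow> (t i)\<^sup>2 | Some b \<Rightarrow> 1) else 0)" for i and j k :: "'d option"
  have am: "has_bochner_integral gauss (\<lambda>x. a i j x * a i k x) (m i j k)" for i j k
  proof -
    have c: "has_bochner_integral (gauss :: (real ^ 'd) measure) (\<lambda>x. c) c" for c :: real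
      using G.prob_space by (simp add: has_bochner_integral_iff)
    have m2: "has_bochner_integral gauss (\<lambda>x::real^'d. x $ b * x $ b) 1" for b
      using gauss_moment2[of b b] by simp
    have m2': "has_bochner_integral gauss (\<lambda>x::real^'d. x $ b * x $ c) 0" if "b \<noteq> c" for b c
      using gauss_moment2[of b c] that by simp
    show ?thesis
      using m2 m2' has_bochner_integral_mult_right[OF gauss_moment1, of "t i"]
        has_bochner_integral_mult_left[OF gauss_moment1, of _ "t i"] c
      by (cases j; cases k) (auto simp: a_def m_def power2_eq_square)
  qed
  have pm: "has_bochner_integral ?P (\<lambda>G. \<Prod>i\<in>UNIV. a i (p i) (G i) * a i (q i) (G i)) (\<Prod>i\<in>UNIV. m i (p i) (q i))" for p q
    using P.product_integrable_prod[of UNIV "\<lambda>i x. a i (p i) x * a i (q i) x"]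
      P.product_integral_prod[of UNIV "\<lambda>i x. a i (p i) x * a i (q i) x"] am
    by (simp add: has_bochner_integral_iff)
  have "has_bochner_integral ?P (\<lambda>G. (det (aug G t))\<^sup>2)
     (\<Sum>p\<in>?S. \<Sum>q\<in>?S. of_int (sign p) * of_int (sign q) * (\<Prod>i\<in>UNIV. m i (p i) (q i)))"
    unfolding sq by (intro has_bochner_integral_sum has_bochner_integral_mult_right pm)
  also have "(\<Sum>p\<in>?S. \<Sum>q\<in>?S. of_int (sign p) * of_int (sign q) * (\<Prod>i\<in>UNIV. m i (p i) (q i))) =
    (\<Sum>p\<in>?S. (t (inv_into UNIV p None))\<^sup>2)"
  proof (rule sum.cong[OF refl])
    fix p assume p: "p \<in> ?S"
    have z: "(\<Prod>i\<in>UNIV. m i (p i) (q i)) = 0" if "q \<noteq> p" for q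
    proof -
      have "\<exists>i. p i \<noteq> q i" using that by (metis ext)
      then obtain i where "p i \<noteq> q i" by blast
      then show ?thesis by (intro prod_zero) (auto simp: m_def)
    qed
    have "m i (p i) (p i) = (if i = inv_into UNIV p None then (t i)\<^sup>2 else 1)" for i
      using p permutes_inv_eq[of p UNIV None i] by (auto simp: m_def split: option.split)
    then have "(\<Prod>i\<in>UNIV. m i (p i) (p i)) = (t (inv_into UNIV p None))\<^sup>2" by simp
    then have "(\<Sum>q\<in>?S. of_int (sign p) * of_int (sign q) * (\<Prod>i\<in>UNIV. m i (p i) (q i))) =
      (\<Sum>q\<in>?S. if q = p then (t (inv_into UNIV p None))\<^sup>2 else 0)"
      using z by (intro sum.cong refl) (auto simp: of_int_mult[symmetric] simp del: of_int_mult)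
    then show "(\<Sum>q\<in>?S. of_int (sign p) * of_int (sign q) * (\<Prod>i\<in>UNIV. m i (p i) (q i))) = (t (inv_into UNIV p None))\<^sup>2"
      using p by simp
  qed
  \<comment> \<open>Inversion is a bijection of the permutations.\<close>
  also have "\<dots> = (\<Sum>p\<in>?S. (t (p None))\<^sup>2)"
    by (rule sum.reindex_bij_betw[where h = "inv_into UNIV" and g = "\<lambda>p. (t (p None))\<^sup>2"])
       (rule bij_betwI[where g = "inv_into UNIV"]; auto simp: permutes_inv inv_inv_eq permutes_bij)
  also have "\<dots> = fact CARD('d) * (\<Sum>i\<in>UNIV. (t i)\<^sup>2)"
    using sum_permutations_at[of "range (Some :: 'd \<Rightarrow> _)" None "\<lambda>i. (t i)\<^sup>2"]
    by (simp add: UNIV_option_conv[symmetric] card_image)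
  finally have "has_bochner_integral ?P (\<lambda>G. (det (aug G t))\<^sup>2) (fact CARD('d) * (\<Sum>i\<in>UNIV. (t i)\<^sup>2))" .
  then show ?thesis
    by (subst nn_integral_eq_integral) (auto simp: has_bochner_integral_iff)
qed

section \<open>The determinant-weighted law of the offset\<close>

text \<open>Legendre duplication at half-integers. Induction in steps of one works because raising
  \<open>d\<close> by 1 turns the second argument into the first and shifts the old first argument
  by 1.\<close>

lemma Gamma_half_duplication:
  "Gamma ((real d + 1) / 2) * Gamma (real d / 2 + 1) = sqrt pi * fact d / 2 ^ d"
proof (induction d)
  case 0
  then show ?case by (simp add: Gamma_one_half_real)
next
  case (Suc d)
  have "Gamma ((real d + 1) / 2 + 1) = (real d + 1) / 2 * Gamma ((real d + 1) / 2)"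
    by (rule Gamma_plus1) (use nonpos_Ints_nonpos[of "(real d + 1) / 2"] in force)
  moreover have "(real (Suc d) + 1) / 2 = real d / 2 + 1" "real (Suc d) / 2 + 1 = (real d + 1) / 2 + 1"
    by simp_all
  ultimately have "Gamma ((real (Suc d) + 1) / 2) * Gamma (real (Suc d) / 2 + 1) =
    (real d + 1) / 2 * (Gamma ((real d + 1) / 2) * Gamma (real d / 2 + 1))"
    by (simp only: mult_ac)
  also have "\<dots> = sqrt pi * fact (Suc d) / 2 ^ Suc d"
    unfolding Suc by (simp add: field_simps)
  finally show ?case .
qed

lemma nn_integral_exp_inner:
  fixes t :: real
  assumes "0 < t"
  shows "(\<integral>\<^sup>+v. ennreal (exp (- t * (v \<bullet> v))) \<partial>(lborel :: (real ^ 'd::finite) measure)) = ennreal (sqrt (pi / t) ^ CARD('d))"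
proof -
  interpret product_sigma_finite "\<lambda>_::'d. lborel :: real measure" ..
  have "(\<integral>\<^sup>+v. ennreal (exp (- t * ((v :: real ^ 'd) \<bullet> v))) \<partial>lborel) =
    (\<integral>\<^sup>+f. (\<Prod>i\<in>UNIV. ennreal (exp (- t * (f i)\<^sup>2))) \<partial>PiM (UNIV :: 'd set) (\<lambda>_. lborel))"
    by (subst nn_integral_lborel_vec, measurable) (intro nn_integral_cong,
      simp add: prod_ennreal exp_sum[symmetric] inner_vec_def sum_distrib_left power2_eq_square sum_negf)
  also have "\<dots> = (\<Prod>i\<in>(UNIV :: 'd set). \<integral>\<^sup>+x. ennreal (exp (- t * x\<^sup>2)) \<partial>lborel)"
    by (rule product_nn_integral_prod) auto
  also have "(\<integral>\<^sup>+x. ennreal (exp (- t * x\<^sup>2)) \<partial>lborel) = ennreal (sqrt (pi / t))"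
    using gaussian_integral_quadratic[of "2 * t" 0] assms by simp
  finally show ?thesis
    using assms by (simp add: prod_constant ennreal_power)
qed

text \<open>The kernel is a Gamma integral: up to the factor Gamma (d/2 + 1) it is the integral of
  t^(d/2) exp (- t (1 + |v|^2)) over t > 0. After exchanging the integrals, the Gaussian integral
  over \<open>v\<close> gives (pi / t)^(d/2), which cancels the power of \<open>t\<close> and leaves
  the integral of exp (- t).\<close>

lemma nn_integral_cauchy_kernel:
  "(\<integral>\<^sup>+v. ennreal (1 / sqrt (1 + v \<bullet> v) ^ (CARD('d) + 2)) \<partial>(lborel :: (real ^ 'd::finite) measure)) =
     ennreal (sqrt pi ^ CARD('d) / Gamma (real CARD('d) / 2 + 1))"
proof -
  let ?d = "CARD('d)"
  let ?a = "real ?d / 2 + 1"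
  have G: "0 < Gamma ?a" by (rule Gamma_real_pos) simp
  define h where "h t = indicator {0<..} t * ennreal (sqrt t ^ ?d)" for t :: real
  have [measurable]: "h \<in> borel_measurable borel" unfolding h_def by measurable
  have sq: "t powr (real ?d / 2) = sqrt t ^ ?d" if t: "0 < t" for t :: real
  proof -
    have "sqrt t powr real ?d = sqrt t ^ ?d" using powr_realpow[of "sqrt t" ?d] t by simp
    moreover have "(t powr (1 / 2)) powr real ?d = t powr (real ?d / 2)" by (simp add: powr_powr)
    moreover have "t powr (1 / 2) = sqrt t" using t by (intro powr_half_sqrt) simp
    ultimately show ?thesis by (simp only:)
  qed
  have ga: "ennreal (Gamma ?a) = (\<integral>\<^sup>+t. h t * ennreal (exp (- t)) \<partial>lborel)"
  proof -
    have "ennreal (Gamma ?a) = (\<integral>\<^sup>+t. ennreal (indicator {0..} t * t powr (?a - 1) / exp t) \<partial>lborel)"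
      by (rule Gamma_conv_nn_integral_real) simp
    also have "\<dots> = (\<integral>\<^sup>+t. h t * ennreal (exp (- t)) \<partial>lborel)"
    proof (rule nn_integral_cong)
      fix t :: real
      consider "t < 0" | "t = 0" | "0 < t" by linarith
      then show "ennreal (indicator {0..} t * t powr (?a - 1) / exp t) = h t * ennreal (exp (- t))"
      proof cases
        case 3
        have "t powr (?a - 1) = sqrt t ^ ?d" using sq[OF 3] by simp
        then have "indicator {0..} t * t powr (?a - 1) / exp t = sqrt t ^ ?d * exp (- t)"
          using 3 by (simp only: exp_minus divide_inverse) simp
        moreover have "h t = ennreal (sqrt t ^ ?d)" using 3 by (simp add: h_def)
        moreover have "ennreal (sqrt t ^ ?d * exp (- t)) = ennreal (sqrt t ^ ?d) * ennreal (exp (- t))"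
          using 3 by (intro ennreal_mult) simp_all
        ultimately show ?thesis by (simp only:)
      qed (simp_all add: h_def)
    qed
    finally show ?thesis .
  qed
  have sc: "ennreal (Gamma ?a) * ennreal (1 / sqrt (1 + q) ^ (?d + 2)) = (\<integral>\<^sup>+t. h t * ennreal (exp (- t * (1 + q))) \<partial>lborel)"
    if q: "0 \<le> q" for q
  proof -
    have "(\<integral>\<^sup>+t. h t * ennreal (exp (- t)) \<partial>lborel) =
      ennreal \<bar>1 + q\<bar> * (\<integral>\<^sup>+t. h (0 + (1 + q) * t) * ennreal (exp (- (0 + (1 + q) * t))) \<partial>lborel)"
      using q by (intro nn_integral_real_affine) auto
    also have "(\<integral>\<^sup>+t. h (0 + (1 + q) * t) * ennreal (exp (- (0 + (1 + q) * t))) \<partial>lborel) =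
      (\<integral>\<^sup>+t. ennreal (sqrt (1 + q) ^ ?d) * (h t * ennreal (exp (- t * (1 + q)))) \<partial>lborel)"
    proof (rule nn_integral_cong)
      fix t :: real
      have "indicator {0<..} ((1 + q) * t) = (indicator {0<..} t :: ennreal)"
        using q by (auto simp: indicator_def zero_less_mult_iff)
      moreover have "ennreal (sqrt ((1 + q) * t) ^ ?d) = ennreal (sqrt (1 + q) ^ ?d) * ennreal (sqrt t ^ ?d)" if "0 < t"
        using q that by (simp add: real_sqrt_mult power_mult_distrib ennreal_mult)
      moreover have "- (0 + (1 + q) * t) = - t * (1 + q)" by simp
      ultimately show "h (0 + (1 + q) * t) * ennreal (exp (- (0 + (1 + q) * t))) =
        ennreal (sqrt (1 + q) ^ ?d) * (h t * ennreal (exp (- t * (1 + q))))"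
        unfolding h_def by (cases "0 < t") (simp_all add: mult_ac)
    qed
    also have "\<dots> = ennreal (sqrt (1 + q) ^ ?d) * (\<integral>\<^sup>+t. h t * ennreal (exp (- t * (1 + q))) \<partial>lborel)"
      by (rule nn_integral_cmult) measurable
    also have "ennreal \<bar>1 + q\<bar> * \<dots> = ennreal (sqrt (1 + q) ^ (?d + 2)) * (\<integral>\<^sup>+t. h t * ennreal (exp (- t * (1 + q))) \<partial>lborel)"
    proof -
      have "sqrt (1 + q) ^ (?d + 2) = \<bar>1 + q\<bar> * sqrt (1 + q) ^ ?d" using q by (simp add: power_add)
      moreover have "ennreal (\<bar>1 + q\<bar> * sqrt (1 + q) ^ ?d) = ennreal \<bar>1 + q\<bar> * ennreal (sqrt (1 + q) ^ ?d)"
        using q by (intro ennreal_mult) simp_all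
      ultimately show ?thesis by (simp only: mult.assoc)
    qed
    finally have e: "ennreal (Gamma ?a) = ennreal (sqrt (1 + q) ^ (?d + 2)) * (\<integral>\<^sup>+t. h t * ennreal (exp (- t * (1 + q))) \<partial>lborel)"
      unfolding ga .
    have "ennreal (1 / sqrt (1 + q) ^ (?d + 2)) * ennreal (sqrt (1 + q) ^ (?d + 2)) = 1"
    proof -
      have "0 < sqrt (1 + q) ^ (?d + 2)" using q by simp
      then show ?thesis using q by (subst ennreal_mult[symmetric]) simp_all
    qed
    then show ?thesis unfolding e
      by (simp only: mult.assoc[symmetric] mult.commute[of _ "ennreal (1 / sqrt (1 + q) ^ (?d + 2))"] mult_1_left)
  qed
  have "ennreal (Gamma ?a) * (\<integral>\<^sup>+v. ennreal (1 / sqrt (1 + (v :: real ^ 'd) \<bullet> v) ^ (?d + 2)) \<partial>lborel) =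
    (\<integral>\<^sup>+v. (\<integral>\<^sup>+t. h t * ennreal (exp (- t * (1 + (v :: real ^ 'd) \<bullet> v))) \<partial>lborel) \<partial>lborel)"
    by (subst nn_integral_cmult[symmetric], measurable) (simp only: sc inner_ge_zero)
  also have "\<dots> = (\<integral>\<^sup>+t. (\<integral>\<^sup>+v. h t * ennreal (exp (- t * (1 + (v :: real ^ 'd) \<bullet> v))) \<partial>lborel) \<partial>lborel)"
    by (rule lborel_pair.Fubini'[symmetric]) measurable
  also have "\<dots> = (\<integral>\<^sup>+t. ennreal (sqrt pi ^ ?d) * (indicator {0<..} t * ennreal (exp (- t))) \<partial>lborel)"
  proof (rule nn_integral_cong)
    fix t :: real
    show "(\<integral>\<^sup>+v. h t * ennreal (exp (- t * (1 + (v :: real ^ 'd) \<bullet> v))) \<partial>lborel) =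
      ennreal (sqrt pi ^ ?d) * (indicator {0<..} t * ennreal (exp (- t)))"
    proof (cases "0 < t")
      case True
      have "(\<integral>\<^sup>+v. h t * ennreal (exp (- t * (1 + (v :: real ^ 'd) \<bullet> v))) \<partial>lborel) =
        (\<integral>\<^sup>+v. ennreal (sqrt t ^ ?d * exp (- t)) * ennreal (exp (- t * ((v :: real ^ 'd) \<bullet> v))) \<partial>lborel)"
        using True by (intro nn_integral_cong)
          (simp add: h_def ennreal_mult[symmetric] exp_add[symmetric] algebra_simps)
      also have "\<dots> = ennreal (sqrt t ^ ?d * exp (- t)) * ennreal (sqrt (pi / t) ^ ?d)"
        by (subst nn_integral_cmult, measurable) (simp only: nn_integral_exp_inner[OF True])
      also have "\<dots> = ennreal (sqrt pi ^ ?d * exp (- t))"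
        using True by (simp add: ennreal_mult[symmetric] real_sqrt_divide power_divide)
      finally show ?thesis using True by (simp add: ennreal_mult)
    qed (simp add: h_def)
  qed
  also have "\<dots> = ennreal (sqrt pi ^ ?d) * (\<integral>\<^sup>+t. indicator {0<..} t * ennreal (exp (- t)) \<partial>lborel)"
    by (rule nn_integral_cmult) measurable
  also have "(\<integral>\<^sup>+t. indicator {0<..} t * ennreal (exp (- t)) \<partial>lborel) = 1"
  proof -
    have "1 = (\<integral>\<^sup>+t. ennreal (indicator {0..} t * t powr (1 - 1) / exp t) \<partial>lborel)"
      using Gamma_conv_nn_integral_real[of 1] by simp
    also have "\<dots> = (\<integral>\<^sup>+t. indicator {0<..} t * ennreal (exp (- t)) \<partial>lborel)"
    proof (rule nn_integral_cong)
      fix t :: real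
      consider "t < 0" | "t = 0" | "0 < t" by linarith
      then show "ennreal (indicator {0..} t * t powr (1 - 1) / exp t) = indicator {0<..} t * ennreal (exp (- t))"
        by cases (simp_all add: exp_minus inverse_eq_divide)
    qed
    finally show ?thesis by simp
  qed
  finally have e: "ennreal (Gamma ?a) * (\<integral>\<^sup>+v. ennreal (1 / sqrt (1 + (v :: real ^ 'd) \<bullet> v) ^ (?d + 2)) \<partial>lborel) = ennreal (sqrt pi ^ ?d)"
    by simp
  define g where "g = Gamma ?a"
  have g: "0 < g" using G by (simp only: g_def)
  have inv: "ennreal (1 / g) * ennreal g = 1"
    using g by (simp add: ennreal_mult[symmetric])
  have "(\<integral>\<^sup>+v. ennreal (1 / sqrt (1 + (v :: real ^ 'd) \<bullet> v) ^ (?d + 2)) \<partial>lborel) = ennreal (1 / g) * ennreal (sqrt pi ^ ?d)"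
    unfolding e[folded g_def, symmetric] by (simp only: mult.assoc[symmetric] inv mult_1_left)
  also have "\<dots> = ennreal (sqrt pi ^ ?d / g)"
    using g by (simp add: ennreal_mult[symmetric])
  finally show ?thesis by (simp only: g_def)
qed

section \<open>Measurability of the interpolating hyperplane\<close>

lemma borel_measurable_det:
  fixes A :: "'a \<Rightarrow> real ^ 'n::finite ^ 'n"
  assumes "\<And>i j. (\<lambda>x. A x $ i $ j) \<in> borel_measurable M"
  shows "(\<lambda>x. det (A x)) \<in> borel_measurable M"
  unfolding det_def using assms by measurable

lemma borel_measurable_aug_nth:
  assumes "\<And>i. (\<lambda>x. G x i) \<in> borel_measurable M"
  shows "(\<lambda>x. aug (G x) t $ i $ j) \<in> borel_measurable M"
  using assms by (cases j) (simp_all add: aug_def)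

lemma borel_measurable_det_aug [measurable (raw)]:
  assumes "\<And>i. (\<lambda>x. G x i) \<in> borel_measurable M"
  shows "(\<lambda>x. det (aug (G x) t)) \<in> borel_measurable M"
  by (intro borel_measurable_det borel_measurable_aug_nth assms)

lemma borel_measurable_hyp_aux:
  assumes "\<And>i. (\<lambda>x. G x i) \<in> borel_measurable M" "\<And>i. (\<lambda>x. u x i) \<in> borel_measurable M"
  shows "(\<lambda>x. det (\<chi> i j. if j = k then u x i else aug (G x) t $ i $ j) / det (aug (G x) t)) \<in> borel_measurable M"
proof (intro borel_measurable_divide borel_measurable_det_aug borel_measurable_det assms)
  fix i j
  show "(\<lambda>x. (\<chi> i j. if j = k then u x i else aug (G x) t $ i $ j) $ i $ j) \<in> borel_measurable M"
    using assms(2) borel_measurable_aug_nth[of G M t i j] assms(1) by (cases "j = k") simp_all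
qed

lemma borel_measurable_hyp:
  assumes "\<And>i. (\<lambda>x. G x i) \<in> borel_measurable M" "\<And>i. (\<lambda>x. u x i) \<in> borel_measurable M"
  shows "(\<lambda>x. fst (hyp (G x) t (u x))) \<in> borel_measurable M" "(\<lambda>x. snd (hyp (G x) t (u x))) \<in> borel_measurable M"
proof -
  show "(\<lambda>x. snd (hyp (G x) t (u x))) \<in> borel_measurable M"
    using borel_measurable_hyp_aux[OF assms] by (simp add: hyp_def split_opt_def)
  show "(\<lambda>x. fst (hyp (G x) t (u x))) \<in> borel_measurable M"
  proof (rule borel_measurable_vecI)
    fix i
    show "(\<lambda>x. fst (hyp (G x) t (u x)) $ i) \<in> borel_measurable M"
      using borel_measurable_hyp_aux[OF assms] by (simp add: hyp_def split_opt_def)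
  qed
qed

text \<open>The signed distance, in lifted space, of the origin from the graph of \<open>x \<mapsto> v \<bullet> x + s\<close>.\<close>

definition offset :: "(real ^ 'd::finite) \<times> real \<Rightarrow> real" where
  "offset p = snd p / sqrt (1 + fst p \<bullet> fst p)"

lemma borel_measurable_offset_hyp:
  assumes "\<And>i. (\<lambda>x. G x i) \<in> borel_measurable M" "\<And>i. (\<lambda>x. u x i) \<in> borel_measurable M"
  shows "(\<lambda>x. offset (hyp (G x) t (u x))) \<in> borel_measurable M"
  unfolding offset_def using borel_measurable_hyp[OF assms] by measurable

text \<open>For frozen vertices, the heights are replaced by the coefficients (v, s) of their
  interpolating hyperplane. The Jacobian is the factor that later completes the determinant weight
  to a square.\<close>

lemma nn_integral_offset_hyp:
  fixes G :: "'d::finite option \<Rightarrow> real ^ 'd"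
  assumes f [measurable]: "f \<in> borel_measurable borel" and d: "det (aug G t) \<noteq> 0"
  shows "(\<integral>\<^sup>+u. f (offset (hyp G t u)) \<partial>PiM UNIV (\<lambda>_. gauss1)) = ennreal \<bar>det (aug G t)\<bar> *
    (\<integral>\<^sup>+v. \<integral>\<^sup>+s. (\<Prod>i\<in>UNIV. ennreal (std_normal_density (v \<bullet> G i + s * t i))) * f (s / sqrt (1 + v \<bullet> v)) \<partial>lborel \<partial>lborel)"
proof -
  define H where "H x = (\<Prod>i\<in>UNIV. ennreal (std_normal_density (x $ i))) * f (offset (hyp G t (\<lambda>i. x $ i)))" for x
  have [measurable]: "(\<lambda>x. offset (hyp G t (\<lambda>i. x $ i))) \<in> borel_measurable borel"
    by (rule borel_measurable_offset_hyp) simp_all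
  have H [measurable]: "H \<in> borel_measurable borel"
    unfolding H_def by measurable
  have m: "(\<lambda>u. offset (hyp G t u)) \<in> borel_measurable (PiM UNIV (\<lambda>_. lborel))"
    by (rule borel_measurable_offset_hyp) simp_all
  have [measurable]: "(\<lambda>u. f (offset (hyp G t u))) \<in> borel_measurable (PiM UNIV (\<lambda>_. lborel))"
    by (rule measurable_compose[OF m f])
  have mm: "(\<lambda>x. aug G t *v x) \<in> borel_measurable borel"
    by (rule borel_measurable_matrix_vector_mult)
  have "(\<integral>\<^sup>+u. f (offset (hyp G t u)) \<partial>PiM UNIV (\<lambda>_. gauss1)) = (\<integral>\<^sup>+u. H (\<chi> i. u i) \<partial>PiM UNIV (\<lambda>_. lborel))"
    unfolding PiM_gauss1[OF finite] by (subst nn_integral_density) (auto simp: H_def)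
  also have "\<dots> = (\<integral>\<^sup>+x. H x \<partial>lborel)"
    by (rule nn_integral_lborel_vec[symmetric]) measurable
  also have "\<dots> = ennreal \<bar>det (aug G t)\<bar> * (\<integral>\<^sup>+x. H (aug G t *v x) \<partial>lborel)"
    by (rule nn_integral_matrix) (use d in auto)
  also have "(\<integral>\<^sup>+x. H (aug G t *v x) \<partial>lborel) =
    (\<integral>\<^sup>+v. \<integral>\<^sup>+s. H (aug G t *v (\<chi> i. case i of None \<Rightarrow> s | Some b \<Rightarrow> v $ b)) \<partial>lborel \<partial>lborel)"
    by (rule nn_integral_lborel_option[OF measurable_compose[OF mm H]])
  also have "\<dots> = (\<integral>\<^sup>+v. \<integral>\<^sup>+s. (\<Prod>i\<in>UNIV. ennreal (std_normal_density (v \<bullet> G i + s * t i))) * f (s / sqrt (1 + v \<bullet> v)) \<partial>lborel \<partial>lborel)"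
  proof (intro nn_integral_cong)
    fix v s
    have "hyp G t (\<lambda>i. v \<bullet> G i + s * t i) = (v, s)"
      using hyp_iff[OF d] by blast
    moreover have "(\<chi> i. case i of None \<Rightarrow> s | Some b \<Rightarrow> v $ b) = join_opt (v, s)"
      by (auto simp: join_opt_def vec_eq_iff split: option.split)
    ultimately show "H (aug G t *v (\<chi> i. case i of None \<Rightarrow> s | Some b \<Rightarrow> v $ b)) = (\<Prod>i\<in>UNIV. ennreal (std_normal_density (v \<bullet> G i + s * t i))) * f (s / sqrt (1 + v \<bullet> v))"
      by (simp add: H_def aug_mult_join offset_def)
  qed
  finally show ?thesis .
qed

text \<open>\<open>gauss_observation\<close> is applied at every vertex with the same
  \<open>T\<close>. The shift at vertex \<open>i\<close> is \<open>t i\<close> times one common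
  vector, the shape that \<open>det_aug_mult\<close> absorbs, so the substitution only multiplies
  the square by (det T)^2 = 1 / (1 + |v|^2).\<close>

lemma nn_integral_det_aug_sq_weighted:
  fixes t :: "'d::finite option \<Rightarrow> real" and v :: "real ^ 'd"
  shows "(\<integral>\<^sup>+G. ennreal ((det (aug G t))\<^sup>2) * (\<Prod>i\<in>UNIV. ennreal (std_normal_density (v \<bullet> G i + s * t i))) \<partial>PiM UNIV (\<lambda>_. gauss)) =
    (\<Prod>i\<in>UNIV. ennreal (normal_density 0 (sqrt (1 + v \<bullet> v)) (s * t i))) *
    ennreal (fact CARD('d) * (\<Sum>i\<in>UNIV. (t i)\<^sup>2) / (1 + v \<bullet> v))"
proof -
  interpret G: prob_space "gauss :: (real ^ 'd) measure" by (rule prob_space_gauss)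
  obtain T :: "real ^ 'd ^ 'd" where dT: "\<bar>det T\<bar> = 1 / sqrt (1 + v \<bullet> v)" and
    T: "\<And>t F. F \<in> borel_measurable borel \<Longrightarrow>
       (\<integral>\<^sup>+x. F x * ennreal (std_normal_density (v \<bullet> x + t)) \<partial>gauss) =
       ennreal (normal_density 0 (sqrt (1 + v \<bullet> v)) t) * (\<integral>\<^sup>+x. F (x v* T - (t / (1 + v \<bullet> v)) *\<^sub>R v) \<partial>gauss)"
    using gauss_observation[of v] by blast
  let ?S = "\<lambda>i x. x v* T - ((s * t i) / (1 + v \<bullet> v)) *\<^sub>R v"
  have mT: "(\<lambda>x. x v* T) \<in> borel_measurable borel"
  proof -
    have "(\<lambda>x. x v* T) = (\<lambda>x. transpose T *v x)" by (simp add: fun_eq_iff)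
    then show ?thesis
      by (simp only: borel_measurable_matrix_vector_mult)
  qed
  have md: "(\<lambda>G. det (aug G t)) \<in> borel_measurable (PiM UNIV (\<lambda>_. gauss))"
    by (rule borel_measurable_det_aug) simp
  have "(\<integral>\<^sup>+G. ennreal ((det (aug G t))\<^sup>2) * (\<Prod>i\<in>UNIV. ennreal (std_normal_density (v \<bullet> G i + s * t i))) \<partial>PiM UNIV (\<lambda>_. gauss)) =
    (\<Prod>i\<in>UNIV. ennreal (normal_density 0 (sqrt (1 + v \<bullet> v)) (s * t i))) *
    (\<integral>\<^sup>+G. ennreal ((det (aug (\<lambda>i\<in>UNIV. ?S i (G i)) t))\<^sup>2) \<partial>PiM UNIV (\<lambda>_. gauss))"
    using mT md T G.sigma_finite_measure_axioms
    by (intro nn_integral_PiM_weighted[where F = "\<lambda>G. ennreal ((det (aug G t))\<^sup>2)" and S = ?S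
       and w = "\<lambda>i x. ennreal (std_normal_density (v \<bullet> x + s * t i))" and M = gauss and I = UNIV]) auto
  also have "(\<integral>\<^sup>+G. ennreal ((det (aug (\<lambda>i\<in>UNIV. ?S i (G i)) t))\<^sup>2) \<partial>PiM UNIV (\<lambda>_. gauss)) =
    (\<integral>\<^sup>+G. ennreal ((det (aug G t))\<^sup>2) * ennreal (1 / (1 + v \<bullet> v)) \<partial>PiM UNIV (\<lambda>_. gauss))"
  proof (rule nn_integral_cong)
    fix G :: "'d option \<Rightarrow> real ^ 'd"
    have "(\<lambda>i\<in>UNIV. ?S i (G i)) = (\<lambda>i. G i v* T + t i *\<^sub>R (- (s / (1 + v \<bullet> v)) *\<^sub>R v))"
      by (simp add: fun_eq_iff mult.commute)
    then have "det (aug (\<lambda>i\<in>UNIV. ?S i (G i)) t) = det (aug G t) * det T"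
      by (simp only: det_aug_mult)
    moreover have "(det T)\<^sup>2 = 1 / (1 + v \<bullet> v)"
    proof -
      have "(det T)\<^sup>2 = \<bar>det T\<bar>\<^sup>2" by simp
      then show ?thesis unfolding dT by (simp add: power_divide)
    qed
    ultimately have "(det (aug (\<lambda>i\<in>UNIV. ?S i (G i)) t))\<^sup>2 = (det (aug G t))\<^sup>2 * (1 / (1 + v \<bullet> v))"
      by (simp only: power_mult_distrib)
    then show "ennreal ((det (aug (\<lambda>i\<in>UNIV. ?S i (G i)) t))\<^sup>2) = ennreal ((det (aug G t))\<^sup>2) * ennreal (1 / (1 + v \<bullet> v))"
      by (simp only:) (rule ennreal_mult, simp_all)
  qed
  also have "\<dots> = (\<integral>\<^sup>+G. ennreal ((det (aug G t))\<^sup>2) \<partial>PiM UNIV (\<lambda>_. gauss)) * ennreal (1 / (1 + v \<bullet> v))"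
    using md by (intro nn_integral_multc) measurable
  also have "\<dots> = ennreal (fact CARD('d) * (\<Sum>i\<in>UNIV. (t i)\<^sup>2) / (1 + v \<bullet> v))"
    unfolding det_aug_sq_integral by (subst ennreal_mult[symmetric]) (auto intro!: sum_nonneg mult_nonneg_nonneg)
  finally show ?thesis .
qed

lemma prod_normal_density_scaled:
  assumes "0 < r"
  shows "(\<Prod>i\<in>(UNIV :: 'n::finite set). ennreal (normal_density 0 r (s * t i))) =
    ennreal ((1 / (sqrt (2 * pi) * r)) ^ CARD('n) * exp (- ((\<Sum>i\<in>UNIV. (t i)\<^sup>2) * (s / r)\<^sup>2) / 2))"
proof -
  have "normal_density 0 r (s * t i) = 1 / (sqrt (2 * pi) * r) * exp (- ((t i)\<^sup>2 * (s / r)\<^sup>2) / 2)" for i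
    using assms by (simp add: normal_density_def real_sqrt_mult power_mult_distrib power_divide mult.commute)
  then have "(\<Prod>i\<in>(UNIV :: 'n set). normal_density 0 r (s * t i)) =
    (1 / (sqrt (2 * pi) * r)) ^ CARD('n) * exp (\<Sum>i\<in>UNIV. - ((t i)\<^sup>2 * (s / r)\<^sup>2) / 2)"
    by (simp only: prod.distrib prod_constant exp_sum[OF finite])
  also have "(\<Sum>i\<in>UNIV. - ((t i)\<^sup>2 * (s / r)\<^sup>2) / 2) = - ((\<Sum>i\<in>UNIV. (t i)\<^sup>2) * (s / r)\<^sup>2) / 2"
    by (simp only: sum_divide_distrib[symmetric] sum_negf sum_distrib_right)
  finally show ?thesis by (simp add: prod_ennreal)
qed

lemma nn_integral_scaled_gaussian:
  assumes [measurable]: "f \<in> borel_measurable borel" and "0 < r" "0 < a"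
  shows "(\<integral>\<^sup>+s. ennreal (exp (- (a\<^sup>2 * (s / r)\<^sup>2) / 2)) * f (s / r) \<partial>lborel) =
    ennreal (r * sqrt (2 * pi) / a) * (\<integral>\<^sup>+z. ennreal (normal_density 0 (1 / a) z) * f z \<partial>lborel)"
proof -
  have "(\<integral>\<^sup>+s. ennreal (exp (- (a\<^sup>2 * (s / r)\<^sup>2) / 2)) * f (s / r) \<partial>lborel) =
    ennreal \<bar>r\<bar> * (\<integral>\<^sup>+z. ennreal (exp (- (a\<^sup>2 * ((0 + r * z) / r)\<^sup>2) / 2)) * f ((0 + r * z) / r) \<partial>lborel)"
    using assms by (intro nn_integral_real_affine) auto
  also have "(\<integral>\<^sup>+z. ennreal (exp (- (a\<^sup>2 * ((0 + r * z) / r)\<^sup>2) / 2)) * f ((0 + r * z) / r) \<partial>lborel) =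
    (\<integral>\<^sup>+z. ennreal (sqrt (2 * pi) / a) * (ennreal (normal_density 0 (1 / a) z) * f z) \<partial>lborel)"
  proof (rule nn_integral_cong)
    fix z
    have "exp (- (a\<^sup>2 * z\<^sup>2) / 2) = sqrt (2 * pi) / a * normal_density 0 (1 / a) z"
      using assms by (simp add: normal_density_def power_divide real_sqrt_divide mult.commute)
    also have "ennreal \<dots> = ennreal (sqrt (2 * pi) / a) * ennreal (normal_density 0 (1 / a) z)"
      using assms by (intro ennreal_mult) (simp_all add: normal_density_nonneg)
    finally show "ennreal (exp (- (a\<^sup>2 * ((0 + r * z) / r)\<^sup>2) / 2)) * f ((0 + r * z) / r) =
      ennreal (sqrt (2 * pi) / a) * (ennreal (normal_density 0 (1 / a) z) * f z)"
      using assms(2) by (simp add: mult.assoc)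
  qed
  also have "\<dots> = ennreal (sqrt (2 * pi) / a) * (\<integral>\<^sup>+z. ennreal (normal_density 0 (1 / a) z) * f z \<partial>lborel)"
    by (rule nn_integral_cmult) measurable
  also have "ennreal \<bar>r\<bar> * \<dots> = ennreal (r * sqrt (2 * pi) / a) * (\<integral>\<^sup>+z. ennreal (normal_density 0 (1 / a) z) * f z \<partial>lborel)"
    using assms by (simp add: mult.assoc[symmetric] ennreal_mult[symmetric])
  finally show ?thesis .
qed

text \<open>All integrands are nonnegative, so the integral over the vertices can be made innermost.
  For fixed (v, s) it is a weighted second moment of the determinant, whose exponential involves
  \<open>s\<close> only through s / r, the argument of \<open>f\<close>. The integrals over
  \<open>v\<close> and over s / r then separate.\<close>

proposition nn_integral_det_aug_offset:
  fixes t :: "'d::finite option \<Rightarrow> real" and f :: "real \<Rightarrow> ennreal"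
  assumes f [measurable]: "f \<in> borel_measurable borel"
    and a: "0 < a" "a\<^sup>2 = (\<Sum>i\<in>UNIV. (t i)\<^sup>2)"
  shows "(\<integral>\<^sup>+G. ennreal \<bar>det (aug G t)\<bar> * (\<integral>\<^sup>+u. f (offset (hyp G t u)) \<partial>PiM UNIV (\<lambda>_. gauss1)) \<partial>PiM UNIV (\<lambda>_. gauss)) =
    ennreal (2 powr (real CARD('d) / 2) * Gamma ((real CARD('d) + 1) / 2) / sqrt pi * a) *
    (\<integral>\<^sup>+z. ennreal (normal_density 0 (1 / a) z) * f z \<partial>lborel)"
proof -
  let ?d = "CARD('d)"
  let ?P = "PiM (UNIV :: 'd option set) (\<lambda>_. gauss :: (real ^ 'd) measure)"
  let ?J = "\<integral>\<^sup>+z. ennreal (normal_density 0 (1 / a) z) * f z \<partial>lborel"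
  interpret P: prob_space ?P by (intro prob_space_PiM prob_space_gauss)
  interpret PL: pair_sigma_finite ?P "lborel :: real measure"
    by (intro pair_sigma_finite.intro P.sigma_finite_measure_axioms sigma_finite_lborel)
  interpret PV: pair_sigma_finite ?P "lborel :: (real ^ 'd) measure"
    by (intro pair_sigma_finite.intro P.sigma_finite_measure_axioms sigma_finite_lborel)
  define K where "K G v s = ennreal ((det (aug G t))\<^sup>2) * (\<Prod>i\<in>UNIV. ennreal (std_normal_density (v \<bullet> G i + s * t i))) * f (s / sqrt (1 + v \<bullet> v))"
    for G :: "'d option \<Rightarrow> real ^ 'd" and v s
  have "(\<integral>\<^sup>+G. ennreal \<bar>det (aug G t)\<bar> * (\<integral>\<^sup>+u. f (offset (hyp G t u)) \<partial>PiM UNIV (\<lambda>_. gauss1)) \<partial>?P) =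
    (\<integral>\<^sup>+G. \<integral>\<^sup>+v. \<integral>\<^sup>+s. K G v s \<partial>lborel \<partial>lborel \<partial>?P)"
  proof (rule nn_integral_cong)
    fix G :: "'d option \<Rightarrow> real ^ 'd"
    show "ennreal \<bar>det (aug G t)\<bar> * (\<integral>\<^sup>+u. f (offset (hyp G t u)) \<partial>PiM UNIV (\<lambda>_. gauss1)) = (\<integral>\<^sup>+v. \<integral>\<^sup>+s. K G v s \<partial>lborel \<partial>lborel)"
    \<comment> \<open>For degenerate vertices \<open>hyp\<close> is junk, but the weight
      vanishes.\<close>
    proof (cases "det (aug G t) = 0")
      case True
      then show ?thesis by (simp add: K_def)
    next
      case False
      have sq: "ennreal ((det (aug G t))\<^sup>2) = ennreal \<bar>det (aug G t)\<bar> * ennreal \<bar>det (aug G t)\<bar>"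
        by (simp add: ennreal_mult[symmetric] power2_eq_square)
      show ?thesis
        unfolding nn_integral_offset_hyp[OF f False] K_def mult.assoc[symmetric] sq[symmetric]
        unfolding mult.assoc by (subst nn_integral_cmult, measurable)+ 
    qed
  qed
  also have "\<dots> = (\<integral>\<^sup>+v. \<integral>\<^sup>+G. \<integral>\<^sup>+s. K G v s \<partial>lborel \<partial>?P \<partial>lborel)"
    by (rule PV.Fubini'[symmetric]) (unfold K_def, measurable)
  also have "\<dots> = (\<integral>\<^sup>+v. \<integral>\<^sup>+s. \<integral>\<^sup>+G. K G v s \<partial>?P \<partial>lborel \<partial>lborel)"
    by (rule nn_integral_cong, rule PL.Fubini'[symmetric]) (unfold K_def, measurable)
  also have "\<dots> = (\<integral>\<^sup>+v. ennreal (fact ?d * a / sqrt (2 * pi) ^ ?d) * ennreal (1 / sqrt (1 + (v :: real ^ 'd) \<bullet> v) ^ (?d + 2)) * ?J \<partial>lborel)"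
  proof (rule nn_integral_cong)
    fix v :: "real ^ 'd"
    define r where "r = sqrt (1 + v \<bullet> v)"
    have r: "0 < r" "r\<^sup>2 = 1 + v \<bullet> v"
      unfolding r_def by (simp_all add: add_pos_nonneg)
    define c where "c = (1 / (sqrt (2 * pi) * r)) ^ (?d + 1) * (fact ?d * a\<^sup>2 / r\<^sup>2)"
    have c: "0 \<le> c" using r by (simp add: c_def)
    have "(\<integral>\<^sup>+G. K G v s \<partial>?P) = ennreal c * (ennreal (exp (- (a\<^sup>2 * (s / r)\<^sup>2) / 2)) * f (s / r))" for s
    proof -
      have "(\<integral>\<^sup>+G. K G v s \<partial>?P) = (\<integral>\<^sup>+G. ennreal ((det (aug G t))\<^sup>2) * (\<Prod>i\<in>UNIV. ennreal (std_normal_density (v \<bullet> G i + s * t i))) \<partial>?P) * f (s / r)"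
        unfolding K_def r_def by (rule nn_integral_multc) measurable
      also have "\<dots> = ennreal ((1 / (sqrt (2 * pi) * r)) ^ CARD('d option) * exp (- (a\<^sup>2 * (s / r)\<^sup>2) / 2)) *
        ennreal (fact ?d * a\<^sup>2 / r\<^sup>2) * f (s / r)"
        unfolding nn_integral_det_aug_sq_weighted r_def[symmetric] prod_normal_density_scaled[OF r(1)] a(2) r(2) ..
      also have "ennreal ((1 / (sqrt (2 * pi) * r)) ^ CARD('d option) * exp (- (a\<^sup>2 * (s / r)\<^sup>2) / 2)) * ennreal (fact ?d * a\<^sup>2 / r\<^sup>2) =
        ennreal c * ennreal (exp (- (a\<^sup>2 * (s / r)\<^sup>2) / 2))"
        unfolding c_def using r by (subst (1 2) ennreal_mult[symmetric]) (auto simp: mult_ac)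
      finally show ?thesis by (simp only: mult.assoc)
    qed
    then have "(\<integral>\<^sup>+s. \<integral>\<^sup>+G. K G v s \<partial>?P \<partial>lborel) = ennreal c * (\<integral>\<^sup>+s. ennreal (exp (- (a\<^sup>2 * (s / r)\<^sup>2) / 2)) * f (s / r) \<partial>lborel)"
      by (simp only:) (rule nn_integral_cmult, measurable)
    also have "\<dots> = ennreal c * ennreal (r * sqrt (2 * pi) / a) * ?J"
      unfolding nn_integral_scaled_gaussian[OF f r(1) a(1)] by (simp only: mult.assoc)
    also have "ennreal c * ennreal (r * sqrt (2 * pi) / a) = ennreal (c * (r * sqrt (2 * pi) / a))"
      using c r a by (intro ennreal_mult[symmetric]) simp_all
    \<comment> \<open>Count of the powers of \<open>r\<close>: \<open>c\<close> contains -(d + 1)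
      from the densities and -2 from the squared determinant, and the rescaling of \<open>s\<close>
      adds 1. The result is the exponent of \<open>nn_integral_cauchy_kernel\<close>.\<close>
    also have "c * (r * sqrt (2 * pi) / a) = fact ?d * a / sqrt (2 * pi) ^ ?d * (1 / r ^ (?d + 2))"
      unfolding c_def using r(1) a(1) by (simp add: field_simps power2_eq_square)
    also have "ennreal \<dots> = ennreal (fact ?d * a / sqrt (2 * pi) ^ ?d) * ennreal (1 / r ^ (?d + 2))"
      using r a by (intro ennreal_mult) simp_all
    finally show "(\<integral>\<^sup>+s. \<integral>\<^sup>+G. K G v s \<partial>?P \<partial>lborel) =
      ennreal (fact ?d * a / sqrt (2 * pi) ^ ?d) * ennreal (1 / sqrt (1 + v \<bullet> v) ^ (?d + 2)) * ?J"
      unfolding r_def .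
  qed
  also have "\<dots> = ennreal (fact ?d * a / sqrt (2 * pi) ^ ?d) * (\<integral>\<^sup>+v. ennreal (1 / sqrt (1 + (v :: real ^ 'd) \<bullet> v) ^ (?d + 2)) \<partial>lborel) * ?J"
    by (subst nn_integral_multc, measurable) (subst nn_integral_cmult, measurable)
  also have "\<dots> = ennreal (fact ?d * a / sqrt (2 * pi) ^ ?d * (sqrt pi ^ ?d / Gamma (real ?d / 2 + 1))) * ?J"
  proof -
    have "0 \<le> sqrt pi ^ ?d / Gamma (real ?d / 2 + 1)" by (simp add: Gamma_real_pos less_imp_le)
    then show ?thesis
      unfolding nn_integral_cauchy_kernel using a by (subst ennreal_mult) simp_all
  qed
  \<comment> \<open>The powers of pi cancel; duplication trades \<open>Gamma (d / 2 + 1)\<close> in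
    the denominator for \<open>Gamma ((d + 1) / 2)\<close> in the numerator.\<close>
  also have "fact ?d * a / sqrt (2 * pi) ^ ?d * (sqrt pi ^ ?d / Gamma (real ?d / 2 + 1)) =
    2 powr (real ?d / 2) * Gamma ((real ?d + 1) / 2) / sqrt pi * a"
  proof -
    define g where "g = Gamma (real ?d / 2 + 1)"
    define h where "h = Gamma ((real ?d + 1) / 2)"
    have g: "0 < g" unfolding g_def by (rule Gamma_real_pos) simp
    have gh: "h * g * 2 ^ ?d = sqrt pi * fact ?d"
      using Gamma_half_duplication[of ?d] by (simp add: g_def h_def)
    have p2: "2 powr (real ?d / 2) = sqrt 2 ^ ?d"
    proof -
      have "sqrt 2 powr real ?d = sqrt 2 ^ ?d" using powr_realpow[of "sqrt 2" ?d] by simp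
      moreover have "(2 powr (1 / 2)) powr real ?d = 2 powr (real ?d / 2)" by (simp add: powr_powr)
      moreover have "2 powr (1 / 2) = sqrt 2" by (intro powr_half_sqrt) simp
      ultimately show ?thesis by (simp only:)
    qed
    have s2: "sqrt 2 ^ ?d * sqrt 2 ^ ?d = 2 ^ ?d"
      by (simp add: power_mult_distrib[symmetric])
    have "fact ?d * a / sqrt (2 * pi) ^ ?d * (sqrt pi ^ ?d / g) = a * (fact ?d / (sqrt 2 ^ ?d * g))"
      by (simp add: real_sqrt_mult power_mult_distrib)
    also have "fact ?d / (sqrt 2 ^ ?d * g) = sqrt 2 ^ ?d * h / sqrt pi"
      using g gh s2[symmetric] by (simp add: field_simps)
    finally show ?thesis
      unfolding g_def[symmetric] h_def[symmetric] p2 by simp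
  qed
  finally show ?thesis .
qed

section \<open>Gaussian polytopes\<close>

text \<open>Independence of the basis coordinates gives a product law over \<open>Basis\<close>,
  which is reindexed along \<open>axis\<close> to the type \<open>'d\<close> and then packed into a
  vector.\<close>

lemma prob_space_std_gaussian_distr:
  fixes X :: "'w \<Rightarrow> real ^ 'd::finite"
  assumes M: "prob_space M" and X: "std_gaussian_vector M X"
  shows "distr M borel X = gauss" "X \<in> borel_measurable M"
proof -
  interpret prob_space M by fact
  have rv: "(\<lambda>\<omega>. X \<omega> \<bullet> b) \<in> borel_measurable M" if "b \<in> Basis" for b
    using X that unfolding std_gaussian_vector_def distributed_def by auto
  show Xm: "X \<in> borel_measurable M"
    using rv by (subst borel_measurable_euclidean_space) auto
  have d1: "distr M borel (\<lambda>\<omega>. X \<omega> \<bullet> b) = gauss1" if "b \<in> Basis" for b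
  proof -
    \<comment> \<open>\<open>distributed\<close> uses \<open>lborel\<close> as target space;
      \<open>distr\<close> depends on it only through the sigma-algebra, which is that of
      \<open>borel\<close>.\<close>
    have "distr M borel (\<lambda>\<omega>. X \<omega> \<bullet> b) = distr M lborel (\<lambda>\<omega>. X \<omega> \<bullet> b)"
      by (rule distr_cong) simp_all
    then show ?thesis
      using X that unfolding std_gaussian_vector_def distributed_def gauss1_def by auto
  qed
  let ?B = "Basis :: (real ^ 'd) set"
  have "distr M (\<Pi>\<^sub>M b\<in>?B. borel) (\<lambda>\<omega>. \<lambda>b\<in>?B. X \<omega> \<bullet> b) = (\<Pi>\<^sub>M b\<in>?B. distr M borel (\<lambda>\<omega>. X \<omega> \<bullet> b))"
    using X rv indep_vars_iff_distr_eq_PiM'[of ?B "\<lambda>b \<omega>. X \<omega> \<bullet> b" "\<lambda>_. borel"]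
    unfolding std_gaussian_vector_def by auto
  also have "\<dots> = PiM ?B (\<lambda>_. gauss1)"
    by (rule PiM_cong) (simp_all add: d1)
  finally have DB: "distr M (\<Pi>\<^sub>M b\<in>?B. borel) (\<lambda>\<omega>. \<lambda>b\<in>?B. X \<omega> \<bullet> b) = PiM ?B (\<lambda>_. gauss1)" .
  have m1: "(\<lambda>\<omega>. \<lambda>b\<in>?B. X \<omega> \<bullet> b) \<in> measurable M (\<Pi>\<^sub>M b\<in>?B. borel)"
    using rv by (intro measurable_restrict) auto
  have m2: "(\<lambda>\<omega>. \<lambda>i\<in>UNIV. \<omega> (axis i 1)) \<in> measurable (\<Pi>\<^sub>M b\<in>?B. borel) (PiM (UNIV :: 'd set) (\<lambda>_. borel :: real measure))"
    by (intro measurable_restrict measurable_component_singleton) simp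
  note m3 = measurable_vec_lambda[where 'n = 'd, OF refl]
  have "PiM (UNIV :: 'd set) (\<lambda>_. gauss1) =
    distr (PiM ?B (\<lambda>_. gauss1)) (PiM (UNIV :: 'd set) (\<lambda>_. gauss1)) (\<lambda>\<omega>. \<lambda>i\<in>UNIV. \<omega> (axis i 1))"
    by (rule distr_PiM_reindex[symmetric]) (auto simp: prob_space_gauss1 inj_axis_1)
  also have "\<dots> = distr (PiM ?B (\<lambda>_. gauss1)) (PiM (UNIV :: 'd set) (\<lambda>_. borel)) (\<lambda>\<omega>. \<lambda>i\<in>UNIV. \<omega> (axis i 1))"
    by (rule distr_cong) (simp_all cong: sets_PiM_cong)
  also have "\<dots> = distr M (PiM (UNIV :: 'd set) (\<lambda>_. borel)) ((\<lambda>\<omega>. \<lambda>i\<in>UNIV. \<omega> (axis i 1)) \<circ> (\<lambda>\<omega>. \<lambda>b\<in>?B. X \<omega> \<bullet> b))"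
    unfolding DB[symmetric] by (rule distr_distr[OF m2 m1])
  finally have P: "PiM (UNIV :: 'd set) (\<lambda>_. gauss1) =
    distr M (PiM (UNIV :: 'd set) (\<lambda>_. borel)) ((\<lambda>\<omega>. \<lambda>i\<in>UNIV. \<omega> (axis i 1)) \<circ> (\<lambda>\<omega>. \<lambda>b\<in>?B. X \<omega> \<bullet> b))" .
  have "gauss = distr M borel ((\<lambda>f. \<chi> i. f i) \<circ> ((\<lambda>\<omega>. \<lambda>i\<in>(UNIV :: 'd set). \<omega> (axis i 1)) \<circ> (\<lambda>\<omega>. \<lambda>b\<in>?B. X \<omega> \<bullet> b)))"
    unfolding distr_PiM_gauss1[symmetric] P by (rule distr_distr[OF m3 measurable_comp[OF m1 m2]])
  also have "((\<lambda>f. \<chi> i. f i) \<circ> ((\<lambda>\<omega>. \<lambda>i\<in>(UNIV :: 'd set). \<omega> (axis i 1)) \<circ> (\<lambda>\<omega>. \<lambda>b\<in>?B. X \<omega> \<bullet> b))) = X"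
    by (auto simp: fun_eq_iff vec_eq_iff inner_axis)
  finally show "distr M borel X = gauss" by simp
qed

section \<open>Simplices with vertices in an indexed family\<close>

definition simplex_det :: "('i \<Rightarrow> real) \<Rightarrow> 'i set \<Rightarrow> ('i \<Rightarrow> real ^ 'd::finite) \<Rightarrow> real" where
  "simplex_det \<tau> I x = det (aug (\<lambda>k. x (enum I k)) (\<lambda>k. \<tau> (enum I k)))"

definition simplex_hyp :: "('i \<Rightarrow> real) \<Rightarrow> 'i set \<Rightarrow> ('i \<Rightarrow> real ^ 'd::finite) \<Rightarrow> ('i \<Rightarrow> real) \<Rightarrow> (real ^ 'd) \<times> real" where
  "simplex_hyp \<tau> I x u = hyp (\<lambda>k. x (enum I k)) (\<lambda>k. \<tau> (enum I k)) (\<lambda>k. u (enum I k))"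

text \<open>This is \<open>\<tau> j\<close> times the height of the hyperplane above the lifted
  point \<open>j\<close>, whose coordinates are \<open>x j /\<^sub>R \<tau> j\<close> and
  \<open>u j / \<tau> j\<close>. With the denominator cleared and the hyperplane fixed, the gap is
  affine in the Gaussian variables \<open>x j\<close> and \<open>u j\<close>.\<close>

definition simplex_gap :: "('i \<Rightarrow> real) \<Rightarrow> 'i set \<Rightarrow> ('i \<Rightarrow> real ^ 'd::finite) \<Rightarrow> ('i \<Rightarrow> real) \<Rightarrow> 'i \<Rightarrow> real" where
  "simplex_gap \<tau> I x u j = fst (simplex_hyp \<tau> I x u) \<bullet> x j + snd (simplex_hyp \<tau> I x u) * \<tau> j - u j"

lemma simplex_gap_on:
  fixes x :: "'i \<Rightarrow> real ^ 'd::finite"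
  assumes "card I = CARD('d) + 1" "simplex_det \<tau> I x \<noteq> 0" "i \<in> I"
  shows "simplex_gap \<tau> I x u i = 0"
proof -
  obtain k where k: "i = (enum I :: 'd option \<Rightarrow> 'i) k"
    using bij_betw_enum[OF assms(1)] assms(3) by (auto simp: bij_betw_def)
  have "\<forall>k. u ((enum I :: 'd option \<Rightarrow> 'i) k) = fst (simplex_hyp \<tau> I x u) \<bullet> x (enum I k) + snd (simplex_hyp \<tau> I x u) * \<tau> (enum I k)"
    using assms(2) hyp_iff[of "\<lambda>k. x (enum I k)" "\<lambda>k. \<tau> (enum I k)" "\<lambda>k. u (enum I k)"]
    unfolding simplex_det_def simplex_hyp_def by (metis prod.collapse)
  then show ?thesis by (simp add: simplex_gap_def k)
qed

lemma measure_convex_hull_scaled_simplex: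
  fixes x :: "'i \<Rightarrow> real ^ 'd::finite"
  assumes I: "card I = CARD('d) + 1" and \<tau>: "\<And>i. i \<in> I \<Longrightarrow> 0 < \<tau> i"
  shows "det (aug (\<lambda>k. x (enum I k) /\<^sub>R \<tau> (enum I k)) (\<lambda>_. 1)) = simplex_det \<tau> I x / prod \<tau> I"
    and "measure lborel (convex hull ((\<lambda>i. x i /\<^sub>R \<tau> i) ` I)) = \<bar>simplex_det \<tau> I x\<bar> / (fact CARD('d) * prod \<tau> I)"
proof -
  let ?e = "enum I :: 'd option \<Rightarrow> 'i"
  note e = bij_betw_enum[OF I]
  have p: "(\<Prod>k\<in>UNIV. \<tau> (?e k)) = prod \<tau> I"
    by (rule prod.reindex_bij_betw[OF e])
  have ee: "?e k \<in> I" for k using e by (auto simp: bij_betw_def)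
  show 1: "det (aug (\<lambda>k. x (?e k) /\<^sub>R \<tau> (?e k)) (\<lambda>_. 1)) = simplex_det \<tau> I x / prod \<tau> I"
    unfolding simplex_det_def p[symmetric] by (rule det_aug_scale) (metis ee \<tau> less_irrefl)
  have r: "(\<lambda>i. x i /\<^sub>R \<tau> i) ` I = range (\<lambda>k. x (?e k) /\<^sub>R \<tau> (?e k))"
  proof -
    have "range ?e = I" using e by (simp add: bij_betw_def)
    then have "(\<lambda>i. x i /\<^sub>R \<tau> i) ` I = (\<lambda>i. x i /\<^sub>R \<tau> i) ` range ?e" by (rule arg_cong[OF sym])
    then show ?thesis by (simp only: image_image)
  qed
  have "0 < prod \<tau> I" by (rule prod_pos) (rule \<tau>)
  then show "measure lborel (convex hull ((\<lambda>i. x i /\<^sub>R \<tau> i) ` I)) = \<bar>simplex_det \<tau> I x\<bar> / (fact CARD('d) * prod \<tau> I)"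
    unfolding r content_simplex_aug 1 by (simp add: abs_divide mult.commute)
qed

text \<open>The regular triangulation for the heights \<open>u i / \<tau> i\<close>, rewritten for
  integration: the range of summation no longer depends on \<open>x\<close> and \<open>u\<close>.
  Degenerate index sets may be included because their factor \<open>simplex_det\<close> is 0, and
  membership in the triangulation becomes a product of indicators.\<close>

lemma measure_convex_hull_triangulation:
  fixes x :: "'i \<Rightarrow> real ^ 'd::finite" and u \<tau> :: "'i \<Rightarrow> real"
  assumes K: "finite K" and \<tau>: "\<And>i. i \<in> K \<Longrightarrow> 0 < \<tau> i"
    and off: "\<And>I j. I \<subseteq> K \<Longrightarrow> card I = CARD('d) + 1 \<Longrightarrow> j \<in> K - I \<Longrightarrow> simplex_gap \<tau> I x u j \<noteq> 0"
  shows "ennreal (measure lborel (convex hull ((\<lambda>i. x i /\<^sub>R \<tau> i) ` K))) =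
    (\<Sum>I | I \<subseteq> K \<and> card I = CARD('d) + 1.
       ennreal (1 / (fact CARD('d) * prod \<tau> I)) * (ennreal \<bar>simplex_det \<tau> I x\<bar> * (\<Prod>j\<in>K - I. indicator {0<..} (simplex_gap \<tau> I x u j))))"
proof -
  let ?y = "\<lambda>i. x i /\<^sub>R \<tau> i"
  let ?A = "{I. I \<subseteq> K \<and> card I = CARD('d) + 1}"
  let ?D = "{I\<in>?A. simplex_det \<tau> I x \<noteq> 0}"
  let ?v = "\<lambda>I. fst (simplex_hyp \<tau> I x u)" and ?s = "\<lambda>I. snd (simplex_hyp \<tau> I x u)"
  let ?t = "\<lambda>I. \<bar>simplex_det \<tau> I x\<bar> * (\<Prod>j\<in>K - I. indicator {0<..} (simplex_gap \<tau> I x u j)) :: real"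
  let ?w = "\<lambda>I. 1 / (fact CARD('d) * prod \<tau> I) :: real"
  let ?B = "{I\<in>?D. \<forall>j\<in>K - I. u j / \<tau> j < ?v I \<bullet> ?y j + ?s I}"
  have finA: "finite ?A" using K finite_subset[of ?A "Pow K"] by auto
  have gap: "u j / \<tau> j - (?v I \<bullet> ?y j + ?s I) = - simplex_gap \<tau> I x u j / \<tau> j" if "j \<in> K" for I j
    using \<tau>[OF that] by (simp add: simplex_gap_def field_simps)
  have vol: "measure lborel (convex hull (?y ` I)) = \<bar>simplex_det \<tau> I x\<bar> / (fact CARD('d) * prod \<tau> I)" if "I \<in> ?A" for I
    using that \<tau> by (intro measure_convex_hull_scaled_simplex(2)) auto
  have "measure lborel (convex hull (?y ` K)) =
    (\<Sum>I\<in>?B. measure lborel (convex hull (?y ` I)))"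
  proof (rule measure_regular_triangulation[OF K])
    show "?D \<subseteq> {I. I \<subseteq> K \<and> card I = DIM(real ^ 'd) + 1}" by auto
  next
    fix I assume I: "I \<subseteq> K" "card I = DIM(real ^ 'd) + 1" "I \<notin> ?D"
    have fI: "finite I" using I(1) K by (rule finite_subset)
    from I have "measure lborel (convex hull (?y ` I)) = 0"
      using vol[of I] by simp
    then have "measure lebesgue (convex hull (?y ` I)) = 0"
      using fI by (simp add: measure_lborel_convex_hull_finite)
    then show "negligible (convex hull (?y ` I))"
      using fI by (subst negligible_iff_measure) (auto intro!: lmeasurable_compact finite_imp_compact_convex_hull)
  next
    fix I p assume I: "I \<in> ?D"
    let ?e = "enum I :: 'd option \<Rightarrow> 'i"
    have c: "card I = CARD('d) + 1" using I by auto
    note e = bij_betw_enum[OF c]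
    have \<tau>I: "0 < \<tau> i" if "i \<in> I" for i using I \<tau> that by auto
    have pos: "0 < prod \<tau> I" by (rule prod_pos) (rule \<tau>I)
    have "det (aug (\<lambda>k. ?y (?e k)) (\<lambda>_. 1)) = simplex_det \<tau> I x / prod \<tau> I"
      by (rule measure_convex_hull_scaled_simplex(1)[OF c]) (rule \<tau>I)
    then have "det (aug (\<lambda>k. ?y (?e k)) (\<lambda>_. 1)) \<noteq> 0"
      using I pos by simp
    then obtain \<beta> where \<beta>: "(\<Sum>k\<in>UNIV. \<beta> k) = 1" "(\<Sum>k\<in>UNIV. \<beta> k *\<^sub>R ?y (?e k)) = p"
      using aug_one_span[of "\<lambda>k. ?y (?e k)" p] by blast
    let ?a = "\<lambda>i. \<beta> (inv_into UNIV ?e i)"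
    have ia: "?a (?e k) = \<beta> k" for k
      using e by (simp add: bij_betw_def)
    have "sum ?a I = 1"
      using sum.reindex_bij_betw[OF e, of ?a] \<beta>(1) by (simp add: ia)
    moreover have "(\<Sum>i\<in>I. ?a i *\<^sub>R ?y i) = p"
      using sum.reindex_bij_betw[OF e, of "\<lambda>i. ?a i *\<^sub>R ?y i"] \<beta>(2) by (simp add: ia)
    ultimately show "\<exists>\<alpha>. sum \<alpha> I = 1 \<and> (\<Sum>i\<in>I. \<alpha> i *\<^sub>R ?y i) = p" by blast
  next
    fix I i assume I: "I \<in> ?D" "i \<in> I"
    then have "simplex_gap \<tau> I x u i = 0" by (intro simplex_gap_on) auto
    then show "u i / \<tau> i = ?v I \<bullet> ?y i + ?s I"
      using gap[of i I] I by auto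
  next
    fix I j assume I: "I \<in> ?D" "j \<in> K - I"
    then have "simplex_gap \<tau> I x u j \<noteq> 0" by (intro off) auto
    then show "u j / \<tau> j \<noteq> ?v I \<bullet> ?y j + ?s I"
      using gap[of j I] I \<tau>[of j] by auto
  qed
  also have "\<dots> = (\<Sum>I\<in>?A. ?w I * ?t I)"
  proof (rule sum.mono_neutral_cong_left[OF finA])
    show "?B \<subseteq> ?A" by auto
    have iff: "u j / \<tau> j < ?v I \<bullet> ?y j + ?s I \<longleftrightarrow> 0 < simplex_gap \<tau> I x u j" if "j \<in> K" for I j
    proof -
      have "u j / \<tau> j < ?v I \<bullet> ?y j + ?s I \<longleftrightarrow> u j / \<tau> j - (?v I \<bullet> ?y j + ?s I) < 0" by linarith
      then show ?thesis unfolding gap[OF that] using \<tau>[OF that] by (simp add: divide_less_0_iff zero_less_divide_iff)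
    qed
    show "\<forall>I\<in>?A - ?B.
      ?w I * ?t I = 0"
    proof
      fix I assume I: "I \<in> ?A - ?B"
      show "?w I * ?t I = (0 :: real)"
      proof (cases "simplex_det \<tau> I x = 0")
        case False
        then obtain j where "j \<in> K - I" "\<not> 0 < simplex_gap \<tau> I x u j"
          using I iff by auto
        then have "(\<Prod>j\<in>K - I. indicator {0<..} (simplex_gap \<tau> I x u j) :: real) = 0"
          using K by (intro prod_zero bexI[of _ j]) auto
        then show ?thesis by simp
      qed simp
    qed
    fix I assume I: "I \<in> ?B"
    then have "(\<Prod>j\<in>K - I. indicator {0<..} (simplex_gap \<tau> I x u j) :: real) = 1"
      using iff by (intro prod.neutral) auto
    then show "measure lborel (convex hull (?y ` I)) = ?w I * ?t I"
      using vol[of I] I by simp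
  qed
  finally have eq: "measure lborel (convex hull (?y ` K)) = \<dots>" .
  have ind: "ennreal (\<Prod>j\<in>K - I. indicator {0<..} (simplex_gap \<tau> I x u j)) = (\<Prod>j\<in>K - I. indicator {0<..} (simplex_gap \<tau> I x u j))" for I
    by (simp add: prod_ennreal[symmetric] ennreal_indicator)
  have "0 \<le> ?w I" if "I \<in> ?A" for I
    using that \<tau> by (intro divide_nonneg_nonneg mult_nonneg_nonneg prod_nonneg) (auto simp: less_imp_le)
  then have e1: "ennreal (?w I * ?t I) =
    ennreal (?w I) * (ennreal \<bar>simplex_det \<tau> I x\<bar> * (\<Prod>j\<in>K - I. indicator {0<..} (simplex_gap \<tau> I x u j)))"
    and e0: "0 \<le> ?w I * ?t I"
    if "I \<in> ?A" for I
    using that unfolding ind[symmetric] by (simp_all only: ennreal_mult abs_ge_zero mult_nonneg_nonneg prod_nonneg indicator_pos_le)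
  show ?thesis
    unfolding eq by (subst sum_ennreal[symmetric]) (simp_all only: e1 e0 cong: sum.cong)
qed

lemma borel_measurable_simplex_gap:
  fixes X :: "'a \<Rightarrow> 'i \<Rightarrow> real ^ 'd::finite"
  assumes I: "card I = CARD('d) + 1"
    and X: "\<And>i. i \<in> insert j I \<Longrightarrow> (\<lambda>p. X p i) \<in> borel_measurable M"
    and U: "\<And>i. i \<in> insert j I \<Longrightarrow> (\<lambda>p. U p i) \<in> borel_measurable M"
  shows "(\<lambda>p. simplex_gap \<tau> I (X p) (U p) j) \<in> borel_measurable M"
proof -
  have e: "(enum I :: 'd option \<Rightarrow> 'i) k \<in> I" for k
    using bij_betw_enum[OF I] by (auto simp: bij_betw_def)
  have h: "(\<lambda>p. fst (simplex_hyp \<tau> I (X p) (U p))) \<in> borel_measurable M"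
    "(\<lambda>p. snd (simplex_hyp \<tau> I (X p) (U p))) \<in> borel_measurable M"
    unfolding simplex_hyp_def by (intro borel_measurable_hyp X U insertI2 e)+
  show ?thesis
    unfolding simplex_gap_def using h X[of j] U[of j] by measurable
qed

lemma borel_measurable_simplex_det:
  fixes X :: "'a \<Rightarrow> 'i \<Rightarrow> real ^ 'd::finite"
  assumes I: "card I = CARD('d) + 1" and X: "\<And>i. i \<in> I \<Longrightarrow> (\<lambda>p. X p i) \<in> borel_measurable M"
  shows "(\<lambda>p. simplex_det \<tau> I (X p)) \<in> borel_measurable M"
proof -
  have e: "(enum I :: 'd option \<Rightarrow> 'i) k \<in> I" for k
    using bij_betw_enum[OF I] by (auto simp: bij_betw_def)
  show ?thesis
    unfolding simplex_det_def by (intro borel_measurable_det_aug X e)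
qed

text \<open>Allows the hyperplane to be treated as constant while points or heights off
  \<open>I\<close> are integrated.\<close>

lemma simplex_cong:
  fixes x x' :: "'i \<Rightarrow> real ^ 'd::finite"
  assumes I: "card I = CARD('d) + 1" and "\<And>i. i \<in> I \<Longrightarrow> x i = x' i" "\<And>i. i \<in> I \<Longrightarrow> u i = u' i"
  shows "simplex_hyp \<tau> I x u = simplex_hyp \<tau> I x' u'" "simplex_det \<tau> I x = simplex_det \<tau> I x'"
proof -
  have e: "(enum I :: 'd option \<Rightarrow> 'i) k \<in> I" for k
    using bij_betw_enum[OF I] by (auto simp: bij_betw_def)
  show "simplex_hyp \<tau> I x u = simplex_hyp \<tau> I x' u'" "simplex_det \<tau> I x = simplex_det \<tau> I x'"
    by (simp_all add: simplex_hyp_def simplex_det_def assms(2,3)[OF e])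
qed

section \<open>Averaging over the heights and points off a simplex\<close>

lemma measurable_gauss: "measurable N gauss = borel_measurable N"
  by (rule measurable_cong_sets) simp_all

lemma measurable_gauss1: "measurable N gauss1 = borel_measurable N"
  by (rule measurable_cong_sets) simp_all

lemma nn_integral_gauss1:
  assumes "F \<in> borel_measurable borel"
  shows "(\<integral>\<^sup>+y. F y \<partial>gauss1) = (\<integral>\<^sup>+y. ennreal (std_normal_density y) * F y \<partial>lborel)"
  unfolding gauss1_def using assms by (subst nn_integral_density) auto

lemma nn_integral_gauss1_less: "(\<integral>\<^sup>+y. indicator {0<..} (a - y) \<partial>gauss1) = Phi a"
  by (subst nn_integral_gauss1, measurable) (auto simp: Phi_def indicator_def intro!: nn_integral_cong)

text \<open>With coordinate \<open>j\<close> integrated innermost, the hyperplane is fixed by the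
  heights over \<open>I\<close>, so the gap vanishes for a single value of \<open>u j\<close>, a
  null event for \<open>gauss1\<close>. The points are held fixed; genericity comes from the
  heights.\<close>

lemma AE_simplex_gap_nonzero:
  fixes x :: "'i \<Rightarrow> real ^ 'd::finite"
  assumes K: "finite K" and I: "I \<subseteq> K" "card I = CARD('d) + 1" and j: "j \<in> K - I"
  shows "AE u in PiM K (\<lambda>_. gauss1). simplex_gap \<tau> I x u j \<noteq> 0"
proof -
  interpret G: prob_space gauss1 by (rule prob_space_gauss1)
  interpret P: product_sigma_finite "\<lambda>_::'i. gauss1" ..
  obtain L where L: "K = insert j L" "j \<notin> L"
    using j by (meson DiffD1 mk_disjoint_insert)
  have m: "(\<lambda>u. indicator {0} (simplex_gap \<tau> I x u j) :: ennreal) \<in> borel_measurable (PiM K (\<lambda>_. gauss1))"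
  proof -
    have "(\<lambda>u. simplex_gap \<tau> I x u j) \<in> borel_measurable (PiM K (\<lambda>_. gauss1))"
    proof (rule borel_measurable_simplex_gap[OF I(2)])
      fix i assume "i \<in> insert j I"
      then have "i \<in> K" using I j by auto
      then show "(\<lambda>u. u i) \<in> borel_measurable (PiM K (\<lambda>_. gauss1))"
        using measurable_component_singleton[of i K "\<lambda>_. gauss1"] by (simp only: measurable_gauss1)
    qed simp
    then show ?thesis by measurable
  qed
  have "(\<integral>\<^sup>+u. indicator {0} (simplex_gap \<tau> I x u j) \<partial>PiM K (\<lambda>_. gauss1)) =
    (\<integral>\<^sup>+u. \<integral>\<^sup>+y. indicator {0} (simplex_gap \<tau> I x (u(j := y)) j) \<partial>gauss1 \<partial>PiM L (\<lambda>_. gauss1))"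
    unfolding L(1) by (rule P.product_nn_integral_insert) (use L K m in auto)
  also have "\<dots> = (\<integral>\<^sup>+u. 0 \<partial>PiM L (\<lambda>_. gauss1))"
  proof (rule nn_integral_cong)
    fix u :: "'i \<Rightarrow> real"
    define c where "c = fst (simplex_hyp \<tau> I x u) \<bullet> x j + snd (simplex_hyp \<tau> I x u) * \<tau> j"
    have "simplex_hyp \<tau> I x (u(j := y)) = simplex_hyp \<tau> I x u" for y
      by (rule simplex_cong(1)[OF I(2)]) (use j in auto)
    then have "(\<integral>\<^sup>+y. indicator {0} (simplex_gap \<tau> I x (u(j := y)) j) \<partial>gauss1) = (\<integral>\<^sup>+y. indicator {c} y \<partial>gauss1)"
      by (intro nn_integral_cong) (auto simp: simplex_gap_def c_def indicator_def)
    also have "\<dots> = (\<integral>\<^sup>+y. ennreal (std_normal_density y) * indicator {c} y \<partial>lborel)"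
      by (rule nn_integral_gauss1) simp
    also have "\<dots> = 0"
      by (rule nn_integral_null_set) (simp add: finite_imp_null_set_lborel)
    finally show "(\<integral>\<^sup>+y. indicator {0} (simplex_gap \<tau> I x (u(j := y)) j) \<partial>gauss1) = 0" .
  qed
  finally have "AE u in PiM K (\<lambda>_. gauss1). indicator {0} (simplex_gap \<tau> I x u j) = (0 :: ennreal)"
    using nn_integral_0_iff_AE[OF m] by simp
  then show ?thesis by eventually_elim (auto simp: indicator_def)
qed

text \<open>The value of \<open>Phi\<close> is the probability that a standard normal variable W
  satisfies W - v x < a. For an independent Gaussian \<open>x\<close>, the difference has variance 1
  + |v|^2; its density is the case \<open>F = 1\<close> of the observation formula.\<close>

lemma nn_integral_Phi_gauss:
  fixes v :: "real ^ 'd::finite"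
  shows "(\<integral>\<^sup>+x. Phi (v \<bullet> x + a) \<partial>gauss) = Phi (a / sqrt (1 + v \<bullet> v))"
proof -
  interpret G: prob_space "gauss :: (real ^ 'd) measure" by (rule prob_space_gauss)
  interpret pair_sigma_finite "gauss :: (real ^ 'd) measure" "lborel :: real measure"
    by (intro pair_sigma_finite.intro G.sigma_finite_measure_axioms sigma_finite_lborel)
  have "(\<integral>\<^sup>+x. Phi (v \<bullet> x + a) \<partial>gauss) = (\<integral>\<^sup>+x. (\<integral>\<^sup>+t. ennreal (std_normal_density (v \<bullet> x + t)) * indicator {..<a} t \<partial>lborel) \<partial>gauss)"
  proof (rule nn_integral_cong)
    fix x :: "real ^ 'd"
    have "Phi (v \<bullet> x + a) = ennreal \<bar>1\<bar> * (\<integral>\<^sup>+t. ennreal (std_normal_density (v \<bullet> x + 1 * t)) * indicator {..<v \<bullet> x + a} (v \<bullet> x + 1 * t) \<partial>lborel)"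
      unfolding Phi_def by (rule nn_integral_real_affine) auto
    then show "Phi (v \<bullet> x + a) = (\<integral>\<^sup>+t. ennreal (std_normal_density (v \<bullet> x + t)) * indicator {..<a} t \<partial>lborel)"
      by (simp add: indicator_def)
  qed
  also have "\<dots> = (\<integral>\<^sup>+t. (\<integral>\<^sup>+x. ennreal (std_normal_density (v \<bullet> x + t)) * indicator {..<a} t \<partial>gauss) \<partial>lborel)"
    by (rule Fubini'[symmetric]) measurable
  also have "\<dots> = (\<integral>\<^sup>+t\<in>{..<a}. ennreal (normal_density 0 (sqrt (1 + v \<bullet> v)) t) \<partial>lborel)"
  proof (rule nn_integral_cong)
    fix t
    obtain T :: "real ^ 'd ^ 'd" where "\<bar>det T\<bar> = 1 / sqrt (1 + v \<bullet> v)" and T: "\<And>t F. F \<in> borel_measurable borel \<Longrightarrow>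
       (\<integral>\<^sup>+x. F x * ennreal (std_normal_density (v \<bullet> x + t)) \<partial>gauss) =
       ennreal (normal_density 0 (sqrt (1 + v \<bullet> v)) t) * (\<integral>\<^sup>+x. F (x v* T - (t / (1 + v \<bullet> v)) *\<^sub>R v) \<partial>gauss)"
      using gauss_observation[of v] by blast
    have "(\<integral>\<^sup>+x. ennreal (std_normal_density (v \<bullet> x + t)) \<partial>gauss) = ennreal (normal_density 0 (sqrt (1 + v \<bullet> v)) t)"
      using T[of "\<lambda>_. 1" t] G.emeasure_space_1 by simp
    then show "(\<integral>\<^sup>+x. ennreal (std_normal_density (v \<bullet> x + t)) * indicator {..<a} t \<partial>gauss) =
      ennreal (normal_density 0 (sqrt (1 + v \<bullet> v)) t) * indicator {..<a} t"
      by (subst nn_integral_multc) auto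
  qed
  also have "\<dots> = Phi (a / sqrt (1 + v \<bullet> v))"
    by (subst normal_tail) (auto simp: add_pos_nonneg)
  finally show ?thesis .
qed

text \<open>Transfers results over the fixed index type \<open>'d option\<close> to an arbitrary
  vertex set.\<close>

lemma nn_integral_PiM_enum:
  fixes F :: "('d::finite option \<Rightarrow> 'a) \<Rightarrow> ennreal" and I :: "'i set"
  assumes M: "prob_space M" and I: "card I = CARD('d) + 1"
    and F: "F \<in> borel_measurable (PiM UNIV (\<lambda>_. M))"
  shows "(\<integral>\<^sup>+y. F (\<lambda>k. y (enum I k)) \<partial>PiM I (\<lambda>_. M)) = (\<integral>\<^sup>+G. F G \<partial>PiM UNIV (\<lambda>_. M))"
proof -
  let ?e = "enum I :: 'd option \<Rightarrow> 'i"
  have e: "inj ?e" "?e \<in> UNIV \<rightarrow> I" using bij_betw_enum[OF I] by (auto simp: bij_betw_def)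
  have m: "(\<lambda>y. \<lambda>k\<in>UNIV. y (?e k)) \<in> measurable (PiM I (\<lambda>_. M)) (PiM UNIV (\<lambda>_. M))"
    using e(2) by (intro measurable_restrict measurable_component_singleton) auto
  have "(\<integral>\<^sup>+G. F G \<partial>PiM UNIV (\<lambda>_. M)) =
    (\<integral>\<^sup>+G. F G \<partial>distr (PiM I (\<lambda>_. M)) (PiM UNIV (\<lambda>_. M)) (\<lambda>y. \<lambda>k\<in>UNIV. y (?e k)))"
    using M e by (subst distr_PiM_reindex) auto
  also have "\<dots> = (\<integral>\<^sup>+y. F (\<lambda>k\<in>UNIV. y (?e k)) \<partial>PiM I (\<lambda>_. M))"
    by (rule nn_integral_distr[OF m]) (use F in simp)
  finally show ?thesis by (simp add: restrict_UNIV)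
qed

lemma borel_measurable_upper_simplex:
  assumes I: "I \<subseteq> K" "card I = CARD('d) + 1"
    and X: "X \<in> measurable N (PiM K (\<lambda>_. gauss :: (real ^ 'd::finite) measure))"
    and U: "U \<in> measurable N (PiM K (\<lambda>_. gauss1))"
  shows "(\<lambda>p. ennreal \<bar>simplex_det \<tau> I (X p)\<bar> * (\<Prod>j\<in>K - I. indicator {0<..} (simplex_gap \<tau> I (X p) (U p) j)))
    \<in> borel_measurable N"
proof -
  have Xi: "(\<lambda>p. X p i) \<in> borel_measurable N" if "i \<in> K" for i
    using measurable_compose[OF X measurable_component_singleton[OF that, of "\<lambda>_. gauss :: (real ^ 'd) measure"]]
    by (simp only: measurable_gauss)
  have Ui: "(\<lambda>p. U p i) \<in> borel_measurable N" if "i \<in> K" for i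
    using measurable_compose[OF U measurable_component_singleton[OF that, of "\<lambda>_. gauss1"]]
    by (simp only: measurable_gauss1)
  have [measurable]: "(\<lambda>p. simplex_det \<tau> I (X p)) \<in> borel_measurable N"
    using I(1) by (intro borel_measurable_simplex_det[OF I(2)] Xi) auto
  have gap: "(\<lambda>p. simplex_gap \<tau> I (X p) (U p) j) \<in> borel_measurable N" if "j \<in> K - I" for j
    using that I(1) by (intro borel_measurable_simplex_gap[OF I(2)] Xi Ui) auto
  have [measurable]: "(\<lambda>p. \<Prod>j\<in>K - I. indicator {0<..} (simplex_gap \<tau> I (X p) (U p) j) :: ennreal) \<in> borel_measurable N"
  proof (rule borel_measurable_prod_ennreal)
    fix j assume "j \<in> K - I"
    note [measurable] = gap[OF this]
    show "(\<lambda>p. indicator {0<..} (simplex_gap \<tau> I (X p) (U p) j) :: ennreal) \<in> borel_measurable N"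
      by measurable
  qed
  show ?thesis by measurable
qed

text \<open>The order of integration is what matters. The heights off \<open>I\<close> turn the
  indicators into \<open>Phi\<close> of the hyperplane evaluated at the remaining points; averaging
  over these points leaves \<open>Phi (\<tau> j * z)\<close> with \<open>z\<close> the
  \<open>offset\<close>. What remains involves the vertices and their heights alone and is an
  instance of \<open>nn_integral_det_aug_offset\<close>.\<close>

proposition nn_integral_upper_simplex:
  fixes \<tau> :: "'i \<Rightarrow> real"
  assumes K: "finite K" and \<tau>: "\<And>i. i \<in> K \<Longrightarrow> 0 < \<tau> i"
    and I: "I \<subseteq> K" "card I = CARD('d) + 1"
  defines "a \<equiv> sqrt (\<Sum>i\<in>I. (\<tau> i)\<^sup>2)"
  shows "(\<integral>\<^sup>+x. \<integral>\<^sup>+u. ennreal \<bar>simplex_det \<tau> I x\<bar> * (\<Prod>j\<in>K - I. indicator {0<..} (simplex_gap \<tau> I x u j))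
      \<partial>PiM K (\<lambda>_. gauss1) \<partial>PiM K (\<lambda>_. gauss :: (real ^ 'd::finite) measure)) =
    ennreal (2 powr (real CARD('d) / 2) * Gamma ((real CARD('d) + 1) / 2) / sqrt pi * a) *
    (\<integral>\<^sup>+z. ennreal (normal_density 0 (1 / a) z) * (\<Prod>j\<in>K - I. Phi (\<tau> j * z)) \<partial>lborel)"
proof -
  let ?g = "gauss :: (real ^ 'd) measure"
  let ?e = "enum I :: 'd option \<Rightarrow> 'i"
  define J where "J = K - I"
  have IJ: "I \<inter> J = {}" "K = I \<union> J" "finite I" "finite J"
    using I K finite_subset by (auto simp: J_def)
  let ?UI = "PiM I (\<lambda>_. gauss1)" and ?GI = "PiM I (\<lambda>_. ?g)"
  let ?UJ = "PiM J (\<lambda>_. gauss1)" and ?GJ = "PiM J (\<lambda>_. ?g)"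
  let ?UK = "PiM K (\<lambda>_. gauss1)" and ?GK = "PiM K (\<lambda>_. ?g)"
  have e: "?e k \<in> I" for k using bij_betw_enum[OF I(2)] by (auto simp: bij_betw_def)
  interpret G1: prob_space gauss1 by (rule prob_space_gauss1)
  interpret G: prob_space ?g by (rule prob_space_gauss)
  interpret P1: product_sigma_finite "\<lambda>_::'i. gauss1" ..
  interpret P: product_sigma_finite "\<lambda>_::'i. ?g" ..
  interpret PJ: prob_space "?GJ" by (intro prob_space_PiM prob_space_gauss)
  interpret PI: prob_space "?UI" by (intro prob_space_PiM prob_space_gauss1)
  interpret PJI: pair_sigma_finite "?GJ" "?UI"
    by (intro pair_sigma_finite.intro PJ.sigma_finite_measure_axioms PI.sigma_finite_measure_axioms)
  interpret P1K: prob_space "?UK" by (intro prob_space_PiM prob_space_gauss1)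
  define D where "D y = ennreal \<bar>simplex_det \<tau> I y\<bar>" for y :: "'i \<Rightarrow> real ^ 'd"
  define H where "H x u = D x * (\<Prod>j\<in>J. indicator {0<..} (simplex_gap \<tau> I x u j))" for x u
  have mH: "(\<lambda>p. H (X p) (U p)) \<in> borel_measurable N"
    if "X \<in> measurable N ?GK" "U \<in> measurable N ?UK" for X U and N :: "'z measure"
    unfolding H_def D_def J_def by (rule borel_measurable_upper_simplex[OF I that])
  have step1: "(\<integral>\<^sup>+u. H x u \<partial>?UK) = (\<integral>\<^sup>+w. D x * (\<Prod>j\<in>J. Phi (fst (simplex_hyp \<tau> I x w) \<bullet> x j + snd (simplex_hyp \<tau> I x w) * \<tau> j)) \<partial>?UI)"
    if x: "x \<in> space ?GK" for x
  proof -
    have "(\<integral>\<^sup>+u. H x u \<partial>?UK) = (\<integral>\<^sup>+w. \<integral>\<^sup>+r. H x (merge I J (w, r)) \<partial>?UJ \<partial>?UI)"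
      unfolding IJ(2) by (rule P1.product_nn_integral_fold[OF IJ(1,3,4)]) (use mH[of "\<lambda>_. x" _ "\<lambda>u. u"] x IJ(2) in simp)
    also have "\<dots> = (\<integral>\<^sup>+w. D x * (\<Prod>j\<in>J. Phi (fst (simplex_hyp \<tau> I x w) \<bullet> x j + snd (simplex_hyp \<tau> I x w) * \<tau> j)) \<partial>?UI)"
    proof (rule nn_integral_cong)
      fix w :: "'i \<Rightarrow> real"
      let ?c = "\<lambda>j. fst (simplex_hyp \<tau> I x w) \<bullet> x j + snd (simplex_hyp \<tau> I x w) * \<tau> j"
      have "simplex_hyp \<tau> I x (merge I J (w, r)) = simplex_hyp \<tau> I x w" for r
        by (rule simplex_cong(1)[OF I(2)]) (auto simp: merge_def)
      then have "simplex_gap \<tau> I x (merge I J (w, r)) j = ?c j - r j" if "j \<in> J" for r j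
        using that IJ(1) by (auto simp: simplex_gap_def merge_def)
      then have "(\<integral>\<^sup>+r. H x (merge I J (w, r)) \<partial>?UJ) = (\<integral>\<^sup>+r. D x * (\<Prod>j\<in>J. indicator {0<..} (?c j - r j)) \<partial>?UJ)"
        unfolding H_def by (intro nn_integral_cong arg_cong2[where f = "(*)"] prod.cong) auto
      also have "\<dots> = D x * (\<integral>\<^sup>+r. (\<Prod>j\<in>J. indicator {0<..} (?c j - r j)) \<partial>?UJ)"
        by (rule nn_integral_cmult) measurable
      also have "(\<integral>\<^sup>+r. (\<Prod>j\<in>J. indicator {0<..} (?c j - r j)) \<partial>?UJ) = (\<Prod>j\<in>J. Phi (?c j))"
        by (subst P1.product_nn_integral_prod[OF IJ(4)]) (simp_all add: nn_integral_gauss1_less)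
      finally show "(\<integral>\<^sup>+r. H x (merge I J (w, r)) \<partial>?UJ) = D x * (\<Prod>j\<in>J. Phi (?c j))" .
    qed
    finally show ?thesis .
  qed
  have mHx: "(\<lambda>x. \<integral>\<^sup>+u. H x u \<partial>?UK) \<in> borel_measurable ?GK"
  proof -
    have "(\<lambda>(x, u). H x u) \<in> borel_measurable (?GK \<Otimes>\<^sub>M ?UK)"
      using mH[of fst "?GK \<Otimes>\<^sub>M ?UK" snd] by (simp add: case_prod_beta)
    then show ?thesis by (rule P1K.borel_measurable_nn_integral)
  qed
  define f where "f z = (\<Prod>j\<in>J. Phi (\<tau> j * z))" for z
  have f [measurable]: "f \<in> borel_measurable borel" unfolding f_def by measurable
  have "(\<integral>\<^sup>+x. \<integral>\<^sup>+u. H x u \<partial>?UK \<partial>?GK) =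
    (\<integral>\<^sup>+y. \<integral>\<^sup>+z. \<integral>\<^sup>+u. H (merge I J (y, z)) u \<partial>?UK \<partial>?GJ \<partial>?GI)"
    using mHx P.product_nn_integral_fold[OF IJ(1,3,4), of "\<lambda>x. \<integral>\<^sup>+u. H x u \<partial>?UK"]
    unfolding IJ(2)[symmetric] by simp
  also have "\<dots> = (\<integral>\<^sup>+y. D y * (\<integral>\<^sup>+w. f (offset (simplex_hyp \<tau> I y w)) \<partial>?UI) \<partial>?GI)"
  proof (rule nn_integral_cong)
    fix y assume y: "y \<in> space ?GI"
    let ?c = "\<lambda>w z j. fst (simplex_hyp \<tau> I y w) \<bullet> z j + snd (simplex_hyp \<tau> I y w) * \<tau> j"
    have hm: "(\<lambda>w. fst (simplex_hyp \<tau> I y w)) \<in> borel_measurable ?UI"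
      "(\<lambda>w. snd (simplex_hyp \<tau> I y w)) \<in> borel_measurable ?UI"
      unfolding simplex_hyp_def using e measurable_component_singleton[of _ I "\<lambda>_. gauss1"]
      by (intro borel_measurable_hyp; simp add: measurable_gauss1)+
    note [measurable] = hm
    have "(\<integral>\<^sup>+z. \<integral>\<^sup>+u. H (merge I J (y, z)) u \<partial>?UK \<partial>?GJ) =
      (\<integral>\<^sup>+z. \<integral>\<^sup>+w. D y * (\<Prod>j\<in>J. Phi (?c w z j)) \<partial>?UI \<partial>?GJ)"
    proof (rule nn_integral_cong)
      fix z assume z: "z \<in> space ?GJ"
      have sp: "merge I J (y, z) \<in> space ?GK"
        using y z IJ by (auto simp: space_PiM merge_def PiE_iff extensional_def)
      have "D (merge I J (y, z)) = D y" "simplex_hyp \<tau> I (merge I J (y, z)) w = simplex_hyp \<tau> I y w" for w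
        unfolding D_def by (subst simplex_cong[OF I(2), of _ y _ w]; auto simp: merge_def)+
      moreover have "merge I J (y, z) j = z j" if "j \<in> J" for j
        using that IJ(1) by (auto simp: merge_def)
      ultimately show "(\<integral>\<^sup>+u. H (merge I J (y, z)) u \<partial>?UK) =
        (\<integral>\<^sup>+w. D y * (\<Prod>j\<in>J. Phi (?c w z j)) \<partial>?UI)"
        unfolding step1[OF sp] by (auto intro!: nn_integral_cong arg_cong2[where f = "(*)"] prod.cong)
    qed
    \<comment> \<open>The points off \<open>I\<close> have to be averaged for a fixed hyperplane, so
      their integral moves inside the one over the heights on \<open>I\<close>.\<close>
    also have "\<dots> = (\<integral>\<^sup>+w. \<integral>\<^sup>+z. D y * (\<Prod>j\<in>J. Phi (?c w z j)) \<partial>?GJ \<partial>?UI)"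
      by (rule PJI.Fubini'[symmetric]) measurable
    also have "\<dots> = (\<integral>\<^sup>+w. D y * f (offset (simplex_hyp \<tau> I y w)) \<partial>?UI)"
    proof (rule nn_integral_cong)
      fix w :: "'i \<Rightarrow> real"
      have "(\<integral>\<^sup>+z. D y * (\<Prod>j\<in>J. Phi (?c w z j)) \<partial>?GJ) = D y * (\<integral>\<^sup>+z. (\<Prod>j\<in>J. Phi (?c w z j)) \<partial>?GJ)"
        by (rule nn_integral_cmult) measurable
      also have "(\<integral>\<^sup>+z. (\<Prod>j\<in>J. Phi (?c w z j)) \<partial>?GJ) = f (offset (simplex_hyp \<tau> I y w))"
        unfolding f_def
        by (subst P.product_nn_integral_prod[OF IJ(4)]) (simp_all add: nn_integral_Phi_gauss offset_def mult.commute)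
      finally show "(\<integral>\<^sup>+z. D y * (\<Prod>j\<in>J. Phi (?c w z j)) \<partial>?GJ) = D y * f (offset (simplex_hyp \<tau> I y w))" .
    qed
    also have "\<dots> = D y * (\<integral>\<^sup>+w. f (offset (simplex_hyp \<tau> I y w)) \<partial>?UI)"
      by (rule nn_integral_cmult) (unfold offset_def, measurable)
    finally show "(\<integral>\<^sup>+z. \<integral>\<^sup>+u. H (merge I J (y, z)) u \<partial>?UK \<partial>?GJ) =
      D y * (\<integral>\<^sup>+w. f (offset (simplex_hyp \<tau> I y w)) \<partial>?UI)" .
  qed
  also have "\<dots> = (\<integral>\<^sup>+y. ennreal \<bar>det (aug (\<lambda>k. y (?e k)) (\<lambda>k. \<tau> (?e k)))\<bar> *
      (\<integral>\<^sup>+u. f (offset (hyp (\<lambda>k. y (?e k)) (\<lambda>k. \<tau> (?e k)) u)) \<partial>PiM UNIV (\<lambda>_. gauss1)) \<partial>?GI)"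
  proof (rule nn_integral_cong)
    fix y :: "'i \<Rightarrow> real ^ 'd"
    have "(\<lambda>u. offset (hyp (\<lambda>k. y (?e k)) (\<lambda>k. \<tau> (?e k)) u)) \<in> borel_measurable (PiM UNIV (\<lambda>_. gauss1))"
      by (rule borel_measurable_offset_hyp) simp_all
    from nn_integral_PiM_enum[OF prob_space_gauss1 I(2) measurable_compose[OF this f]]
    show "D y * (\<integral>\<^sup>+w. f (offset (simplex_hyp \<tau> I y w)) \<partial>?UI) =
      ennreal \<bar>det (aug (\<lambda>k. y (?e k)) (\<lambda>k. \<tau> (?e k)))\<bar> *
      (\<integral>\<^sup>+u. f (offset (hyp (\<lambda>k. y (?e k)) (\<lambda>k. \<tau> (?e k)) u)) \<partial>PiM UNIV (\<lambda>_. gauss1))"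
      by (simp add: D_def simplex_det_def simplex_hyp_def)
  qed
  also have "\<dots> = (\<integral>\<^sup>+G. ennreal \<bar>det (aug G (\<lambda>k. \<tau> (?e k)))\<bar> *
      (\<integral>\<^sup>+u. f (offset (hyp G (\<lambda>k. \<tau> (?e k)) u)) \<partial>PiM UNIV (\<lambda>_. gauss1)) \<partial>PiM UNIV (\<lambda>_. ?g))"
  proof (rule nn_integral_PiM_enum[OF prob_space_gauss I(2)])
    interpret U: prob_space "PiM (UNIV :: 'd option set) (\<lambda>_. gauss1)" by (intro prob_space_PiM prob_space_gauss1)
    have "(\<lambda>p. offset (hyp (fst p) (\<lambda>k. \<tau> (?e k)) (snd p))) \<in> borel_measurable (PiM UNIV (\<lambda>_. ?g) \<Otimes>\<^sub>M PiM UNIV (\<lambda>_. gauss1))"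
      by (rule borel_measurable_offset_hyp) measurable
    then have [measurable]: "(\<lambda>(G, u). f (offset (hyp G (\<lambda>k. \<tau> (?e k)) u))) \<in> borel_measurable (PiM UNIV (\<lambda>_. ?g) \<Otimes>\<^sub>M PiM UNIV (\<lambda>_. gauss1))"
      using measurable_compose[OF _ f] by (simp add: case_prod_beta)
    have "(\<lambda>G. \<integral>\<^sup>+u. f (offset (hyp G (\<lambda>k. \<tau> (?e k)) u)) \<partial>PiM UNIV (\<lambda>_. gauss1)) \<in> borel_measurable (PiM UNIV (\<lambda>_. ?g))"
      by (rule U.borel_measurable_nn_integral) measurable
    then show "(\<lambda>G. ennreal \<bar>det (aug G (\<lambda>k. \<tau> (?e k)))\<bar> *
      (\<integral>\<^sup>+u. f (offset (hyp G (\<lambda>k. \<tau> (?e k)) u)) \<partial>PiM UNIV (\<lambda>_. gauss1))) \<in> borel_measurable (PiM UNIV (\<lambda>_. ?g))"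
      by measurable
  qed
  also have "\<dots> = ennreal (2 powr (real CARD('d) / 2) * Gamma ((real CARD('d) + 1) / 2) / sqrt pi * a) *
    (\<integral>\<^sup>+z. ennreal (normal_density 0 (1 / a) z) * f z \<partial>lborel)"
  proof (rule nn_integral_det_aug_offset[OF f])
    have "I \<noteq> {}" using I(2) by auto
    then have pos: "0 < (\<Sum>i\<in>I. (\<tau> i)\<^sup>2)"
      using I(1) IJ(3) \<tau> by (intro sum_pos) force+
    then show "0 < a" by (simp add: a_def)
    have "(\<Sum>k\<in>UNIV. (\<tau> (?e k))\<^sup>2) = (\<Sum>i\<in>I. (\<tau> i)\<^sup>2)"
      by (rule sum.reindex_bij_betw[OF bij_betw_enum[OF I(2)]])
    then show "a\<^sup>2 = (\<Sum>k\<in>UNIV. (\<tau> (?e k))\<^sup>2)"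
      using pos by (simp add: a_def)
  qed
  finally show ?thesis
    unfolding H_def D_def f_def J_def .
qed

theorem theorem6p6:
  fixes M :: "'w measure"
    and g :: "nat \<Rightarrow> 'w \<Rightarrow> real ^ 'd"
    and \<tau> :: "nat \<Rightarrow> real"
    and n d :: nat
  assumes d: "d = CARD('d)"
    and n: "n \<ge> d + 1"
    and \<tau>: "\<And>i. i \<in> {1..n} \<Longrightarrow> \<tau> i > 0"
    and M: "prob_space M"
    and indep: "prob_space.indep_vars M (\<lambda>_. borel) g {1..n}"
    and gauss: "\<And>i. i \<in> {1..n} \<Longrightarrow> std_gaussian_vector M (g i)"
  shows "prob_space.expectation M
           (\<lambda>\<omega>. measure lborel (convex hull ((\<lambda>i. g i \<omega> /\<^sub>R \<tau> i) ` {1..n}))) =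
         2 powr (real d / 2) * Gamma ((real d + 1) / 2) / (sqrt pi * fact d) *
         (\<Sum>I | I \<subseteq> {1..n} \<and> card I = d + 1.
            sqrt (\<Sum>i\<in>I. (\<tau> i)\<^sup>2) / (\<Prod>i\<in>I. \<tau> i) *
            gfun (\<Sum>i\<in>I. (\<tau> i)\<^sup>2)
                 (map (\<lambda>j. (\<tau> j)\<^sup>2) (sorted_list_of_set ({1..n} - I))))"
proof -
  interpret M: prob_space M by (rule M)
  let ?g = "gauss :: (real ^ 'd) measure"
  define K where "K = {1..n}"
  have K: "finite K" "K \<noteq> {}" using n by (auto simp: K_def)
  have pos: "0 < \<tau> i" if "i \<in> K" for i using \<tau> that by (simp add: K_def)
  let ?A = "{I. I \<subseteq> K \<and> card I = CARD('d) + 1}"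
  have finA: "finite ?A" using K(1) finite_subset[of ?A "Pow K"] by auto
  let ?G = "PiM K (\<lambda>_. ?g)" and ?U = "PiM K (\<lambda>_. gauss1)"
  interpret U: prob_space ?U by (intro prob_space_PiM prob_space_gauss1)
  define V where "V x = measure lborel (convex hull ((\<lambda>i. x i /\<^sub>R \<tau> i) ` K))" for x :: "nat \<Rightarrow> real ^ 'd"
  define w where "w I = 1 / (fact CARD('d) * prod \<tau> I)" for I
  define H where "H I x u = ennreal \<bar>simplex_det \<tau> I x\<bar> * (\<Prod>j\<in>K - I. indicator {0<..} (simplex_gap \<tau> I x u j))"
    for I and x :: "nat \<Rightarrow> real ^ 'd" and u
  have w: "0 \<le> w I" if "I \<in> ?A" for I
    unfolding w_def using that pos by (intro divide_nonneg_nonneg mult_nonneg_nonneg prod_nonneg) (auto intro: less_imp_le)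
  have mH: "(\<lambda>(x, u). H I x u) \<in> borel_measurable (?G \<Otimes>\<^sub>M ?U)" if "I \<in> ?A" for I
    unfolding H_def case_prod_beta using that by (intro borel_measurable_upper_simplex) auto
  have mHx: "(\<lambda>x. \<integral>\<^sup>+u. H I x u \<partial>?U) \<in> borel_measurable ?G" if "I \<in> ?A" for I
    by (rule U.borel_measurable_nn_integral[OF mH[OF that]])
  have mHu: "H I x \<in> borel_measurable ?U" if "I \<in> ?A" "x \<in> space ?G" for I x
    using measurable_compose[OF measurable_Pair1'[OF that(2)] mH[OF that(1)]] by simp
  \<comment> \<open>The volume does not depend on the auxiliary heights: the triangulation formula
    holds for almost every \<open>u\<close>, and averaging it over the probability measure
    \<open>?U\<close> leaves its left side unchanged.\<close>
  have V: "ennreal (V x) = (\<Sum>I\<in>?A. ennreal (w I) * (\<integral>\<^sup>+u. H I x u \<partial>?U))" if x: "x \<in> space ?G" for x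
  proof -
    have "AE u in ?U. \<forall>I\<in>?A. \<forall>j\<in>K - I. simplex_gap \<tau> I x u j \<noteq> 0"
      using K(1) finA by (intro AE_finite_allI AE_simplex_gap_nonzero) auto
    then have "AE u in ?U. ennreal (V x) = (\<Sum>I\<in>?A. ennreal (w I) * H I x u)"
    proof eventually_elim
      case (elim u)
      then show ?case
        unfolding V_def w_def H_def by (intro measure_convex_hull_triangulation[OF K(1) pos]) auto
    qed
    then have "(\<integral>\<^sup>+u. ennreal (V x) \<partial>?U) = (\<integral>\<^sup>+u. (\<Sum>I\<in>?A. ennreal (w I) * H I x u) \<partial>?U)"
      by (rule nn_integral_cong_AE)
    also have "\<dots> = (\<Sum>I\<in>?A. \<integral>\<^sup>+u. ennreal (w I) * H I x u \<partial>?U)"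
      using mHu[OF _ x] by (intro nn_integral_sum borel_measurable_times_ennreal) auto
    also have "\<dots> = (\<Sum>I\<in>?A. ennreal (w I) * (\<integral>\<^sup>+u. H I x u \<partial>?U))"
      using mHu[OF _ x] by (intro sum.cong refl nn_integral_cmult)
    finally show ?thesis by (simp add: U.emeasure_space_1)
  qed
  \<comment> \<open>Measurability of the hull volume is inherited from the right side of this
    formula.\<close>
  have mV: "V \<in> borel_measurable ?G"
  proof -
    have "(\<lambda>x. \<Sum>I\<in>?A. ennreal (w I) * (\<integral>\<^sup>+u. H I x u \<partial>?U)) \<in> borel_measurable ?G"
      using mHx by (intro borel_measurable_sum borel_measurable_times_ennreal) auto
    then have "(\<lambda>x. enn2real (\<Sum>I\<in>?A. ennreal (w I) * (\<integral>\<^sup>+u. H I x u \<partial>?U))) \<in> borel_measurable ?G"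
      by (rule borel_measurable_enn2real)
    moreover have "V x = enn2real (\<Sum>I\<in>?A. ennreal (w I) * (\<integral>\<^sup>+u. H I x u \<partial>?U))" if "x \<in> space ?G" for x
      unfolding V[OF that, symmetric] by (simp add: V_def)
    ultimately show ?thesis by (simp cong: measurable_cong)
  qed
  \<comment> \<open>The factor 1 / d! of the claim is kept apart from \<open>?c\<close>; it enters
    through the simplex volumes in \<open>w\<close>.\<close>
  let ?c = "2 powr (real d / 2) * Gamma ((real d + 1) / 2) / sqrt pi"
  let ?s = "\<lambda>I. sqrt (\<Sum>i\<in>I. (\<tau> i)\<^sup>2)"
  let ?gf = "\<lambda>I. gfun (\<Sum>i\<in>I. (\<tau> i)\<^sup>2) (map (\<lambda>j. (\<tau> j)\<^sup>2) (sorted_list_of_set (K - I)))"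
  have c: "0 \<le> ?c" by (simp add: Gamma_real_pos less_imp_le)
  have gf0: "0 \<le> gfun l ls" for l ls by (simp add: gfun_def Let_def)
  have gf: "ennreal (?gf I) = (\<integral>\<^sup>+z. ennreal (normal_density 0 (1 / ?s I) z) * (\<Prod>j\<in>K - I. Phi (\<tau> j * z)) \<partial>lborel)"
    if I: "I \<in> ?A" for I
  proof -
    let ?js = "sorted_list_of_set (K - I)"
    let ?ls = "map (\<lambda>j. (\<tau> j)\<^sup>2) ?js"
    have js: "set ?js = K - I" "distinct ?js" using K(1) by auto
    have "I \<noteq> {}" "finite I" using I K(1) finite_subset by auto
    then have "0 < (\<Sum>i\<in>I. (\<tau> i)\<^sup>2)" using I pos by (intro sum_pos) force+
    moreover have "\<forall>i<length ?ls. 0 < ?ls ! i"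
    proof (intro allI impI)
      fix i assume "i < length ?ls"
      then have "?js ! i \<in> set ?js" by (intro nth_mem) simp
      then have "?js ! i \<in> K - I" by (simp only: js(1))
      then have "0 < \<tau> (?js ! i)" using pos by blast
      then show "0 < ?ls ! i" using \<open>i < length ?ls\<close> by simp
    qed
    ultimately have E: "ennreal (?gf I) =
      (\<integral>\<^sup>+z. ennreal (normal_density 0 (1 / ?s I) z) * (\<Prod>i<length ?ls. Phi (sqrt (?ls ! i) * z)) \<partial>lborel)"
      by (rule gfun_eq)
    \<comment> \<open>The sorted list only fixes an order for a symmetric product, and
      \<open>sqrt\<close> undoes the square since the \<open>\<tau> j\<close> are positive.\<close>
    have P: "(\<Prod>i<length ?ls. Phi (sqrt (?ls ! i) * z)) = (\<Prod>j\<in>K - I. Phi (\<tau> j * z))" for z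
    proof -
      have "(\<Prod>i<length ?ls. Phi (sqrt (?ls ! i) * z)) = (\<Prod>i<length ?js. Phi (sqrt ((\<tau> (?js ! i))\<^sup>2) * z))"
        by (intro prod.cong) simp_all
      also have "\<dots> = (\<Prod>j\<in>K - I. Phi (sqrt ((\<tau> j)\<^sup>2) * z))"
        by (rule prod.reindex_bij_betw[OF bij_betw_nth[OF js(2) refl js(1)[symmetric]]])
      also have "\<dots> = (\<Prod>j\<in>K - I. Phi (\<tau> j * z))"
        using pos by (intro prod.cong) (auto simp: less_imp_le)
      finally show ?thesis .
    qed
    show ?thesis using E by (simp only: P)
  qed
  have "(\<integral>\<^sup>+x. ennreal (V x) \<partial>?G) = (\<integral>\<^sup>+x. (\<Sum>I\<in>?A. ennreal (w I) * (\<integral>\<^sup>+u. H I x u \<partial>?U)) \<partial>?G)"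
    by (rule nn_integral_cong) (rule V)
  also have "\<dots> = (\<Sum>I\<in>?A. \<integral>\<^sup>+x. ennreal (w I) * (\<integral>\<^sup>+u. H I x u \<partial>?U) \<partial>?G)"
    using mHx by (intro nn_integral_sum borel_measurable_times_ennreal) auto
  also have "\<dots> = (\<Sum>I\<in>?A. ennreal (w I) * (\<integral>\<^sup>+x. \<integral>\<^sup>+u. H I x u \<partial>?U \<partial>?G))"
    using mHx by (intro sum.cong refl nn_integral_cmult)
  also have "\<dots> = (\<Sum>I\<in>?A. ennreal (w I * (?c * ?s I * ?gf I)))"
  proof (rule sum.cong[OF refl])
    fix I assume I: "I \<in> ?A"
    have "(\<integral>\<^sup>+x. \<integral>\<^sup>+u. H I x u \<partial>?U \<partial>?G) = ennreal (?c * ?s I) * ennreal (?gf I)"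
      unfolding H_def gf[OF I] d using I by (intro nn_integral_upper_simplex[OF K(1) pos]) auto
    also have "\<dots> = ennreal (?c * ?s I * ?gf I)"
      using c gf0 by (intro ennreal_mult[symmetric] mult_nonneg_nonneg) (auto intro!: sum_nonneg)
    finally show "ennreal (w I) * (\<integral>\<^sup>+x. \<integral>\<^sup>+u. H I x u \<partial>?U \<partial>?G) = ennreal (w I * (?c * ?s I * ?gf I))"
      using w[OF I] c gf0 by (simp only:) (intro ennreal_mult[symmetric] mult_nonneg_nonneg, auto intro!: sum_nonneg)
  qed
  also have "\<dots> = ennreal (\<Sum>I\<in>?A. w I * (?c * ?s I * ?gf I))"
    using w c gf0 by (intro sum_ennreal mult_nonneg_nonneg) (auto intro!: sum_nonneg)
  finally have nnV: "(\<integral>\<^sup>+x. ennreal (V x) \<partial>?G) = ennreal (\<Sum>I\<in>?A. w I * (?c * ?s I * ?gf I))" .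
  have rv: "g i \<in> borel_measurable M" "distr M borel (g i) = ?g" if "i \<in> K" for i
    using prob_space_std_gaussian_distr[OF M gauss[of i]] that by (simp_all add: K_def)
  have mg: "(\<lambda>\<omega>. \<lambda>i\<in>K. g i \<omega>) \<in> measurable M (PiM K (\<lambda>_. borel))"
    using rv(1) by (intro measurable_restrict)
  \<comment> \<open>Only the joint law of the \<open>g i\<close> enters the expectation;
    independence and the individual laws identify it with the product of \<open>gauss\<close> over
    \<open>K\<close>.\<close>
  have "distr M (PiM K (\<lambda>_. borel)) (\<lambda>\<omega>. \<lambda>i\<in>K. g i \<omega>) = PiM K (\<lambda>i. distr M borel (g i))"
    using M.indep_vars_iff_distr_eq_PiM'[OF K(2), of g "\<lambda>_. borel"] rv(1) indep by (simp add: K_def)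
  also have "\<dots> = ?G" by (rule PiM_cong) (simp_all add: rv(2))
  finally have law: "distr M (PiM K (\<lambda>_. borel)) (\<lambda>\<omega>. \<lambda>i\<in>K. g i \<omega>) = ?G" .
  have mV': "V \<in> borel_measurable (PiM K (\<lambda>_. borel))"
  proof -
    have "sets ?G = sets (PiM K (\<lambda>_. borel :: (real ^ 'd) measure))" by (rule sets_PiM_cong) simp_all
    then show ?thesis using mV measurable_cong_sets[of ?G _ borel borel] by blast
  qed
  have "(\<lambda>i. (\<lambda>i\<in>K. g i \<omega>) i /\<^sub>R \<tau> i) ` K = (\<lambda>i. g i \<omega> /\<^sub>R \<tau> i) ` K" for \<omega>
    by (rule image_cong) simp_all
  then have "M.expectation (\<lambda>\<omega>. measure lborel (convex hull ((\<lambda>i. g i \<omega> /\<^sub>R \<tau> i) ` {1..n}))) =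
    M.expectation (\<lambda>\<omega>. V (\<lambda>i\<in>K. g i \<omega>))"
    by (simp only: V_def) (simp only: K_def)
  also have "\<dots> = integral\<^sup>L ?G V"
    unfolding law[symmetric] by (rule integral_distr[OF mg mV', symmetric])
  also have "\<dots> = enn2real (\<integral>\<^sup>+x. ennreal (V x) \<partial>?G)"
    by (rule integral_eq_nn_integral[OF mV]) (simp add: V_def)
  also have "\<dots> = (\<Sum>I\<in>?A. w I * (?c * ?s I * ?gf I))"
    unfolding nnV using w c gf0
    by (intro enn2real_ennreal sum_nonneg mult_nonneg_nonneg) (auto intro!: sum_nonneg)
  also have "\<dots> = 2 powr (real d / 2) * Gamma ((real d + 1) / 2) / (sqrt pi * fact d) *
         (\<Sum>I\<in>?A. ?s I / (\<Prod>i\<in>I. \<tau> i) * ?gf I)"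
    unfolding sum_distrib_left w_def d by (intro sum.cong refl) (simp add: mult_ac)
  finally show ?thesis by (simp only: K_def d)
qed

end
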